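(* Let $H\ge 0$. Every rotational surface of constant mean curvature $H$ in the unit sphere $\mathbb{S}^3\subset\mathbb{R}^4$ is given, with respect to a suitable orthonormal basis of $\mathbb{R}^4$, by $$(\theta,t)\mapsto\Big(r(t)\cos\theta,\ r(t)\sin\theta,\ \sqrt{1-r^2(t)}\cos\psi(t),\ \sqrt{1-r^2(t)}\sin\psi(t)\Big)$$ with $$r(t)=\sqrt{C_1}\,\operatorname{dn}_p(\Xi t),\qquad p^2=\frac{C_1-C_2}{C_1}\in[0,1],$$ $$\psi(t)=Ht-\frac{C-H}{C_1-1}\,\frac1\Xi\,\Pi_p\!\left(\frac{C_1-C_2}{C_1-1};\,\Xi t\right)$$ (with $\psi(t)=Ht$ in the special case $C_1=1$), where $\Xi=\sqrt{(H^2+1)C_1}$, $C\in\mathbb{R}$ is a constant, and $C_1>C_2$ are the non-negative roots of the polynomial $$p_C(x)=(H^2+1)x^2-(1+2HC)x+C^2.$$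
   Context: Mean curvature is $H=\frac{\kappa_1+\kappa_2}{2}$, with $\kappa_1,\kappa_2$ the principal curvatures; the orientation of the unit normal is always chosen such that $H\ge 0$. A surface in $\mathbb{S}^3$ is rotational if it is invariant under a 1-parameter group of rotations of $\mathbb{R}^4$ that acts on a 2-plane and as the identity on the orthogonal complement of that plane. The constant $C$ is restricted to values for which $p_C$ has non-negative real roots. $\operatorname{sn}_p,\operatorname{cn}_p,\operatorname{dn}_p$ denote the Jacobi elliptic functions with modulus $p$, and $\Pi_p(k;s)=\int_0^s\frac{du}{1-k\,\operatorname{sn}_p^2(u)}$ is the incomplete elliptic integral of the third kind.
   Formalization: C_1=C_2 is allowed (needed for tori); if C=0, points on the rotation axis (poles of spheres) are left out; if C_1=1, the last two basis vectors change sign where sn_p(Ξt)<0, since the literal formula fails across r=1; surfaces are connected and t runs over an open interval. *)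

theory Defs
  imports "HOL-Analysis.Analysis" "HOL-Computational_Algebra.Polynomial"
begin

section \<open>Jacobi elliptic functions\<close>

definition elliptic_F :: "real \<Rightarrow> real \<Rightarrow> real" where
  "elliptic_F p \<phi> = (LBINT \<theta>=0..\<phi>. 1 / sqrt (1 - p\<^sup>2 * (sin \<theta>)\<^sup>2))"

text \<open>The amplitude inverts the integral of the first kind, for moduli \<open>0 \<le> p \<le> 1\<close>.
  For \<open>p < 1\<close> the integral is a bijection of the real line. For \<open>p = 1\<close> it diverges at
  \<open>\<plusminus>\<pi>/2\<close>, and it is a bijection from the open interval between these points onto the line.\<close>

definition jacobi_am :: "real \<Rightarrow> real \<Rightarrow> real" where
  "jacobi_am p u = (THE \<phi>. (p < 1 \<or> \<bar>\<phi>\<bar> < pi / 2) \<and> elliptic_F p \<phi> = u)"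

definition jacobi_sn :: "real \<Rightarrow> real \<Rightarrow> real" where
  "jacobi_sn p u = sin (jacobi_am p u)"

definition jacobi_dn :: "real \<Rightarrow> real \<Rightarrow> real" where
  "jacobi_dn p u = sqrt (1 - p\<^sup>2 * (jacobi_sn p u)\<^sup>2)"

definition elliptic_Pi :: "real \<Rightarrow> real \<Rightarrow> real \<Rightarrow> real" where
  "elliptic_Pi p k s = (LBINT u=0..s. 1 / (1 - k * (jacobi_sn p u)\<^sup>2))"


section \<open>Immersed surfaces in the unit sphere of \<open>\<real>\<^sup>4\<close>\<close>

definition dir_deriv :: "(real^2 \<Rightarrow> real^4) \<Rightarrow> real^2 \<Rightarrow> real^2 \<Rightarrow> real^4" where
  "dir_deriv g v x = frechet_derivative g (at x) v"

definition C2_on :: "(real^2) set \<Rightarrow> (real^2 \<Rightarrow> real^4) \<Rightarrow> bool" where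
  "C2_on U g \<longleftrightarrow> g differentiable_on U \<and>
     (\<forall>v. dir_deriv g v differentiable_on U) \<and>
     (\<forall>v w. continuous_on U (dir_deriv (dir_deriv g v) w))"

text \<open>A surface is given by a space \<open>M\<close> and a map \<open>f\<close> which near every point of \<open>M\<close> is,
  after composition with a local homeomorphism \<open>\<phi>\<close> from an open subset of the plane, a
  regular parametrization. No atlas has to be specified separately: two regular
  parametrizations of this kind are automatically related by a \<open>C\<^sup>2\<close> change of parameters.\<close>

definition local_param ::
  "'m::topological_space set \<Rightarrow> ('m \<Rightarrow> real^4) \<Rightarrow> (real^2) set \<Rightarrow> (real^2 \<Rightarrow> 'm) \<Rightarrow> bool" where
  "local_param M f U \<phi> \<longleftrightarrow>
     open U \<and> openin (top_of_set M) (\<phi> ` U) \<and> (\<exists>\<phi>'. homeomorphism U (\<phi> ` U) \<phi> \<phi>') \<and>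
     C2_on U (f \<circ> \<phi>) \<and> (\<forall>x\<in>U. inj (\<lambda>v. dir_deriv (f \<circ> \<phi>) v x))"

definition immersed_surface_S3 ::
  "'m::{t2_space,second_countable_topology} set \<Rightarrow> ('m \<Rightarrow> real^4) \<Rightarrow> bool" where
  "immersed_surface_S3 M f \<longleftrightarrow>
     M \<noteq> {} \<and> connected M \<and> f ` M \<subseteq> sphere 0 1 \<and>
     (\<forall>m\<in>M. \<exists>U \<phi>. local_param M f U \<phi> \<and> m \<in> \<phi> ` U)"

definition fund1 :: "(real^2 \<Rightarrow> real^4) \<Rightarrow> real^2 \<Rightarrow> real^2 \<Rightarrow> real^2 \<Rightarrow> real" where
  "fund1 g x v w = dir_deriv g v x \<bullet> dir_deriv g w x"

definition unit_normal :: "(real^2 \<Rightarrow> real^4) \<Rightarrow> real^2 \<Rightarrow> real^4 \<Rightarrow> bool" where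
  "unit_normal g x n \<longleftrightarrow> norm n = 1 \<and> n \<bullet> g x = 0 \<and> (\<forall>v. n \<bullet> dir_deriv g v x = 0)"

definition fund2 ::
  "(real^2 \<Rightarrow> real^4) \<Rightarrow> real^2 \<Rightarrow> real^4 \<Rightarrow> real^2 \<Rightarrow> real^2 \<Rightarrow> real" where
  "fund2 g x n v w = dir_deriv (dir_deriv g v) w x \<bullet> n"

definition principal_curvatures ::
  "(real^2 \<Rightarrow> real^4) \<Rightarrow> real^2 \<Rightarrow> real^4 \<Rightarrow> real \<Rightarrow> real \<Rightarrow> bool" where
  "principal_curvatures g x n \<kappa>1 \<kappa>2 \<longleftrightarrow>
     (\<exists>v w. fund1 g x v v = 1 \<and> fund1 g x w w = 1 \<and> fund1 g x v w = 0 \<and>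
            fund2 g x n v v = \<kappa>1 \<and> fund2 g x n w w = \<kappa>2 \<and> fund2 g x n v w = 0)"

text \<open>The existential over \<open>n\<close> is the choice of orientation making the mean curvature
  non-negative: there are only two unit normals at each point, and the mean curvature
  changes sign with the normal. For \<open>H > 0\<close> the chosen normal is unique, hence continuous.\<close>

definition constant_mean_curvature ::
  "'m::topological_space set \<Rightarrow> ('m \<Rightarrow> real^4) \<Rightarrow> real \<Rightarrow> bool" where
  "constant_mean_curvature M f H \<longleftrightarrow>
     (\<forall>U \<phi>. local_param M f U \<phi> \<longrightarrow>
       (\<forall>x\<in>U. \<exists>n \<kappa>1 \<kappa>2. unit_normal (f \<circ> \<phi>) x n \<and>
          principal_curvatures (f \<circ> \<phi>) x n \<kappa>1 \<kappa>2 \<and> H = (\<kappa>1 + \<kappa>2) / 2))"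


section \<open>Rotational surfaces\<close>

text \<open>Rotation by the angle \<open>\<phi>\<close> in the plane with orthonormal basis \<open>a\<close>, \<open>b\<close>; it is the
  identity on the orthogonal complement of that plane.\<close>

definition rot :: "real^4 \<Rightarrow> real^4 \<Rightarrow> real \<Rightarrow> real^4 \<Rightarrow> real^4" where
  "rot a b \<phi> x = x - (x \<bullet> a) *\<^sub>R a - (x \<bullet> b) *\<^sub>R b
     + (cos \<phi> * (x \<bullet> a) - sin \<phi> * (x \<bullet> b)) *\<^sub>R a
     + (sin \<phi> * (x \<bullet> a) + cos \<phi> * (x \<bullet> b)) *\<^sub>R b"

definition rotational :: "(real^4) set \<Rightarrow> bool" where
  "rotational S \<longleftrightarrow>
     (\<exists>a b. norm a = 1 \<and> norm b = 1 \<and> a \<bullet> b = 0 \<and> (\<forall>\<phi>. rot a b \<phi> ` S = S))"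


section \<open>The parametrization\<close>

definition orthonormal_basis :: "(4 \<Rightarrow> real^4) \<Rightarrow> bool" where
  "orthonormal_basis e \<longleftrightarrow> (\<forall>i j. e i \<bullet> e j = (if i = j then 1 else 0))"

definition p_poly :: "real \<Rightarrow> real \<Rightarrow> real poly" where
  "p_poly H C = [: C\<^sup>2, - (1 + 2 * H * C), H\<^sup>2 + 1 :]"

definition radius :: "real \<Rightarrow> real \<Rightarrow> real \<Rightarrow> real \<Rightarrow> real" where
  "radius C1 p \<Xi> t = sqrt C1 * jacobi_dn p (\<Xi> * t)"

definition angle :: "real \<Rightarrow> real \<Rightarrow> real \<Rightarrow> real \<Rightarrow> real \<Rightarrow> real \<Rightarrow> real \<Rightarrow> real" where
  "angle H C C1 C2 p \<Xi> t =
     (if C1 = 1 then H * t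
      else H * t - (C - H) / (C1 - 1) * (1 / \<Xi>) * elliptic_Pi p ((C1 - C2) / (C1 - 1)) (\<Xi> * t))"

definition rot_param ::
  "(4 \<Rightarrow> real^4) \<Rightarrow> (real \<Rightarrow> real) \<Rightarrow> (real \<Rightarrow> real) \<Rightarrow> real \<Rightarrow> real \<Rightarrow> real^4" where
  "rot_param e r \<psi> \<theta> t =
     (r t * cos \<theta>) *\<^sub>R e 1 + (r t * sin \<theta>) *\<^sub>R e 2
     + (sqrt (1 - (r t)\<^sup>2) * cos (\<psi> t)) *\<^sub>R e 3 + (sqrt (1 - (r t)\<^sup>2) * sin (\<psi> t)) *\<^sub>R e 4"

text \<open>For \<open>C1 = 1\<close> one has \<open>sqrt (1 - r\<^sup>2) = p * \<bar>sn\<bar>\<close>: at the zeros of \<open>sn\<close> the profile curve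
  passes through \<open>r = 1\<close>, the pole of the polar coordinates \<open>(sqrt (1 - r\<^sup>2), \<psi>)\<close>, and the polar
  angle of the smooth curve jumps by \<open>\<pi>\<close>. The formula \<open>\<psi> = H t\<close> therefore describes the
  surface on each interval between consecutive zeros of \<open>sn\<close>, in an orthonormal basis whose last
  two vectors change sign from one interval to the next. For \<open>C1 \<noteq> 1\<close> the basis is the same for
  all \<open>t\<close>.\<close>

definition basis_at :: "(4 \<Rightarrow> real^4) \<Rightarrow> real \<Rightarrow> real \<Rightarrow> real \<Rightarrow> real \<Rightarrow> 4 \<Rightarrow> real^4" where
  "basis_at e C1 p \<Xi> t =
     (if C1 = 1 \<and> jacobi_sn p (\<Xi> * t) < 0
      then (\<lambda>i. if i \<in> {3, 4} then - e i else e i) else e)"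

definition rot_axis :: "(4 \<Rightarrow> real^4) \<Rightarrow> (real^4) set" where
  "rot_axis e = {x. x \<bullet> e 1 = 0 \<and> x \<bullet> e 2 = 0}"

end

(* Fix an orthonormal basis a, b, c, d of R^4 with the rotations acting on span(a, b), and write y
   for a point of the surface, n for the unit normal, x = (y.a)^2 + (y.b)^2 for the squared distance
   from the axis and z = (y.c) + i (y.d). The cone over the surface is negligible, so by an open
   mapping argument the rotation field is tangent to the surface. Together with the value of H this
   determines the shape operator in the conformal frame (K, V), where K is the rotation field and
   V is orthogonal to it. Hence C = H x + <y_ab, n_ab> is constant and, along V, the quantities
   x, del = x'/(2x), z and v = z' satisfy the autonomous system
     x' = 2 x del,  del' = C^2/x - (1 + H^2) x,  z' = v,  v' = 2 del v + 2 i C (v - del z),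
   which is regular where z vanishes, unlike the polar angle psi. The profile built from the
   Jacobi functions solves it too, and some value of it agrees with the initial state at a point of
   the surface up to a rotation of the (c, d)-plane. By uniqueness for the system, the set of points
   that match the model is open and closed off the axis; points on the axis are isolated, so that
   the complement of the axis stays connected, and they force C = 0. *)
theory Submission
  imports Defs
begin

section \<open>The amplitude and the Jacobi elliptic functions\<close>

text \<open>Only the image of \<open>f\<close> is assumed invariant. The immersion may intersect
  itself and \<open>M\<close> carries no action, so orbits cannot be followed on \<open>M\<close>;
  the rotation field is compared with the surface in R^4 itself. There is no global normal either:
  each chart has its own, and \<open>C\<close> may change with it. For H > 0 normals of overlapping
  charts are shown to agree off the axis, with coordinate changes treated as merely continuous; for
  H = 0 both orientations are admissible and the sign is chosen per chart. No integral curves are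
  constructed: states are transported along straight segments of a chart, where the motion along
  \<open>K\<close> drops out of the system and the motion along \<open>V\<close> is the rate of the
  model time. That time need not be a function on the surface, so matching is a relation between
  points and times, and \<open>J\<close> is a component of the set of attained times. The polynomial
  enters through a first integral: \<open>x * del\<^sup>2 = - poly (p_poly H C) x\<close> confines
  \<open>x\<close> to the range between the roots.\<close>

lemma interval_integral_has_derivative:
  fixes h :: "real \<Rightarrow> real"
  assumes "open A" "convex A" "0 \<in> A" "x \<in> A" "continuous_on A h"
  shows "((\<lambda>u. LBINT s=0..u. h s) has_real_derivative h x) (at x)"
proof -
  obtain e where e: "e > 0" "cball x e \<subseteq> A"
    using assms(1,4) open_contains_cball by blast
  \<comment> \<open>The compact interval contains the base point \<open>0\<close> and a
    neighbourhood of \<open>x\<close>; the latter turns the derivative within the interval into a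
    derivative at \<open>x\<close>.\<close>
  define a where "a = min 0 (x - e)"
  define b where "b = max 0 (x + e)"
  have ab: "a \<in> A" "b \<in> A"
    using e assms(3) by (auto simp: a_def b_def min_def max_def subset_iff dist_real_def)
  have sub: "{a..b} \<subseteq> A"
    using convex_contains_segment[of A] assms(2) ab e
    by (metis a_def b_def closed_segment_eq_real_ivl max.coboundedI1 min.coboundedI1 order.refl)
  have "((\<lambda>u. LBINT s=ereal 0..ereal u. h s) has_vector_derivative h x) (at x within {a..b})"
    using e by (intro interval_integral_FTC2 continuous_on_subset[OF assms(5) sub])
      (auto simp: a_def b_def)
  moreover have "x \<in> interior {a..b}"
    using e(1) by (simp only: interior_atLeastAtMost_real greaterThanLessThan_iff a_def b_def) linarith
  ultimately show ?thesis
    by (simp only: has_real_derivative_iff_has_vector_derivative at_within_interior zero_ereal_def)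
qed

definition am_range :: "real \<Rightarrow> real set" where
  "am_range p = {\<phi>. p < 1 \<or> \<bar>\<phi>\<bar> < pi / 2}"

lemma am_range: "open (am_range p)" "convex (am_range p)" "0 \<in> am_range p"
proof -
  have "am_range p = (if p < 1 then UNIV else {- (pi/2) <..< pi/2})"
    by (auto simp: am_range_def)
  then show "open (am_range p)" "convex (am_range p)" "0 \<in> am_range p" by auto
qed

lemma am_range_pos:
  assumes "0 \<le> p" "p \<le> 1" "\<phi> \<in> am_range p"
  shows "0 < 1 - p\<^sup>2 * (sin \<phi>)\<^sup>2"
proof (cases "p < 1")
  case True
  have "p\<^sup>2 * (sin \<phi>)\<^sup>2 \<le> p\<^sup>2 * 1"
    by (intro mult_left_mono) (auto simp: abs_square_le_1)
  also have "\<dots> < 1" using True assms by (simp add: power_less_one_iff abs_square_less_1)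
  finally show ?thesis by simp
next
  case False
  then have "p = 1" "cos \<phi> > 0" using assms by (auto simp: am_range_def intro!: cos_gt_zero_pi)
  then have "0 < (cos \<phi>)\<^sup>2" by simp
  then show ?thesis using sin_cos_squared_add[of \<phi>] \<open>p = 1\<close>
    by (simp only: power_one mult_1)
qed

lemma elliptic_F_has_derivative:
  assumes "0 \<le> p" "p \<le> 1" "\<phi> \<in> am_range p"
  shows "(elliptic_F p has_real_derivative 1 / sqrt (1 - p\<^sup>2 * (sin \<phi>)\<^sup>2)) (at \<phi>)"
proof -
  have "continuous_on (am_range p) (\<lambda>\<theta>. 1 / sqrt (1 - p\<^sup>2 * (sin \<theta>)\<^sup>2))"
    using am_range_pos[OF assms(1,2)] by (intro continuous_intros) force
  from interval_integral_has_derivative[OF am_range assms(3) this]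
  show ?thesis by (simp add: elliptic_F_def[abs_def])
qed

lemma elliptic_F_0 [simp]: "elliptic_F p 0 = 0"
  by (simp add: elliptic_F_def flip: zero_ereal_def)

lemma elliptic_F_mono:
  assumes "0 \<le> p" "p \<le> 1" "x \<in> am_range p" "y \<in> am_range p" "x < y"
  shows "elliptic_F p x < elliptic_F p y"
proof -
  have "{x..y} \<subseteq> am_range p" using assms by (auto simp: am_range_def)
  then show ?thesis using am_range_pos[OF assms(1,2)] elliptic_F_has_derivative[OF assms(1,2)]
    by (intro DERIV_pos_imp_increasing[OF assms(5)])
      (metis atLeastAtMost_iff divide_pos_pos real_sqrt_gt_zero subsetD zero_less_one)
qed

text \<open>For \<open>p < 1\<close> the integrand is at least 1, so
  \<open>elliptic_F p s - s\<close> is nondecreasing and the value \<open>u\<close> is attained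
  between \<open>- \<bar>u\<bar>\<close> and \<open>\<bar>u\<bar>\<close>. For \<open>p = 1\<close>
  the integrand is \<open>1 / cos\<close>, the integral is \<open>artanh (sin \<phi>)\<close>, and
  the preimage is the Gudermannian \<open>arcsin (tanh u)\<close>.\<close>

lemma elliptic_F_surj:
  assumes "0 \<le> p" "p \<le> 1"
  shows "\<exists>\<phi>\<in>am_range p. elliptic_F p \<phi> = u"
proof (cases "p < 1")
  case True
  have inr: "\<phi> \<in> am_range p" for \<phi> using True by (simp add: am_range_def)
  have d: "((\<lambda>s. elliptic_F p s - s) has_real_derivative 1 / sqrt (1 - p\<^sup>2 * (sin \<phi>)\<^sup>2) - 1) (at \<phi>)" for \<phi>
    by (intro DERIV_diff elliptic_F_has_derivative assms inr DERIV_ident)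
  have d0: "1 / sqrt (1 - p\<^sup>2 * (sin \<phi>)\<^sup>2) - 1 \<ge> 0" for \<phi>
    using am_range_pos[OF assms inr] by (simp add: field_simps)
  have m: "elliptic_F p x - x \<le> elliptic_F p y - y" if "x \<le> y" for x y
    using DERIV_nonneg_imp_nondecreasing[OF that, of "\<lambda>s. elliptic_F p s - s"] d d0 by blast
  have "continuous_on {-\<bar>u\<bar>..\<bar>u\<bar>} (elliptic_F p)"
    by (intro continuous_at_imp_continuous_on ballI)
      (rule DERIV_isCont[OF elliptic_F_has_derivative[OF assms inr]])
  then have "\<exists>\<phi>. -\<bar>u\<bar> \<le> \<phi> \<and> \<phi> \<le> \<bar>u\<bar> \<and> elliptic_F p \<phi> = u"
    using m[of 0 "\<bar>u\<bar>"] m[of "-\<bar>u\<bar>" 0] by (intro IVT') auto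
  then show ?thesis using inr by blast
next
  case False
  then have p: "p = 1" using assms by simp
  have c: "sqrt (1 - (sin \<phi>)\<^sup>2) = cos \<phi>" if "\<phi> \<in> am_range 1" for \<phi>
    using that by (simp add: am_range_def cos_squared_eq[symmetric] cos_ge_zero)
  have "elliptic_F 1 \<phi> = artanh (sin \<phi>)" if "\<phi> \<in> am_range 1" for \<phi>
  proof -
    have "((\<lambda>s. elliptic_F 1 s - artanh (sin s)) has_real_derivative 0) (at s within am_range 1)"
      if s: "s \<in> am_range 1" for s
    proof -
      have cp: "cos s > 0" using s by (auto simp: am_range_def intro!: cos_gt_zero_pi)
      then have "0 < (cos s)\<^sup>2" by simp
      then have "(sin s)\<^sup>2 < 1" using sin_cos_squared_add[of s] by linarith
      then have "\<bar>sin s\<bar> < 1" by (simp add: abs_square_less_1)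
      moreover have "(elliptic_F 1 has_real_derivative 1 / cos s) (at s)"
        using elliptic_F_has_derivative[of 1 s] s c by simp
      ultimately have "((\<lambda>s. elliptic_F 1 s - artanh (sin s)) has_real_derivative
          1 / cos s - 1 / (1 - (sin s)\<^sup>2) * cos s) (at s)"
        by (intro DERIV_diff DERIV_chain2[OF artanh_real_has_field_derivative] DERIV_sin)
      moreover have "1 / cos s - 1 / (1 - (sin s)\<^sup>2) * cos s = 0"
        using cp by (simp only: sin_squared_eq) (simp add: power2_eq_square)
      ultimately have "((\<lambda>s. elliptic_F 1 s - artanh (sin s)) has_real_derivative 0) (at s)"
        by simp
      then show ?thesis by (rule has_field_derivative_at_within)
    qed
    from has_field_derivative_zero_constant[OF am_range(2) this] obtain c
      where c: "\<And>s. s \<in> am_range 1 \<Longrightarrow> elliptic_F 1 s - artanh (sin s) = c" by blast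
    show ?thesis using c[OF am_range(3)] c[OF that] by simp
  qed
  moreover have tb: "-1 < tanh u" "tanh u < 1" using tanh_real_bounds[of u] by simp_all
  have "- (pi / 2) < arcsin (tanh u) \<and> arcsin (tanh u) < pi / 2"
    by (rule arcsin_lt_bounded[OF tb])
  then have r: "arcsin (tanh u) \<in> am_range 1" by (auto simp only: am_range_def mem_Collect_eq abs_less_iff)
  have "sin (arcsin (tanh u)) = tanh u"
    by (rule sin_arcsin) (use tb in linarith)+
  ultimately have "elliptic_F 1 (arcsin (tanh u)) = u"
    using r by (simp only: artanh_tanh_real)
  with r show ?thesis unfolding p by (rule bexI[rotated])
qed

lemma jacobi_am_unique:
  assumes "0 \<le> p" "p \<le> 1" "\<phi> \<in> am_range p"
  shows "jacobi_am p (elliptic_F p \<phi>) = \<phi>"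
proof -
  have "\<psi> = \<phi>" if "\<psi> \<in> am_range p" "elliptic_F p \<psi> = elliptic_F p \<phi>" for \<psi>
  proof (rule ccontr)
    assume "\<psi> \<noteq> \<phi>"
    then consider "\<psi> < \<phi>" | "\<phi> < \<psi>" by linarith
    then show False
      using elliptic_F_mono[OF assms(1,2) that(1) assms(3)]
        elliptic_F_mono[OF assms(1,2) assms(3) that(1)] that(2)
      by cases simp_all
  qed
  then show ?thesis unfolding jacobi_am_def
    using assms(3) by (intro the_equality) (auto simp: am_range_def)
qed

lemma jacobi_am:
  assumes "0 \<le> p" "p \<le> 1"
  shows "jacobi_am p u \<in> am_range p" "elliptic_F p (jacobi_am p u) = u"
proof -
  obtain \<phi> where \<phi>: "\<phi> \<in> am_range p" "elliptic_F p \<phi> = u"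
    using elliptic_F_surj[OF assms, of u] by (rule bexE)
  have "jacobi_am p u = \<phi>" using jacobi_am_unique[OF assms \<phi>(1)] by (simp only: \<phi>(2))
  with \<phi> show "jacobi_am p u \<in> am_range p" "elliptic_F p (jacobi_am p u) = u" by simp_all
qed

lemma jacobi_dn_pos:
  assumes "0 \<le> p" "p \<le> 1"
  shows "jacobi_dn p u > 0"
  using am_range_pos[OF assms jacobi_am(1)[OF assms, of u]] by (simp add: jacobi_dn_def jacobi_sn_def)

lemma jacobi_dn_squared:
  assumes "0 \<le> p" "p \<le> 1"
  shows "(jacobi_dn p u)\<^sup>2 = 1 - p\<^sup>2 * (sin (jacobi_am p u))\<^sup>2"
  using am_range_pos[OF assms jacobi_am(1)[OF assms, of u]] by (simp add: jacobi_dn_def jacobi_sn_def)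

text \<open>Inverse function theorem for \<open>elliptic_F p\<close>: the reciprocal of its
  integrand, taken at the amplitude, is \<open>jacobi_dn\<close>.\<close>

lemma jacobi_am_has_derivative:
  assumes "0 \<le> p" "p \<le> 1"
  shows "(jacobi_am p has_real_derivative jacobi_dn p u) (at u)"
proof -
  let ?\<phi> = "jacobi_am p u" and ?D = "\<lambda>\<phi>. 1 / sqrt (1 - p\<^sup>2 * (sin \<phi>)\<^sup>2)"
  have nz: "?D ?\<phi> \<noteq> 0" using am_range_pos[OF assms jacobi_am(1)[OF assms, of u]] by auto
  have "(jacobi_am p has_derivative (*) (inverse (?D ?\<phi>))) (at (elliptic_F p ?\<phi>))"
  proof (rule has_derivative_inverse_strong[where S = "am_range p" and f = "elliptic_F p" and x = ?\<phi>])
    show "continuous_on (am_range p) (elliptic_F p)"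
      by (intro continuous_at_imp_continuous_on ballI)
        (rule DERIV_isCont[OF elliptic_F_has_derivative[OF assms]])
    show "(elliptic_F p has_derivative (*) (?D ?\<phi>)) (at ?\<phi>)"
      using elliptic_F_has_derivative[OF assms jacobi_am(1)[OF assms]]
      unfolding has_field_derivative_def .
    show "(*) (?D ?\<phi>) \<circ> (*) (inverse (?D ?\<phi>)) = id" using nz by (auto simp: fun_eq_iff)
  qed (use am_range jacobi_am[OF assms] jacobi_am_unique[OF assms] in auto)
  then show ?thesis
    by (simp add: jacobi_am(2)[OF assms] has_field_derivative_def jacobi_dn_def jacobi_sn_def)
qed

section \<open>The differential system of the profile curve\<close>

text \<open>With \<open>K\<close> a bound of \<open>k\<close>, Cauchy-Schwarz bounds the derivative
  of \<open>w \<bullet> w\<close> by \<open>2 * K * (w \<bullet> w)\<close>. Hence \<open>q\<close>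
  does not increase from its initial value 0, while it is nonnegative.\<close>

lemma gronwall_zero:
  fixes w :: "real \<Rightarrow> 'a::real_inner"
  assumes der: "\<And>s. s \<in> {0..1} \<Longrightarrow> (w has_vector_derivative w' s) (at s within {0..1})"
    and bd: "\<And>s. s \<in> {0..1} \<Longrightarrow> norm (w' s) \<le> k s * norm (w s)"
    and cont: "continuous_on {0..1} k" and w0: "w 0 = 0" and s: "s \<in> {0..1}"
  shows "w s = 0"
proof (cases "s = 0")
  case False
  then have s0: "0 < s" using s by simp
  obtain K where K: "\<And>s. s \<in> {0..1} \<Longrightarrow> k s \<le> K"
    using compact_continuous_image[OF cont] compact_imp_bounded bounded_imp_bdd_above bdd_above_def
    by (metis compact_Icc imageI)
  define q where "q = (\<lambda>s. (w s \<bullet> w s) * exp (- (2 * K * s)))"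
  have dq: "(q has_derivative (\<lambda>h. h * ((2 * (w s \<bullet> w' s) - 2 * K * (w s \<bullet> w s)) * exp (- (2 * K * s)))))
      (at s within {0..1})" if "s \<in> {0..1}" for s
    unfolding q_def using der[OF that]
    by (auto intro!: derivative_eq_intros simp: has_vector_derivative_def fun_eq_iff inner_commute algebra_simps)
  have "\<exists>x\<in>{0<..<s}. q s - q 0 = (s - 0) * ((2 * (w x \<bullet> w' x) - 2 * K * (w x \<bullet> w x)) * exp (- (2 * K * x)))"
    using s by (intro mvt_simple[OF s0] has_derivative_subset[OF dq]) auto
  then obtain x where x: "x \<in> {0<..<s}"
    "q s - q 0 = s * ((2 * (w x \<bullet> w' x) - 2 * K * (w x \<bullet> w x)) * exp (- (2 * K * x)))" by auto
  have xi: "x \<in> {0..1}" using x s by auto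
  have "w x \<bullet> w' x \<le> norm (w x) * norm (w' x)" by (rule norm_cauchy_schwarz)
  also have "\<dots> \<le> norm (w x) * (K * norm (w x))"
    by (intro mult_left_mono order_trans[OF bd[OF xi]] mult_right_mono K[OF xi]) auto
  also have "\<dots> = K * (w x \<bullet> w x)" by (simp add: dot_square_norm power2_eq_square)
  finally have "q s - q 0 \<le> 0" unfolding x(2) using s0
    by (intro mult_nonneg_nonpos mult_nonpos_nonneg) auto
  then have "(w s \<bullet> w s) * exp (- (2 * K * s)) \<le> 0" by (simp add: q_def w0)
  then have "w s \<bullet> w s \<le> 0" by (simp only: mult_le_0_iff) (simp add: not_le)
  then show ?thesis using inner_ge_zero[of "w s"] by (metis inner_eq_zero_iff order_antisym)
qed (simp add: w0)

text \<open>The factor \<open>\<beta>\<close> allows an arbitrary parametrization: along a curve on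
  the surface the profile advances at a varying rate, possibly negative or zero. The filter is a
  parameter since the model is differentiated at a point and the curves within
  \<open>{0..1}\<close>.\<close>

definition profile_flow ::
  "real \<Rightarrow> real \<Rightarrow> real \<Rightarrow> (real \<Rightarrow> real) \<Rightarrow> (real \<Rightarrow> real) \<Rightarrow> (real \<Rightarrow> complex) \<Rightarrow> (real \<Rightarrow> complex) \<Rightarrow> real filter \<Rightarrow> real \<Rightarrow> bool"
  where "profile_flow H C \<beta> X D Z V F s \<longleftrightarrow>
    (X has_real_derivative \<beta> * (2 * X s * D s)) F \<and>
    (D has_real_derivative \<beta> * (C\<^sup>2 / X s - (1 + H\<^sup>2) * X s)) F \<and>
    (Z has_vector_derivative of_real \<beta> * V s) F \<and>
    (V has_vector_derivative of_real \<beta> * (2 * of_real (D s) * V s + 2 * \<i> * of_real C * (V s - of_real (D s) * Z s))) F"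

text \<open>The difference of two solutions satisfies the bound of \<open>gronwall_zero\<close>. All
  right-hand sides are polynomial in the state except \<open>C\<^sup>2 / X\<close>, whose difference
  is \<open>- C\<^sup>2 / (X * X')\<close> times that of \<open>X\<close>; positivity of
  \<open>X\<close> and \<open>X'\<close> keeps this coefficient continuous.\<close>

lemma profile_flow_unique:
  assumes f1: "\<And>s. s \<in> {0..1} \<Longrightarrow> profile_flow H C (\<beta> s) X D Z V (at s within {0..1}) s"
    and f2: "\<And>s. s \<in> {0..1} \<Longrightarrow> profile_flow H C (\<beta> s) X' D' Z' V' (at s within {0..1}) s"
    and pos: "\<And>s. s \<in> {0..1} \<Longrightarrow> X s > 0 \<and> X' s > 0"
    and cont: "continuous_on {0..1} \<beta>"
    and init: "X 0 = X' 0" "D 0 = D' 0" "Z 0 = Z' 0" "V 0 = V' 0"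
    and s: "s \<in> {0..1}"
  shows "X s = X' s \<and> D s = D' s \<and> Z s = Z' s \<and> V s = V' s"
proof -
  note F = profile_flow_def has_real_derivative_iff_has_vector_derivative
  have cX: "continuous_on {0..1} X" "continuous_on {0..1} X'" "continuous_on {0..1} D"
    "continuous_on {0..1} D'" "continuous_on {0..1} Z'" "continuous_on {0..1} V'"
    using f1 f2 unfolding F by (meson has_vector_derivative_continuous continuous_on_eq_continuous_within)+
  let ?c = "\<lambda>s. 2 * \<i> * of_real C"
  define w where "w = (\<lambda>s. (X s - X' s, D s - D' s, Z s - Z' s, V s - V' s))"
  define w' where "w' = (\<lambda>s. (\<beta> s * (2 * X s * D s) - \<beta> s * (2 * X' s * D' s),
     \<beta> s * (C\<^sup>2 / X s - (1 + H\<^sup>2) * X s) - \<beta> s * (C\<^sup>2 / X' s - (1 + H\<^sup>2) * X' s),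
     of_real (\<beta> s) * V s - of_real (\<beta> s) * V' s,
     of_real (\<beta> s) * (2 * of_real (D s) * V s + 2 * \<i> * of_real C * (V s - of_real (D s) * Z s))
     - of_real (\<beta> s) * (2 * of_real (D' s) * V' s + 2 * \<i> * of_real C * (V' s - of_real (D' s) * Z' s))))"
  \<comment> \<open>The sum of the four coefficients in the component estimates \<open>b1\<close> to
    \<open>b4\<close>.\<close>
  define k where "k = (\<lambda>s. \<bar>\<beta> s\<bar> * ((2 * \<bar>X s\<bar> + 2 * \<bar>D' s\<bar>) + (C\<^sup>2 / (X s * X' s) + (1 + H\<^sup>2)) + 1
     + (2 * \<bar>D s\<bar> + 2 * norm (V' s) + 2 * \<bar>C\<bar> * (1 + \<bar>D s\<bar> + norm (Z' s)))))"
  have "w s = 0"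
  proof (rule gronwall_zero[where w' = w' and k = k])
    show "(w has_vector_derivative w' s) (at s within {0..1})" if "s \<in> {0..1}" for s
      unfolding w_def w'_def
      using f1[OF that] f2[OF that] unfolding F
      by (intro has_vector_derivative_Pair has_vector_derivative_diff) auto
    show "continuous_on {0..1} k" unfolding k_def
      using pos by (intro continuous_intros cX cont) (force simp: less_imp_neq)
    show "w 0 = 0" by (simp add: w_def init zero_prod_def)
    show "norm (w' s) \<le> k s * norm (w s)" if "s \<in> {0..1}" for s
    proof -
      let ?x = "X s - X' s" and ?d = "D s - D' s" and ?z = "Z s - Z' s" and ?v = "V s - V' s"
      let ?n = "norm (w s)"
      have X0: "X s > 0" "X' s > 0" using pos[OF that] by auto
      have le: "\<bar>?x\<bar> \<le> ?n" "\<bar>?d\<bar> \<le> ?n" "norm ?z \<le> ?n" "norm ?v \<le> ?n"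
        unfolding w_def
        by (metis norm_fst_le norm_snd_le fst_conv snd_conv real_norm_def order_trans)+
      have e1: "fst (w' s) = \<beta> s * (2 * X s * ?d + 2 * D' s * ?x)"
        by (simp add: w'_def algebra_simps)
      have b1: "norm (fst (w' s)) \<le> \<bar>\<beta> s\<bar> * ((2 * \<bar>X s\<bar> + 2 * \<bar>D' s\<bar>) * ?n)"
      proof -
        have "\<bar>2 * X s * ?d + 2 * D' s * ?x\<bar> \<le> 2 * \<bar>X s\<bar> * \<bar>?d\<bar> + 2 * \<bar>D' s\<bar> * \<bar>?x\<bar>"
          by (intro order_trans[OF abs_triangle_ineq]) (simp add: abs_mult)
        also have "\<dots> \<le> 2 * \<bar>X s\<bar> * ?n + 2 * \<bar>D' s\<bar> * ?n"
          using le by (intro add_mono mult_left_mono) auto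
        finally show ?thesis unfolding e1 real_norm_def abs_mult
          by (intro mult_left_mono) (auto simp: algebra_simps)
      qed
      have e2: "fst (snd (w' s)) = \<beta> s * (- (C\<^sup>2 / (X s * X' s) + (1 + H\<^sup>2)) * ?x)"
        using X0 by (simp add: w'_def field_simps)
      have b2: "norm (fst (snd (w' s))) \<le> \<bar>\<beta> s\<bar> * ((C\<^sup>2 / (X s * X' s) + (1 + H\<^sup>2)) * ?n)"
        unfolding e2 real_norm_def abs_mult abs_minus_cancel using X0 le(1)
        by (intro mult_left_mono mult_mono) (auto simp: abs_of_nonneg)
      have e3: "fst (snd (snd (w' s))) = of_real (\<beta> s) * ?v" by (simp add: w'_def algebra_simps)
      have b3: "norm (fst (snd (snd (w' s)))) \<le> \<bar>\<beta> s\<bar> * (1 * ?n)"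
        unfolding e3 norm_mult norm_of_real using le by (intro mult_left_mono) auto
      have e4: "snd (snd (snd (w' s))) = of_real (\<beta> s) * (2 * of_real (D s) * ?v + 2 * V' s * of_real ?d
          + 2 * \<i> * of_real C * (?v - of_real (D s) * ?z - Z' s * of_real ?d))"
        by (simp add: w'_def algebra_simps)
      have b4: "norm (snd (snd (snd (w' s)))) \<le> \<bar>\<beta> s\<bar> * ((2 * \<bar>D s\<bar> + 2 * norm (V' s) + 2 * \<bar>C\<bar> * (1 + \<bar>D s\<bar> + norm (Z' s))) * ?n)"
      proof -
        have "norm (2 * of_real (D s) * ?v + 2 * V' s * of_real ?d
          + 2 * \<i> * of_real C * (?v - of_real (D s) * ?z - Z' s * of_real ?d))
          \<le> 2 * \<bar>D s\<bar> * norm ?v + 2 * norm (V' s) * \<bar>?d\<bar> + 2 * \<bar>C\<bar> * (norm ?v + \<bar>D s\<bar> * norm ?z + norm (Z' s) * \<bar>?d\<bar>)"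
        proof (intro norm_triangle_le add_mono)
          show "norm (2 * \<i> * of_real C * (?v - of_real (D s) * ?z - Z' s * of_real ?d))
            \<le> 2 * \<bar>C\<bar> * (norm ?v + \<bar>D s\<bar> * norm ?z + norm (Z' s) * \<bar>?d\<bar>)"
          proof -
            have "norm (?v - of_real (D s) * ?z - Z' s * of_real ?d)
              \<le> norm ?v + norm (of_real (D s) * ?z) + norm (Z' s * of_real ?d)"
              by (rule order_trans[OF norm_triangle_ineq4 add_right_mono[OF norm_triangle_ineq4]])
            also have "\<dots> = norm ?v + \<bar>D s\<bar> * norm ?z + norm (Z' s) * \<bar>?d\<bar>"
              by (simp only: norm_mult norm_of_real)
            finally show ?thesis unfolding norm_mult[of "2 * \<i> * of_real C"]
              by (intro mult_mono) (auto simp: norm_mult)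
          qed
        qed (simp_all add: norm_mult flip: of_real_diff)
        also have "\<dots> \<le> 2 * \<bar>D s\<bar> * ?n + 2 * norm (V' s) * ?n + 2 * \<bar>C\<bar> * (?n + \<bar>D s\<bar> * ?n + norm (Z' s) * ?n)"
          using le by (intro add_mono mult_left_mono) auto
        finally show ?thesis unfolding e4 norm_mult[of "of_real (\<beta> s)"] norm_of_real
          by (intro mult_left_mono) (auto simp: algebra_simps)
      qed
      have "norm (w' s) \<le> norm (fst (w' s)) + (norm (fst (snd (w' s))) + (norm (fst (snd (snd (w' s)))) + norm (snd (snd (snd (w' s))))))"
        by (metis (no_types, opaque_lifting) norm_Pair_le prod.collapse add_left_mono order_trans)
      also have "\<dots> \<le> k s * ?n"
        using b1 b2 b3 b4 unfolding k_def by (simp add: algebra_simps)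
      finally show ?thesis .
    qed
  qed (fact s)
  then show ?thesis by (simp add: w_def zero_prod_def)
qed

section \<open>The model profile\<close>

text \<open>The assumptions \<open>roots_sum\<close> and \<open>roots_prod\<close> say that \<open>C1\<close> and \<open>C2\<close> are the roots of
  the polynomial \<open>p_poly H C\<close>.\<close>

locale model_profile =
  fixes H C C1 C2 :: real
  assumes C2_nonneg: "0 \<le> C2" and C2_le: "C2 \<le> C1" and C1_pos: "0 < C1" and C1_le: "C1 \<le> 1"
    and roots_sum: "(H\<^sup>2 + 1) * (C1 + C2) = 1 + 2 * H * C"
    and roots_prod: "(H\<^sup>2 + 1) * (C1 * C2) = C\<^sup>2"
begin

definition p :: real where "p = sqrt ((C1 - C2) / C1)"
definition \<Xi> :: real where "\<Xi> = sqrt ((H\<^sup>2 + 1) * C1)"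
definition A :: "real \<Rightarrow> real" where "A t = jacobi_am p (\<Xi> * t)"
definition D :: "real \<Rightarrow> real" where "D t = jacobi_dn p (\<Xi> * t)"
definition X :: "real \<Rightarrow> real" where "X t = C1 * (D t)\<^sup>2"
text \<open>The logarithmic derivative of \<open>D\<close>, hence of the radius.\<close>

definition Del :: "real \<Rightarrow> real" where "Del t = - (p\<^sup>2) * \<Xi> * sin (A t) * cos (A t) / D t"
definition \<psi> :: "real \<Rightarrow> real" where "\<psi> = angle H C C1 C2 p \<Xi>"
text \<open>The logarithmic derivative of \<open>sqrt (1 - X t) * cis (\<psi> t)\<close>: the real
  part comes from the modulus, the imaginary part is the angular velocity found in
  \<open>angle_deriv\<close>.\<close>

definition mu :: "real \<Rightarrow> complex" where "mu t = (of_real (- X t * Del t) + \<i> * of_real (C - H * X t)) / of_real (1 - X t)"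
text \<open>For \<open>C1 = 1\<close> the modulus \<open>p * \<bar>sin (A t)\<bar>\<close> is
  replaced by its signed version. This makes \<open>Z\<close> smooth at its zeros and absorbs the
  sign changes that \<open>basis_at\<close> puts into the basis.\<close>

definition Z :: "real \<Rightarrow> complex" where
  "Z t = (if C1 = 1 then of_real (p * sin (A t)) * cis (H * t) else of_real (sqrt (1 - X t)) * cis (\<psi> t))"
definition V :: "real \<Rightarrow> complex" where
  "V t = (if C1 = 1 then (of_real (cos (A t) * D t) + \<i> * of_real (H * p * sin (A t))) * cis (H * t)
     else mu t * Z t)"

lemma p_bounds: "0 \<le> p" "p \<le> 1" and p_sq: "p\<^sup>2 = (C1 - C2) / C1" "C1 * p\<^sup>2 = C1 - C2"
  using C2_nonneg C2_le C1_pos by (auto simp: p_def)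

lemma Xi_pos: "0 < \<Xi>" and Xi_sq: "\<Xi>\<^sup>2 = (H\<^sup>2 + 1) * C1"
proof -
  have "0 < (H\<^sup>2 + 1) * C1" using C1_pos by (intro mult_pos_pos add_nonneg_pos) auto
  then show "0 < \<Xi>" "\<Xi>\<^sup>2 = (H\<^sup>2 + 1) * C1" by (auto simp: \<Xi>_def)
qed

lemma D_pos: "0 < D t" by (simp add: D_def jacobi_dn_pos p_bounds)

lemma D_sq: "(D t)\<^sup>2 = 1 - p\<^sup>2 * (sin (A t))\<^sup>2"
  by (simp add: D_def A_def jacobi_dn_squared p_bounds)

lemma X_pos: "0 < X t" using D_pos[of t] C1_pos unfolding X_def by (intro mult_pos_pos zero_less_power)

lemma X_eq: "X t = C1 - (C1 - C2) * (sin (A t))\<^sup>2"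
  unfolding X_def D_sq p_sq(2)[symmetric] by (simp add: algebra_simps)

lemma X_le: "X t \<le> C1"
  unfolding X_eq using C2_le by simp

lemma A_deriv: "(A has_real_derivative \<Xi> * D t) (at t)"
proof -
  have "((\<lambda>t. jacobi_am p (\<Xi> * t)) has_real_derivative jacobi_dn p (\<Xi> * t) * \<Xi>) (at t)"
    by (rule DERIV_chain2[OF jacobi_am_has_derivative[OF p_bounds]])
      (auto intro!: derivative_eq_intros)
  then show ?thesis by (simp add: A_def[abs_def] D_def mult.commute)
qed

lemma D_deriv: "(D has_real_derivative - (p\<^sup>2) * \<Xi> * sin (A t) * cos (A t)) (at t)"
proof -
  have e: "D = (\<lambda>t. sqrt (1 - p\<^sup>2 * (sin (A t))\<^sup>2))"
    by (rule ext, rule sym, rule real_sqrt_unique[OF D_sq less_imp_le[OF D_pos]])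
  have pos: "0 < 1 - p\<^sup>2 * (sin (A t))\<^sup>2" using D_sq[of t] D_pos[of t] by (metis zero_less_power)
  have s: "sqrt (1 - p\<^sup>2 * (sin (A t))\<^sup>2) = D t"
    using D_sq[of t] D_pos[of t] by (intro real_sqrt_unique) simp_all
  have in_d: "((\<lambda>t. 1 - p\<^sup>2 * (sin (A t))\<^sup>2) has_real_derivative
      - (p\<^sup>2 * (2 * sin (A t) * (cos (A t) * (\<Xi> * D t))))) (at t)"
    by (auto intro!: derivative_eq_intros A_deriv)
  have "((\<lambda>t. sqrt (1 - p\<^sup>2 * (sin (A t))\<^sup>2)) has_real_derivative
      (inverse (D t) / 2) * (- (p\<^sup>2 * (2 * sin (A t) * (cos (A t) * (\<Xi> * D t)))))) (at t)"
    using DERIV_chain2[OF DERIV_real_sqrt[OF pos] in_d] unfolding s .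
  moreover have "(inverse (D t) / 2) * (- (p\<^sup>2 * (2 * sin (A t) * (cos (A t) * (\<Xi> * D t)))))
     = - (p\<^sup>2) * \<Xi> * sin (A t) * cos (A t)"
    using D_pos[of t] by (simp add: field_simps)
  ultimately show ?thesis by (simp only: e[symmetric])
qed

lemma X_deriv: "(X has_real_derivative 2 * X t * Del t) (at t)"
proof -
  have "(X has_real_derivative C1 * (2 * D t * (- (p\<^sup>2) * \<Xi> * sin (A t) * cos (A t)))) (at t)"
    unfolding X_def[abs_def] by (auto intro!: derivative_eq_intros D_deriv)
  moreover have "C1 * (2 * D t * (- (p\<^sup>2) * \<Xi> * sin (A t) * cos (A t))) = 2 * X t * Del t"
    using D_pos[of t] by (simp add: X_def Del_def field_simps power2_eq_square)
  ultimately show ?thesis by (simp only:)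
qed

text \<open>Since \<open>C2 = C1 * (1 - p\<^sup>2)\<close>, the product of the roots gives
  \<open>C\<^sup>2 = \<Xi>\<^sup>2 * C1 * (1 - p\<^sup>2)\<close>. Both sides then equal
  \<open>\<Xi>\<^sup>2 * ((1 - p\<^sup>2) / d\<^sup>2 - d\<^sup>2)\<close> with
  \<open>d = D t\<close>.\<close>

lemma Del_deriv: "(Del has_real_derivative C\<^sup>2 / X t - (1 + H\<^sup>2) * X t) (at t)"
proof -
  define s c d where "s = sin (A t)" and "c = cos (A t)" and "d = D t"
  have d: "d > 0" "d\<^sup>2 = 1 - p\<^sup>2 * s\<^sup>2" and c: "c\<^sup>2 = 1 - s\<^sup>2"
    using D_pos[of t] D_sq[of t] by (auto simp: s_def d_def c_def cos_squared_eq)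
  have "(Del has_real_derivative - (p\<^sup>2) * \<Xi> * (((c * c - s * s) * (\<Xi> * d)) * d - s * c * (- (p\<^sup>2) * \<Xi> * s * c)) / (d * d)) (at t)"
    unfolding Del_def[abs_def] using D_pos[of t]
    by (auto intro!: derivative_eq_intros A_deriv D_deriv simp: s_def c_def d_def field_simps)
  moreover have "- (p\<^sup>2) * \<Xi> * (((c * c - s * s) * (\<Xi> * d)) * d - s * c * (- (p\<^sup>2) * \<Xi> * s * c)) / (d * d)
      = C\<^sup>2 / X t - (1 + H\<^sup>2) * X t"
  proof -
    have "C1 * (1 - p\<^sup>2) = C2" unfolding right_diff_distrib p_sq(2) by simp
    then have "C\<^sup>2 = \<Xi>\<^sup>2 * C1 * (1 - p\<^sup>2)"
      unfolding Xi_sq roots_prod[symmetric] by (simp only: mult.assoc)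
    then have r: "C\<^sup>2 / X t = \<Xi>\<^sup>2 * (1 - p\<^sup>2) / d\<^sup>2"
      using C1_pos by (simp add: X_def d_def)
    have r2: "(1 + H\<^sup>2) * X t = \<Xi>\<^sup>2 * d\<^sup>2" by (simp add: X_def d_def Xi_sq)
    have "- (p\<^sup>2) * \<Xi> * (((c * c - s * s) * (\<Xi> * d)) * d - s * c * (- (p\<^sup>2) * \<Xi> * s * c))
       = - (p\<^sup>2) * \<Xi>\<^sup>2 * ((c\<^sup>2 - s\<^sup>2) * d\<^sup>2 + p\<^sup>2 * s\<^sup>2 * c\<^sup>2)"
      by (simp add: power2_eq_square algebra_simps)
    also have "\<dots> = \<Xi>\<^sup>2 * (1 - p\<^sup>2) - \<Xi>\<^sup>2 * d\<^sup>2 * d\<^sup>2"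
      unfolding d(2) c by (simp add: power2_eq_square algebra_simps)
    finally show ?thesis unfolding r r2 using d(1) by (simp add: diff_divide_distrib power2_eq_square)
  qed
  ultimately show ?thesis by (simp only:)
qed

text \<open>Both sides are \<open>- poly (p_poly H C) x\<close>, on the left in factored form. The
  right-hand form is the one that the geometry produces.\<close>

lemma poly_factor: "(H\<^sup>2 + 1) * ((C1 - x) * (x - C2)) = x - x\<^sup>2 - (C - H * x)\<^sup>2"
proof -
  have "(H\<^sup>2 + 1) * ((C1 - x) * (x - C2))
      = x * ((H\<^sup>2 + 1) * (C1 + C2)) - (H\<^sup>2 + 1) * x\<^sup>2 - (H\<^sup>2 + 1) * (C1 * C2)"
    by (simp add: power2_eq_square algebra_simps)
  then show ?thesis unfolding roots_sum roots_prod by (simp add: power2_eq_square algebra_simps)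
qed

text \<open>First integral of the system. The distances of \<open>X t\<close> to the two roots are
  \<open>C1 * p\<^sup>2 * (sin (A t))\<^sup>2\<close> and
  \<open>C1 * p\<^sup>2 * (cos (A t))\<^sup>2\<close>, so the left side is the factored polynomial
  up to sign.\<close>

lemma energy: "(Del t)\<^sup>2 * X t = X t - (X t)\<^sup>2 - (C - H * X t)\<^sup>2"
proof -
  have "(Del t)\<^sup>2 * X t = \<Xi>\<^sup>2 * C1 * p\<^sup>2 * p\<^sup>2 * (sin (A t))\<^sup>2 * (cos (A t))\<^sup>2"
    using D_pos[of t] by (simp add: Del_def X_def power2_eq_square field_simps)
  also have "\<dots> = (H\<^sup>2 + 1) * ((C1 * p\<^sup>2 * (sin (A t))\<^sup>2) * (C1 * p\<^sup>2 * (cos (A t))\<^sup>2))"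
    by (simp add: Xi_sq algebra_simps)
  also have "C1 * p\<^sup>2 * (sin (A t))\<^sup>2 = C1 - X t" unfolding p_sq(2) X_eq by simp
  also have "C1 * p\<^sup>2 * (cos (A t))\<^sup>2 = X t - C2" unfolding p_sq(2) X_eq cos_squared_eq by (simp add: algebra_simps)
  finally show ?thesis by (simp only: poly_factor)
qed

text \<open>The polynomial has the value \<open>(H - C)\<^sup>2\<close> at 1, so 1 is a root only if
  \<open>C = H\<close>. Then \<open>(p * \<Xi>)\<^sup>2 = (H\<^sup>2 + 1) * (C1 - C2)\<close>
  reduces to 1 by the product of the roots.\<close>

lemma C1_eq_1: assumes "C1 = 1" shows "C = H" "p * \<Xi> = 1"
proof -
  have "(H\<^sup>2 + 1) * (1 - C1) * (1 - C2) = (H\<^sup>2 + 1) - (H\<^sup>2 + 1) * (C1 + C2) + (H\<^sup>2 + 1) * (C1 * C2)"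
    by (simp add: algebra_simps)
  also have "\<dots> = (H - C)\<^sup>2" unfolding roots_sum roots_prod by (simp add: power2_eq_square algebra_simps)
  finally show C: "C = H" using assms by simp
  have "(p * \<Xi>)\<^sup>2 = (H\<^sup>2 + 1) * (C1 * p\<^sup>2)" by (simp add: power_mult_distrib Xi_sq)
  also have "\<dots> = (H\<^sup>2 + 1) - (H\<^sup>2 + 1) * (C1 * C2)"
    unfolding p_sq(2) using assms by (simp add: algebra_simps)
  also have "\<dots> = 1" unfolding roots_prod C by simp
  finally have "\<bar>p * \<Xi>\<bar> = 1" by (simp add: power2_eq_1_iff abs_eq_iff')
  then show "p * \<Xi> = 1" using p_bounds Xi_pos by simp
qed

text \<open>Multiplying the denominator of the integrand of \<open>elliptic_Pi\<close> by
  \<open>C1 - 1\<close> gives \<open>X t - 1\<close>, so the derivative is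
  \<open>H + (C - H) / (1 - X t)\<close>. The parameter \<open>?k\<close> is nonpositive, hence the
  integrand is regular on the whole line.\<close>

lemma angle_deriv:
  assumes "C1 \<noteq> 1"
  shows "(\<psi> has_real_derivative (C - H * X t) / (1 - X t)) (at t)"
proof -
  let ?k = "(C1 - C2) / (C1 - 1)"
  have C11: "C1 - 1 < 0" using assms C1_le by simp
  have sn: "(C1 - 1) * (1 - ?k * (jacobi_sn p (\<Xi> * t))\<^sup>2) = X t - 1" for t
    using C11 by (simp add: X_eq A_def jacobi_sn_def field_simps)
  have k: "?k \<le> 0" using C11 C2_le by (simp add: divide_nonneg_neg)
  have cont: "continuous_on UNIV (\<lambda>u. 1 / (1 - ?k * (jacobi_sn p u)\<^sup>2))"
  proof -
    have "continuous_on UNIV (jacobi_am p)"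
      by (intro continuous_at_imp_continuous_on ballI)
        (rule DERIV_isCont[OF jacobi_am_has_derivative[OF p_bounds]])
    moreover have "1 - ?k * (sin (jacobi_am p u))\<^sup>2 \<noteq> 0" for u
      using mult_nonpos_nonneg[OF k zero_le_power2[of "sin (jacobi_am p u)"]] by linarith
    ultimately show ?thesis unfolding jacobi_sn_def
      by (intro continuous_intros ballI)
  qed
  have "(elliptic_Pi p ?k has_real_derivative 1 / (1 - ?k * (jacobi_sn p u)\<^sup>2)) (at u)" for u
    unfolding elliptic_Pi_def[abs_def]
    by (rule interval_integral_has_derivative[OF _ _ _ _ cont]) auto
  note d = DERIV_chain2[OF this]
  have "((\<lambda>t. H * t - (C - H) / (C1 - 1) * (1 / \<Xi>) * elliptic_Pi p ?k (\<Xi> * t)) has_real_derivative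
     H - (C - H) / (C1 - 1) * (1 / \<Xi>) * (1 / (1 - ?k * (jacobi_sn p (\<Xi> * t))\<^sup>2) * \<Xi>)) (at t)"
    using Xi_pos assms by (auto intro!: derivative_eq_intros d)
  moreover have "H - (C - H) / (C1 - 1) * (1 / \<Xi>) * (1 / (1 - ?k * (jacobi_sn p (\<Xi> * t))\<^sup>2) * \<Xi>)
    = H - (C - H) / ((C1 - 1) * (1 - ?k * (jacobi_sn p (\<Xi> * t))\<^sup>2))"
    using Xi_pos by simp
  moreover have "\<dots> = (C - H * X t) / (1 - X t)"
    unfolding sn using X_le[of t] C11 by (simp add: field_simps)
  ultimately show ?thesis using assms by (simp add: \<psi>_def angle_def[abs_def])
qed

lemma Z1: "Z t = of_real (p * sin (A t)) * cis (H * t)"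
  and V1: "V t = (of_real (cos (A t) * D t) + \<i> * of_real (H * p * sin (A t))) * cis (H * t)"
  if "C1 = 1"
  unfolding Z_def V_def if_P[OF that] by (rule refl)+

lemma X1: "1 - X t = p\<^sup>2 * (sin (A t))\<^sup>2" if "C1 = 1"
proof -
  have "X t = (D t)\<^sup>2 + (C1 - 1) * (D t)\<^sup>2" by (simp add: X_def algebra_simps)
  moreover have "C1 - 1 = 0" using that by simp
  ultimately have "X t = (D t)\<^sup>2" by (simp only: mult_zero_left add_0_right)
  then show ?thesis unfolding D_sq by simp
qed

lemma norm_Z: "(norm (Z t))\<^sup>2 = 1 - X t"
proof (cases "C1 = 1")
  case True
  show ?thesis unfolding Z1[OF True] X1[OF True] by (simp add: norm_mult power_mult_distrib abs_mult)
next
  case False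
  then show ?thesis using X_le[of t] C1_le by (simp add: Z_def norm_mult)
qed

lemma cis_deriv:
  assumes "(f has_real_derivative f') (at t)"
  shows "((\<lambda>t. cis (f t)) has_vector_derivative of_real f' * \<i> * cis (f t)) (at t)"
  unfolding has_vector_derivative_complex_iff using assms
  by (auto intro!: derivative_eq_intros)

lemma mu_Z: "V t = mu t * Z t" if "C1 \<noteq> 1"
  using that by (simp add: V_def)

lemma Z_deriv: "(Z has_vector_derivative V t) (at t)"
proof (cases "C1 = 1")
  case True
  have "((\<lambda>t. p * sin (A t)) has_real_derivative (p * \<Xi>) * (cos (A t) * D t)) (at t)"
    by (auto intro!: derivative_eq_intros A_deriv)
  then have "((\<lambda>t. p * sin (A t)) has_real_derivative cos (A t) * D t) (at t)"
    by (simp only: C1_eq_1[OF True] mult_1)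
  moreover have "((\<lambda>t. H * t) has_real_derivative H) (at t)" by (auto intro!: derivative_eq_intros)
  ultimately have "((\<lambda>t. of_real (p * sin (A t)) * cis (H * t)) has_vector_derivative
     of_real (p * sin (A t)) * (of_real H * \<i> * cis (H * t)) + of_real (cos (A t) * D t) * cis (H * t)) (at t)"
    by (intro has_vector_derivative_mult has_vector_derivative_of_real cis_deriv)
  moreover have "Z = (\<lambda>t. of_real (p * sin (A t)) * cis (H * t))" using Z1[OF True] by blast
  ultimately show ?thesis unfolding V1[OF True] by (simp add: algebra_simps)
next
  case False
  define q where "q = (\<lambda>t. sqrt (1 - X t))"
  have w: "1 - X t > 0" for t using X_le[of t] C1_le False by auto
  have q: "q t > 0" "1 - X t = (q t)\<^sup>2" using w[of t] by (auto simp: q_def)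
  have qs: "sqrt (1 - X t) = q t" for t by (simp add: q_def)
  have dq: "(q has_real_derivative - (X t * Del t) / q t) (at t)"
  proof -
    have wd: "((\<lambda>t. 1 - X t) has_real_derivative - (2 * X t * Del t)) (at t)"
      by (auto intro!: derivative_eq_intros X_deriv)
    have "(q has_real_derivative (inverse (sqrt (1 - X t)) / 2) * (- (2 * X t * Del t))) (at t)"
      unfolding q_def by (rule DERIV_chain2[OF DERIV_real_sqrt[OF w] wd])
    moreover have "(inverse (sqrt (1 - X t)) / 2) * (- (2 * X t * Del t)) = - (X t * Del t) / q t"
      unfolding qs using q(1) by (simp add: field_simps)
    ultimately show ?thesis by (simp only:)
  qed
  have "((\<lambda>t. of_real (q t) * cis (\<psi> t)) has_vector_derivative
     of_real (q t) * (of_real ((C - H * X t) / (1 - X t)) * \<i> * cis (\<psi> t)) + of_real (- (X t * Del t) / q t) * cis (\<psi> t)) (at t)"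
    by (intro has_vector_derivative_mult has_vector_derivative_of_real cis_deriv dq angle_deriv False)
  moreover have "of_real (q t) * (of_real ((C - H * X t) / (1 - X t)) * \<i> * cis (\<psi> t)) + of_real (- (X t * Del t) / q t) * cis (\<psi> t) = V t"
    unfolding mu_Z[OF False] mu_def Z_def if_not_P[OF False] qs q(2) using q(1)
    by (simp add: field_simps power2_eq_square)
  moreover have "Z = (\<lambda>t. of_real (q t) * cis (\<psi> t))" unfolding Z_def[abs_def] if_not_P[OF False] qs ..
  ultimately show ?thesis by (simp only:)
qed

text \<open>The Riccati equation of \<open>mu = Z' / Z\<close> that belongs to the second order
  linear equation for \<open>Z\<close> in \<open>profile_flow\<close>. The real part rests on
  \<open>energy\<close>; the imaginary part is an identity in \<open>m = C - H * x\<close> and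
  \<open>w = 1 - x\<close>.\<close>

lemma mu_deriv:
  assumes "C1 \<noteq> 1"
  shows "(mu has_vector_derivative
    2 * of_real (Del t) * mu t + 2 * \<i> * of_real C * (mu t - of_real (Del t)) - mu t * mu t) (at t)"
proof -
  define x d m where "x = X t" and "d = Del t" and "m = C - H * X t"
  define w where "w = 1 - x"
  have w0: "w > 0" using X_le[of t] C1_le assms by (auto simp: x_def w_def)
  have m: "m = C - H * x" by (simp add: m_def x_def)
  have en: "d\<^sup>2 * x = x - x\<^sup>2 - m\<^sup>2" using energy[of t] by (simp add: x_def d_def m_def)
  define d' where "d' = C\<^sup>2 / x - (1 + H\<^sup>2) * x"
  have d': "x * d' = C\<^sup>2 - (1 + H\<^sup>2) * x\<^sup>2"
    using X_pos[of t] by (simp add: d'_def x_def field_simps power2_eq_square)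
  have wd: "((\<lambda>t. 1 - X t) has_real_derivative - (2 * x * d)) (at t)"
    unfolding x_def d_def by (auto intro!: derivative_eq_intros X_deriv)
  have nd: "((\<lambda>t. - (X t * Del t)) has_real_derivative - (2 * x * d * d + x * d')) (at t)"
    unfolding x_def d_def d'_def by (auto intro!: derivative_eq_intros X_deriv Del_deriv)
  have md: "((\<lambda>t. C - H * X t) has_real_derivative - (H * (2 * x * d))) (at t)"
    unfolding x_def d_def by (auto intro!: derivative_eq_intros X_deriv)
  have w1: "1 - X t \<noteq> 0" using w0 by (simp add: w_def x_def)
  have re: "((\<lambda>t. (- (X t * Del t)) / (1 - X t)) has_real_derivative
      (- (2 * x * d * d + x * d') * w - (- (x * d)) * (- (2 * x * d))) / (w * w)) (at t)"
    using DERIV_divide[OF nd wd w1] by (simp only: w_def x_def d_def)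
  have im: "((\<lambda>t. (C - H * X t) / (1 - X t)) has_real_derivative
      (- (H * (2 * x * d)) * w - m * (- (2 * x * d))) / (w * w)) (at t)"
    using DERIV_divide[OF md wd w1] by (simp only: w_def x_def d_def m_def)
  have mu: "mu t = Complex (- (x * d) / w) (m / w)"
    by (simp add: mu_def complex_eq_iff x_def d_def w_def m_def)
  have re_eq: "(- (2 * x * d * d + x * d') * w - (- (x * d)) * (- (2 * x * d))) / (w * w)
     = 2 * d * (- (x * d) / w) - 2 * C * (m / w) - ((- (x * d) / w) * (- (x * d) / w) - (m / w) * (m / w))"
  proof -
    have 1: "x * x * (d * d) = x * (x - x\<^sup>2 - m\<^sup>2)"
      unfolding en[symmetric] by (simp add: power2_eq_square)
    have Cm: "C = m + H * x" by (simp add: m)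
    have "- (2 * x * d * d + x * d') * w - (- (x * d)) * (- (2 * x * d))
       = (2 * d * (- (x * d)) - 2 * C * m) * w - (x * x * (d * d) - m * m)
         - (x * x * (d * d) + w * (C\<^sup>2 - (1 + H\<^sup>2) * x\<^sup>2) - 2 * C * m * w + m * m)"
      unfolding d'[symmetric] by (simp add: algebra_simps)
    also have "x * x * (d * d) + w * (C\<^sup>2 - (1 + H\<^sup>2) * x\<^sup>2) - 2 * C * m * w + m * m = 0"
      unfolding 1 w_def Cm by (simp add: power2_eq_square algebra_simps)
    finally show ?thesis using w0 by (simp add: field_simps)
  qed
  have im_eq: "(- (H * (2 * x * d)) * w - m * (- (2 * x * d))) / (w * w)
     = 2 * d * (m / w) + 2 * C * (- (x * d) / w - d) - 2 * ((- (x * d) / w) * (m / w))"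
  proof -
    have "- (H * (2 * x * d)) = 2 * d * m - 2 * C * (x * d + d * w)"
      unfolding w_def m by (simp add: algebra_simps)
    then show ?thesis using w0 by (simp add: field_simps)
  qed
  show ?thesis unfolding has_vector_derivative_complex_iff
  proof
    show "((\<lambda>x. Re (mu x)) has_real_derivative Re (2 * of_real (Del t) * mu t + 2 * \<i> * of_real C * (mu t - of_real (Del t)) - mu t * mu t)) (at t)"
      using re unfolding re_eq by (simp add: mu) (simp add: mu_def d_def[symmetric])
    show "((\<lambda>x. Im (mu x)) has_real_derivative Im (2 * of_real (Del t) * mu t + 2 * \<i> * of_real C * (mu t - of_real (Del t)) - mu t * mu t)) (at t)"
    proof -
      have "2 * d * (m / w) + 2 * C * (- (x * d) / w - d) - 2 * ((- (x * d) / w) * (m / w))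
        = Im (2 * of_real (Del t) * mu t + 2 * \<i> * of_real C * (mu t - of_real (Del t)) - mu t * mu t)"
        by (simp add: mu d_def[symmetric] algebra_simps)
      moreover have "(\<lambda>t. Im (mu t)) = (\<lambda>t. (C - H * X t) / (1 - X t))" by (simp add: mu_def)
      ultimately show ?thesis using im im_eq by metis
    qed
  qed
qed

text \<open>For \<open>C1 \<noteq> 1\<close> the product rule for \<open>mu * Z\<close> cancels the
  quadratic term of the Riccati equation. For \<open>C1 = 1\<close> the quotient \<open>mu\<close>
  breaks down at zeros of \<open>Z\<close>, so the closed form is differentiated with
  \<open>C = H\<close> and \<open>p * \<Xi> = 1\<close>.\<close>

lemma V_deriv: "(V has_vector_derivative
    2 * of_real (Del t) * V t + 2 * \<i> * of_real C * (V t - of_real (Del t) * Z t)) (at t)"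
proof (cases "C1 = 1")
  case True
  note CH = C1_eq_1[OF True]
  define s c d where "s = sin (A t)" and "c = cos (A t)" and "d = D t"
  have d: "d > 0" "d\<^sup>2 = 1 - p\<^sup>2 * s\<^sup>2" and c: "c\<^sup>2 = 1 - s\<^sup>2"
    using D_pos[of t] D_sq[of t] by (auto simp: s_def d_def c_def cos_squared_eq)
  have X2: "\<Xi>\<^sup>2 = H\<^sup>2 + 1"
  proof -
    have "(H\<^sup>2 + 1) * C1 = H\<^sup>2 + 1" using True by simp
    then show ?thesis by (simp only: Xi_sq)
  qed
  have E: "((\<lambda>t. cos (A t) * D t) has_real_derivative (2 * Del t * (c * d) - H\<^sup>2 * (p * s))) (at t)"
  proof -
    have "((\<lambda>t. cos (A t) * D t) has_real_derivative - (s * (\<Xi> * d)) * d + (- (p\<^sup>2) * \<Xi> * s * c) * c) (at t)"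
      unfolding s_def c_def d_def by (auto intro!: derivative_eq_intros A_deriv D_deriv)
    moreover have "- (s * (\<Xi> * d)) * d + (- (p\<^sup>2) * \<Xi> * s * c) * c = 2 * Del t * (c * d) - H\<^sup>2 * (p * s)"
    proof -
      have Xp: "\<Xi> = p * \<Xi>\<^sup>2" using CH(2) by (simp add: power2_eq_square flip: mult.assoc)
      have p1: "p\<^sup>2 * \<Xi>\<^sup>2 = 1" using CH(2) by (metis power_mult_distrib power_one)
      have "Del t * (c * d) = - (p * (p * \<Xi>)) * s * c\<^sup>2"
        using d(1) by (simp add: Del_def s_def c_def d_def power2_eq_square field_simps)
      then have D1: "Del t * (c * d) = - p * s * c\<^sup>2" by (simp add: CH)
      have "- (s * (\<Xi> * d)) * d + (- (p\<^sup>2) * \<Xi> * s * c) * c = - (s * \<Xi> * (d\<^sup>2 + p\<^sup>2 * c\<^sup>2))"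
        by (simp add: power2_eq_square algebra_simps)
      also have "\<dots> = - (s * p * (\<Xi>\<^sup>2 + (p\<^sup>2 * \<Xi>\<^sup>2) * (1 - 2 * s\<^sup>2)))"
        by (subst Xp) (simp add: d(2) c algebra_simps)
      also have "\<dots> = 2 * (- p * s * c\<^sup>2) - H\<^sup>2 * (p * s)" unfolding p1 unfolding X2 c by (simp add: algebra_simps)
      finally show ?thesis by (simp only: mult.assoc D1)
    qed
    ultimately show ?thesis by (simp only:)
  qed
  have W: "((\<lambda>t. H * p * sin (A t)) has_real_derivative H * (c * d)) (at t)"
  proof -
    have "((\<lambda>t. H * p * sin (A t)) has_real_derivative H * (p * \<Xi>) * (c * d)) (at t)"
      unfolding c_def d_def by (auto intro!: derivative_eq_intros A_deriv)
    then show ?thesis by (simp add: CH)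
  qed
  have "((\<lambda>t. (of_real (cos (A t) * D t) + \<i> * of_real (H * p * sin (A t))) * cis (H * t)) has_vector_derivative
     (of_real (cos (A t) * D t) + \<i> * of_real (H * p * sin (A t))) * (of_real H * \<i> * cis (H * t))
     + (of_real (2 * Del t * (c * d) - H\<^sup>2 * (p * s)) + \<i> * of_real (H * (c * d))) * cis (H * t)) (at t)"
    by (intro has_vector_derivative_mult has_vector_derivative_add has_vector_derivative_mult_right
        has_vector_derivative_of_real cis_deriv E W) (auto intro!: derivative_eq_intros)
  moreover have "V = (\<lambda>t. (of_real (cos (A t) * D t) + \<i> * of_real (H * p * sin (A t))) * cis (H * t))"
    using V1[OF True] by blast
  moreover have "(of_real (cos (A t) * D t) + \<i> * of_real (H * p * sin (A t))) * (of_real H * \<i> * cis (H * t))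
     + (of_real (2 * Del t * (c * d) - H\<^sup>2 * (p * s)) + \<i> * of_real (H * (c * d))) * cis (H * t)
     = 2 * of_real (Del t) * V t + 2 * \<i> * of_real C * (V t - of_real (Del t) * Z t)"
  proof -
    have CC: "complex_of_real C = complex_of_real H" using CH(1) by (rule arg_cong)
    show ?thesis unfolding V1[OF True] Z1[OF True] CC
      by (simp add: s_def c_def d_def algebra_simps power2_eq_square)
  qed
  ultimately show ?thesis by (simp only:)
next
  case False
  have "((\<lambda>t. mu t * Z t) has_vector_derivative mu t * V t +
     (2 * of_real (Del t) * mu t + 2 * \<i> * of_real C * (mu t - of_real (Del t)) - mu t * mu t) * Z t) (at t)"
    by (intro has_vector_derivative_mult Z_deriv mu_deriv False)
  then show ?thesis using False by (simp add: V_def[abs_def] algebra_simps)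
qed

text \<open>At a zero of \<open>Z\<close> the product \<open>V t * cnj (Z t)\<close> carries no
  information about \<open>V t\<close>; the modulus found here replaces it in
  \<open>initial_match\<close>.\<close>

lemma norm_V_C1: "norm (V t) = 1" if "C1 = 1" "Z t = 0"
proof -
  have s: "sin (A t) = 0"
  proof (rule ccontr)
    assume "sin (A t) \<noteq> 0"
    moreover have "p \<noteq> 0" using C1_eq_1(2)[OF that(1)] by auto
    ultimately show False using that(2) unfolding Z1[OF that(1)] by (simp add: cis_neq_zero)
  qed
  then have "\<bar>cos (A t)\<bar> = 1" using sin_cos_squared_add[of "A t"] by (simp add: power2_eq_1_iff abs_eq_iff')
  moreover have "D t = 1" using D_sq[of t] D_pos[of t] s by (simp add: power2_eq_1_iff)
  ultimately show ?thesis unfolding V1[OF that(1)] using s by (simp add: norm_mult)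
qed

lemma flow: "profile_flow H C 1 X Del Z V (at t) t"
  unfolding profile_flow_def using X_deriv Del_deriv Z_deriv V_deriv by simp

lemma flow_compose:
  assumes "(\<tau> has_real_derivative \<beta>) (at s within S)"
  shows "profile_flow H C \<beta> (X \<circ> \<tau>) (Del \<circ> \<tau>) (Z \<circ> \<tau>) (V \<circ> \<tau>) (at s within S) s"
proof -
  have v: "(\<tau> has_vector_derivative \<beta>) (at s within S)"
    using assms by (simp add: has_real_derivative_iff_has_vector_derivative)
  have "((X \<circ> \<tau>) has_real_derivative \<beta> * (2 * X (\<tau> s) * Del (\<tau> s))) (at s within S)"
    using DERIV_chain[OF X_deriv assms] by (simp only: mult.commute)
  moreover have "((Del \<circ> \<tau>) has_real_derivative \<beta> * (C\<^sup>2 / X (\<tau> s) - (1 + H\<^sup>2) * X (\<tau> s))) (at s within S)"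
    using DERIV_chain[OF Del_deriv assms] by (simp only: mult.commute)
  moreover have "((Z \<circ> \<tau>) has_vector_derivative of_real \<beta> * V (\<tau> s)) (at s within S)"
    using vector_diff_chain_within[OF v has_vector_derivative_at_within[OF Z_deriv]]
    by (simp only: scaleR_conv_of_real)
  moreover have "((V \<circ> \<tau>) has_vector_derivative of_real \<beta> * (2 * of_real (Del (\<tau> s)) * V (\<tau> s)
      + 2 * \<i> * of_real C * (V (\<tau> s) - of_real (Del (\<tau> s)) * Z (\<tau> s)))) (at s within S)"
    using vector_diff_chain_within[OF v has_vector_derivative_at_within[OF V_deriv]]
    by (simp only: scaleR_conv_of_real)
  ultimately show ?thesis by (simp only: profile_flow_def o_apply)
qed

end

section \<open>Initial states attained by the model\<close>

context model_profile
begin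

text \<open>The real part is half the derivative of \<open>(norm (Z t))\<^sup>2 = 1 - X t\<close>,
  the imaginary part is the angular momentum of \<open>Z\<close>. Where \<open>Z t\<close> is
  nonzero the velocity is therefore determined by \<open>Z t\<close>, \<open>X t\<close> and
  \<open>Del t\<close>.\<close>

lemma V_cnj_Z: "V t * cnj (Z t) = of_real (- X t * Del t) + \<i> * of_real (C - H * X t)"
proof (cases "C1 = 1")
  case True
  have "X t = (D t)\<^sup>2" using X1[OF True, of t] D_sq[of t] by simp
  moreover have "Del t * D t = - (p * sin (A t) * cos (A t))"
  proof -
    have "Del t * D t = - (p * (p * \<Xi>) * sin (A t) * cos (A t))"
      using D_pos[of t] by (simp add: Del_def power2_eq_square)
    then show ?thesis unfolding C1_eq_1(2)[OF True] by simp
  qed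
  ultimately have 1: "- X t * Del t = D t * (p * sin (A t) * cos (A t))"
    by (simp add: power2_eq_square algebra_simps)
  have "C - H * X t = H * (1 - X t)" using C1_eq_1(1)[OF True] by (simp add: algebra_simps)
  then have 2: "C - H * X t = H * (p\<^sup>2 * (sin (A t))\<^sup>2)" by (simp only: X1[OF True])
  have "V t * cnj (Z t) = (of_real (cos (A t) * D t) + \<i> * of_real (H * p * sin (A t))) * of_real (p * sin (A t))
      * (cis (H * t) * cnj (cis (H * t)))"
    unfolding V1[OF True] Z1[OF True] by simp
  also have "cis (H * t) * cnj (cis (H * t)) = 1"
    by (simp add: complex_norm_square[symmetric])
  finally show ?thesis unfolding 1 2 by (simp add: algebra_simps power2_eq_square)
next
  case False
  have w: "1 - X t > 0" using X_le[of t] C1_le False by auto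
  have "V t * cnj (Z t) = mu t * of_real ((norm (Z t))\<^sup>2)"
    unfolding mu_Z[OF False] by (simp add: mult.assoc complex_norm_square[symmetric] del: of_real_power)
  then show ?thesis unfolding norm_Z mu_def using w by simp
qed

text \<open>An amplitude \<phi> with \<open>sin\<^sup>2 = (C1 - x0) / (C1 - C2)\<close> gives the
  right \<open>X\<close>. Then \<open>energy\<close> determines \<open>Del\<close> up to sign, and
  passing to \<open>- \<phi>\<close> reverses that sign without changing \<open>X\<close>.\<close>

lemma attains:
  assumes "0 < x0" "C2 \<le> x0" "x0 \<le> C1"
    and en: "d0\<^sup>2 * x0 = x0 - x0\<^sup>2 - (C - H * x0)\<^sup>2"
  obtains t where "X t = x0" "Del t = d0"
proof -
  obtain \<phi> where \<phi>: "\<phi> \<in> am_range p" "(C1 - C2) * (sin \<phi>)\<^sup>2 = C1 - x0"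
  proof (cases "C1 = C2")
    case True
    then show ?thesis using that[of 0] assms am_range(3) by simp
  next
    case False
    define q where "q = (C1 - x0) / (C1 - C2)"
    have q: "0 \<le> q" "q \<le> 1" "(C1 - C2) * q = C1 - x0"
      using False C2_le assms by (auto simp: q_def divide_simps)
    have sq: "0 \<le> sqrt q" "sqrt q \<le> 1" using q by auto
    have "(C1 - C2) * (sin (arcsin (sqrt q)))\<^sup>2 = C1 - x0"
      using sq q by (subst sin_arcsin) (auto intro: order_trans[of _ 0])
    moreover have "arcsin (sqrt q) \<in> am_range p"
    proof (cases "p < 1")
      case False
      \<comment> \<open>For modulus 1 the smaller root is 0, so \<open>x0 > 0\<close> keeps
        \<open>q\<close> below 1 and the angle away from the excluded end point
        \<open>pi / 2\<close>.\<close>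
      then have "p = 1" using p_bounds by simp
      then have "C2 = 0" using p_sq(2) by simp
      then have "q < 1" using assms \<open>C1 \<noteq> C2\<close> C1_pos by (simp add: q_def)
      then have "arcsin (sqrt q) < pi / 2" "- (pi / 2) < arcsin (sqrt q)"
        using arcsin_lt_bounded[of "sqrt q"] sq by auto
      then show ?thesis unfolding am_range_def mem_Collect_eq abs_less_iff by linarith
    qed (simp add: am_range_def)
    ultimately show ?thesis using that by blast
  qed
  have A: "A (elliptic_F p s / \<Xi>) = s" if "s \<in> am_range p" for s
    using jacobi_am_unique[OF p_bounds that] Xi_pos by (simp add: A_def)
  have m: "- \<phi> \<in> am_range p" using \<phi>(1) by (simp add: am_range_def)
  let ?t = "elliptic_F p \<phi> / \<Xi>" and ?t' = "elliptic_F p (- \<phi>) / \<Xi>"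
  have X: "X ?t = x0" "X ?t' = x0" unfolding X_eq A[OF \<phi>(1)] A[OF m] using \<phi>(2) by simp_all
  have "(D ?t)\<^sup>2 = (D ?t')\<^sup>2" unfolding D_sq A[OF \<phi>(1)] A[OF m] by simp
  then have "D ?t = D ?t'" using D_pos by (meson less_imp_le power2_eq_imp_eq)
  then have D: "Del ?t' = - Del ?t" unfolding Del_def A[OF \<phi>(1)] A[OF m] by simp
  have "(Del ?t)\<^sup>2 * x0 = d0\<^sup>2 * x0" using energy[of ?t] unfolding X en .
  then have "(Del ?t)\<^sup>2 = d0\<^sup>2" using assms(1) by simp
  then have "Del ?t = d0 \<or> Del ?t' = d0" unfolding D by (auto simp: power2_eq_iff)
  then show ?thesis using that X by blast
qed

text \<open>After \<open>X\<close> and \<open>Del\<close> are matched, \<open>z0\<close> and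
  \<open>Z t\<close> have equal modulus. If they are nonzero, the quotient \<open>u\<close> also
  matches the velocities by \<open>V_cnj_Z\<close>; if both vanish, \<open>u\<close> is the quotient
  of the velocities, which have modulus 1.\<close>

lemma initial_match:
  assumes "0 < x0" "C2 \<le> x0" "x0 \<le> C1"
    and "d0\<^sup>2 * x0 = x0 - x0\<^sup>2 - (C - H * x0)\<^sup>2"
    and z0: "(norm z0)\<^sup>2 = 1 - x0"
    and vz: "v0 * cnj z0 = of_real (- x0 * d0) + \<i> * of_real (C - H * x0)"
    and v0: "z0 = 0 \<Longrightarrow> norm v0 = 1"
  obtains t u where "X t = x0" "Del t = d0" "norm u = 1" "z0 = u * Z t" "v0 = u * V t"
proof -
  obtain t where t: "X t = x0" "Del t = d0" using attains[OF assms(1-4)] .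
  have nZ: "norm (Z t) = norm z0" using norm_Z[of t] z0 t
    by (metis norm_ge_zero power2_eq_imp_eq)
  show ?thesis
  proof (cases "Z t = 0")
    case True
    then have z: "z0 = 0" using nZ by simp
    then have "C1 = 1" using z0 assms C1_le by simp
    then have V: "norm (V t) = 1" by (rule norm_V_C1[OF _ True])
    then have "V t \<noteq> 0" by auto
    show ?thesis by (rule that[OF t, of "v0 / V t"]) (use V v0 z True \<open>V t \<noteq> 0\<close> in \<open>auto simp: norm_divide\<close>)
  next
    case False
    define u where "u = z0 / Z t"
    have u: "norm u = 1" "z0 = u * Z t" using False nZ by (auto simp: u_def norm_divide)
    have "v0 * cnj z0 = V t * cnj (Z t)" unfolding vz V_cnj_Z t ..
    then have "v0 * cnj u = V t" using False by (simp add: u(2))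
    then have "u * V t = v0 * (u * cnj u)" by (simp add: mult_ac)
    also have "u * cnj u = 1" by (simp add: complex_norm_square[symmetric] u(1))
    finally show ?thesis using that[OF t u] by simp
  qed
qed

text \<open>For \<open>C1 = 1\<close> the formula uses
  \<open>sqrt (1 - X t) = p * \<bar>sin (A t)\<bar>\<close>, whereas \<open>Z t\<close> contains
  \<open>p * sin (A t)\<close>; the sign change in \<open>basis_at\<close> is exactly the missing
  sign.\<close>

lemma rot_param_model:
  "rot_param (basis_at e C1 p \<Xi> t) (radius C1 p \<Xi>) (angle H C C1 C2 p \<Xi>) \<theta> t =
     (sqrt (X t) * cos \<theta>) *\<^sub>R e 1 + (sqrt (X t) * sin \<theta>) *\<^sub>R e 2 + Re (Z t) *\<^sub>R e 3 + Im (Z t) *\<^sub>R e 4"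
proof -
  have r: "radius C1 p \<Xi> t = sqrt (X t)"
    using D_pos[of t] by (simp add: radius_def X_def D_def real_sqrt_mult)
  have r2: "(sqrt (X t))\<^sup>2 = X t" using X_pos[of t] by simp
  have num: "(1::4) \<noteq> 3" "(1::4) \<noteq> 4" "(2::4) \<noteq> 3" "(2::4) \<noteq> 4" by simp_all
  show ?thesis
  proof (cases "C1 = 1")
    case True
    have a: "angle H C C1 C2 p \<Xi> t = H * t" unfolding angle_def if_P[OF True] ..
    have sn: "jacobi_sn p (\<Xi> * t) = sin (A t)" by (simp add: jacobi_sn_def A_def)
    have q: "sqrt (1 - X t) = p * \<bar>sin (A t)\<bar>"
      unfolding X1[OF True] using p_bounds by (simp add: real_sqrt_mult)
    have b: "basis_at e C1 p \<Xi> t = (if sin (A t) < 0 then (\<lambda>i. if i \<in> {3, 4} then - e i else e i) else e)"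
      unfolding basis_at_def sn using True by (simp only: simp_thms)
    show ?thesis unfolding rot_param_def r r2 a q b Z1[OF True] using num by auto
  next
    case False
    have b: "basis_at e C1 p \<Xi> t = e" unfolding basis_at_def using False by (simp only: simp_thms if_False)
    show ?thesis unfolding rot_param_def r r2 b Z_def if_not_P[OF False] \<psi>_def by simp
  qed
qed

end

text \<open>By \<open>en\<close> the polynomial takes the value
  \<open>- (d0\<^sup>2 * x0) \<le> 0\<close> at \<open>x0\<close>. Hence its discriminant is
  nonnegative and \<open>x0\<close> lies between the roots.\<close>

lemma model_profile_exists:
  fixes H C x0 d0 :: real
  assumes x0: "0 < x0" "x0 \<le> 1" and en: "d0\<^sup>2 * x0 = x0 - x0\<^sup>2 - (C - H * x0)\<^sup>2"
  obtains C1 C2 where "model_profile H C C1 C2" "C2 \<le> x0" "x0 \<le> C1"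
proof -
  define a b r where "a = H\<^sup>2 + 1" and "b = 1 + 2 * H * C" and "r = sqrt (b\<^sup>2 - 4 * a * C\<^sup>2)"
  have a: "a \<ge> 1" by (simp add: a_def)
  have p: "a * x0\<^sup>2 - b * x0 + C\<^sup>2 = - (d0\<^sup>2 * x0)"
    unfolding en a_def b_def by (simp add: power2_eq_square algebra_simps)
  then have "a * x0\<^sup>2 - b * x0 + C\<^sup>2 \<le> 0" using x0 by simp
  then have "4 * a * (a * x0\<^sup>2 - b * x0 + C\<^sup>2) \<le> 0" using a by (intro mult_nonneg_nonpos) auto
  then have disc: "(2 * a * x0 - b)\<^sup>2 \<le> b\<^sup>2 - 4 * a * C\<^sup>2"
    by (simp add: power2_eq_square algebra_simps)
  then have d0: "0 \<le> b\<^sup>2 - 4 * a * C\<^sup>2" by (rule order_trans[OF zero_le_power2])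
  then have r: "r \<ge> 0" "r\<^sup>2 = b\<^sup>2 - 4 * a * C\<^sup>2" by (auto simp: r_def)
  have ab: "\<bar>2 * a * x0 - b\<bar> \<le> r" using disc r by (metis abs_le_square_iff abs_of_nonneg)
  define C1 C2 where "C1 = (b + r) / (2 * a)" and "C2 = (b - r) / (2 * a)"
  have sum: "a * (C1 + C2) = b" using a by (simp add: C1_def C2_def field_simps)
  have "a * (C1 * C2) = (b\<^sup>2 - r\<^sup>2) / (4 * a)" using a by (simp add: C1_def C2_def field_simps power2_eq_square)
  then have prod: "a * (C1 * C2) = C\<^sup>2" unfolding r(2) using a by simp
  have le: "C2 \<le> C1" "C2 \<le> x0" "x0 \<le> C1"
    using ab r(1) a by (auto simp: C1_def C2_def field_simps abs_le_iff)
  have C1: "0 < C1" using le x0 by linarith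
  have "0 \<le> a * (C1 * C2)" unfolding prod by simp
  then have C2: "0 \<le> C2" using C1 a by (simp add: zero_le_mult_iff)
  have fac: "a * ((1 - C1) * (1 - C2)) = (H - C)\<^sup>2"
  proof -
    have "a * ((1 - C1) * (1 - C2)) = a - a * (C1 + C2) + a * (C1 * C2)" by (simp add: algebra_simps)
    then show ?thesis unfolding sum prod by (simp add: a_def b_def power2_eq_square algebra_simps)
  qed
  \<comment> \<open>Since the polynomial is nonnegative at 1, \<open>C1 > 1\<close> would force
    \<open>C2 \<ge> 1\<close>, hence \<open>C2 = 1\<close> because
    \<open>C2 \<le> x0 \<le> 1\<close>. Then \<open>H = C\<close>, and the product of the roots
    gives \<open>a * C1 = H\<^sup>2 < a\<close>.\<close>
  have "C1 \<le> 1"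
  proof (rule ccontr)
    assume n: "\<not> C1 \<le> 1"
    have "0 \<le> a * ((1 - C1) * (1 - C2))" unfolding fac by simp
    then have "0 \<le> (1 - C1) * (1 - C2)" using a by (simp add: zero_le_mult_iff)
    then have "C2 = 1" using n le x0 by (auto simp: zero_le_mult_iff)
    then have "H = C" using fac by simp
    then have "a * C1 = a - 1" using prod \<open>C2 = 1\<close> by (simp add: a_def)
    moreover have "a * 1 \<le> a * C1" using n a by (intro mult_left_mono) auto
    ultimately show False by simp
  qed
  then have "model_profile H C C1 C2"
    using C1 C2 le sum prod unfolding a_def b_def by unfold_locales
  then show ?thesis using that le by blast
qed

section \<open>Frames adapted to the rotation\<close>

lemma orthonormal4_expand:
  fixes a b c d w :: "real^4"
  assumes "a \<bullet> a = 1" "b \<bullet> b = 1" "c \<bullet> c = 1" "d \<bullet> d = 1"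
    "a \<bullet> b = 0" "a \<bullet> c = 0" "a \<bullet> d = 0" "b \<bullet> c = 0" "b \<bullet> d = 0" "c \<bullet> d = 0"
  shows "w = (w \<bullet> a) *\<^sub>R a + (w \<bullet> b) *\<^sub>R b + (w \<bullet> c) *\<^sub>R c + (w \<bullet> d) *\<^sub>R d"
proof -
  let ?B = "{a, b, c, d}"
  have ne: "a \<noteq> b" "a \<noteq> c" "a \<noteq> d" "b \<noteq> c" "b \<noteq> d" "c \<noteq> d" using assms by auto
  have orth: "pairwise orthogonal ?B"
    using assms by (auto simp: pairwise_def orthogonal_def inner_commute)
  have "0 \<notin> ?B" using assms by auto
  then have ind: "independent ?B" using pairwise_orthogonal_independent orth by blast
  have "card ?B = 4" using ne by simp
  then have "UNIV \<subseteq> span ?B" by (intro card_ge_dim_independent ind) (auto simp: dim_UNIV)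
  then have "w \<in> span ?B" by blast
  then have "(\<Sum>i\<in>?B. (w \<bullet> i) *\<^sub>R i) = w"
    using assms orth \<open>w \<in> span ?B\<close>
    by (intro orthonormal_basis_expand[of ?B]) (auto simp: norm_eq_1)
  then show ?thesis using ne by (simp add: add.assoc)
qed

section \<open>The conformal frame and the structure equations\<close>

locale frame4 =
  fixes a b c d :: "real^4"
  assumes unit: "a \<bullet> a = 1" "b \<bullet> b = 1" "c \<bullet> c = 1" "d \<bullet> d = 1"
    and orth: "a \<bullet> b = 0" "a \<bullet> c = 0" "a \<bullet> d = 0" "b \<bullet> c = 0" "b \<bullet> d = 0" "c \<bullet> d = 0"
begin

lemmas frame_expand = orthonormal4_expand[OF unit orth]

lemma orth_sym: "b \<bullet> a = 0" "c \<bullet> a = 0" "d \<bullet> a = 0" "c \<bullet> b = 0" "d \<bullet> b = 0" "d \<bullet> c = 0"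
  using orth by (auto simp: inner_commute)

lemmas frame_simps = unit orth orth_sym

lemma frame_inner:
  "u \<bullet> w = (u \<bullet> a) * (w \<bullet> a) + (u \<bullet> b) * (w \<bullet> b) + (u \<bullet> c) * (w \<bullet> c) + (u \<bullet> d) * (w \<bullet> d)"
proof -
  have "w \<bullet> u = w \<bullet> ((u \<bullet> a) *\<^sub>R a + (u \<bullet> b) *\<^sub>R b + (u \<bullet> c) *\<^sub>R c + (u \<bullet> d) *\<^sub>R d)"
    by (rule arg_cong[OF frame_expand])
  then show ?thesis by (simp only: inner_add_right inner_scaleR_right inner_commute[of u w])
qed

definition K :: "real^4 \<Rightarrow> real^4" where "K y = (y \<bullet> a) *\<^sub>R b - (y \<bullet> b) *\<^sub>R a"
definition axdist :: "real^4 \<Rightarrow> real" where "axdist y = (y \<bullet> a)\<^sup>2 + (y \<bullet> b)\<^sup>2"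
definition mm :: "real^4 \<Rightarrow> real^4 \<Rightarrow> real" where "mm y n = (y \<bullet> a) * (n \<bullet> a) + (y \<bullet> b) * (n \<bullet> b)"
definition del :: "real^4 \<Rightarrow> real^4 \<Rightarrow> real" where "del y n = (n \<bullet> c) * (y \<bullet> d) - (n \<bullet> d) * (y \<bullet> c)"
text \<open>Up to sign the triple vector product of \<open>y\<close>, \<open>n\<close> and
  \<open>K y\<close> in R^4. Being polynomial it stays regular where \<open>zc y\<close> vanishes,
  and its first two coordinates show \<open>del\<close> as the rate of change of the logarithmic
  distance from the axis.\<close>

definition V :: "real^4 \<Rightarrow> real^4 \<Rightarrow> real^4" where
  "V y n = (del y n * (y \<bullet> a)) *\<^sub>R a + (del y n * (y \<bullet> b)) *\<^sub>R b
     + (axdist y * (n \<bullet> d) - mm y n * (y \<bullet> d)) *\<^sub>R c + (mm y n * (y \<bullet> c) - axdist y * (n \<bullet> c)) *\<^sub>R d"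
definition zc :: "real^4 \<Rightarrow> complex" where "zc y = Complex (y \<bullet> c) (y \<bullet> d)"

lemma K_coords: "K y \<bullet> a = - (y \<bullet> b)" "K y \<bullet> b = y \<bullet> a" "K y \<bullet> c = 0" "K y \<bullet> d = 0"
  by (simp_all add: K_def inner_diff_left frame_simps)

lemma V_coords: "V y n \<bullet> a = del y n * (y \<bullet> a)" "V y n \<bullet> b = del y n * (y \<bullet> b)"
  "V y n \<bullet> c = axdist y * (n \<bullet> d) - mm y n * (y \<bullet> d)" "V y n \<bullet> d = mm y n * (y \<bullet> c) - axdist y * (n \<bullet> c)"
  by (simp_all add: V_def inner_add_left frame_simps)

lemma K_skew: "u \<bullet> K w = - (K u \<bullet> w)"
  by (simp add: frame_inner[of u "K w"] frame_inner[of "K u" w] K_coords)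

lemma linear_K: "linear K"
  by (rule linearI) (simp_all add: K_def inner_add_left algebra_simps)

lemma K_self: "y \<bullet> K y = 0" using K_skew[of y y] by (simp add: inner_commute)

lemma K_norm: "K y \<bullet> K y = axdist y"
  by (simp add: frame_inner[of "K y" "K y"] K_coords axdist_def power2_eq_square)

end

locale normal_pt = frame4 +
  fixes y n :: "real^4"
  assumes yy: "y \<bullet> y = 1" and nn: "n \<bullet> n = 1" and yn: "y \<bullet> n = 0" and nK: "n \<bullet> K y = 0"
    and ax: "axdist y > 0"
begin

text \<open>As \<open>n\<close> is orthogonal to \<open>K y\<close>, the parts of \<open>n\<close>
  and \<open>y\<close> in the rotation plane are parallel, with ratio \<open>k\<close>. The
  principal curvature in the direction of \<open>K y\<close> is \<open>- k\<close>.\<close>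

definition k :: real where "k = mm y n / axdist y"

lemma n_a: "n \<bullet> a = k * (y \<bullet> a)" and n_b: "n \<bullet> b = k * (y \<bullet> b)" and mm_k: "mm y n = k * axdist y"
proof -
  have e: "(y \<bullet> a) * (n \<bullet> b) = (y \<bullet> b) * (n \<bullet> a)"
    using nK by (simp add: frame_inner[of n "K y"] K_coords mult.commute)
  have "axdist y * (n \<bullet> a) = (y \<bullet> a) * ((y \<bullet> a) * (n \<bullet> a)) + (y \<bullet> b) * ((y \<bullet> b) * (n \<bullet> a))"
    by (simp add: axdist_def power2_eq_square algebra_simps)
  also have "\<dots> = (y \<bullet> a) * mm y n" unfolding e[symmetric] by (simp add: mm_def algebra_simps)
  finally show "n \<bullet> a = k * (y \<bullet> a)" using ax by (simp add: k_def field_simps)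
  have "axdist y * (n \<bullet> b) = (y \<bullet> a) * ((y \<bullet> a) * (n \<bullet> b)) + (y \<bullet> b) * ((y \<bullet> b) * (n \<bullet> b))"
    by (simp add: axdist_def power2_eq_square algebra_simps)
  also have "\<dots> = (y \<bullet> b) * mm y n" unfolding e by (simp add: mm_def algebra_simps)
  finally show "n \<bullet> b = k * (y \<bullet> b)" using ax by (simp add: k_def field_simps)
  show "mm y n = k * axdist y" using ax by (simp add: k_def)
qed

lemma K_n: "K n = k *\<^sub>R K y"
  by (simp add: K_def n_a n_b algebra_simps)

lemma eqs:
  "(y \<bullet> a) * (y \<bullet> a) + (y \<bullet> b) * (y \<bullet> b) = axdist y"
  "(y \<bullet> c) * (y \<bullet> c) + (y \<bullet> d) * (y \<bullet> d) = 1 - axdist y"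
  "(n \<bullet> c) * (n \<bullet> c) + (n \<bullet> d) * (n \<bullet> d) = 1 - k * k * axdist y"
  "(y \<bullet> c) * (n \<bullet> c) + (y \<bullet> d) * (n \<bullet> d) = - (k * axdist y)"
proof -
  show 1: "(y \<bullet> a) * (y \<bullet> a) + (y \<bullet> b) * (y \<bullet> b) = axdist y"
    by (simp add: axdist_def power2_eq_square)
  show "(y \<bullet> c) * (y \<bullet> c) + (y \<bullet> d) * (y \<bullet> d) = 1 - axdist y"
    using yy frame_inner[of y y] 1 by simp
  have "k * k * axdist y = (n \<bullet> a) * (n \<bullet> a) + (n \<bullet> b) * (n \<bullet> b)"
    unfolding n_a n_b 1[symmetric] by (simp add: algebra_simps)
  then show "(n \<bullet> c) * (n \<bullet> c) + (n \<bullet> d) * (n \<bullet> d) = 1 - k * k * axdist y"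
    using nn frame_inner[of n n] by simp
  have "k * axdist y = (y \<bullet> a) * (n \<bullet> a) + (y \<bullet> b) * (n \<bullet> b)"
    unfolding n_a n_b 1[symmetric] by (simp add: algebra_simps)
  then show "(y \<bullet> c) * (n \<bullet> c) + (y \<bullet> d) * (n \<bullet> d) = - (k * axdist y)"
    using yn frame_inner[of y n] by simp
qed

text \<open>Lagrange's identity for the parts of \<open>y\<close> and \<open>n\<close> in the (c,
  d)-plane. With \<open>mm = C - H * axdist\<close> it is the relation \<open>energy\<close> of the
  model.\<close>

lemma del_sq: "del y n * del y n * axdist y = axdist y - axdist y * axdist y - (k * axdist y) * (k * axdist y)"
proof -
  have "del y n * del y n = ((n \<bullet> c) * (n \<bullet> c) + (n \<bullet> d) * (n \<bullet> d)) * ((y \<bullet> c) * (y \<bullet> c) + (y \<bullet> d) * (y \<bullet> d))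
     - ((y \<bullet> c) * (n \<bullet> c) + (y \<bullet> d) * (n \<bullet> d)) * ((y \<bullet> c) * (n \<bullet> c) + (y \<bullet> d) * (n \<bullet> d))"
    by (simp add: del_def algebra_simps)
  then have D: "del y n * del y n = 1 - axdist y - k * k * axdist y"
    unfolding eqs by (simp add: algebra_simps)
  show ?thesis unfolding D by (simp add: algebra_simps)
qed

lemma V_c: "V y n \<bullet> c = axdist y * ((n \<bullet> d) - k * (y \<bullet> d))"
  and V_d: "V y n \<bullet> d = axdist y * (k * (y \<bullet> c) - (n \<bullet> c))"
  by (simp_all add: V_coords mm_k algebra_simps)

lemma V_cross: "(V y n \<bullet> d) * (y \<bullet> c) - (V y n \<bullet> c) * (y \<bullet> d) = k * axdist y"
proof -
  have "(V y n \<bullet> d) * (y \<bullet> c) - (V y n \<bullet> c) * (y \<bullet> d) =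
     axdist y * (k * ((y \<bullet> c) * (y \<bullet> c) + (y \<bullet> d) * (y \<bullet> d)) - ((y \<bullet> c) * (n \<bullet> c) + (y \<bullet> d) * (n \<bullet> d)))"
    unfolding V_c V_d by (simp add: algebra_simps)
  then show ?thesis unfolding eqs by (simp add: algebra_simps)
qed

lemma V_dot: "(V y n \<bullet> c) * (y \<bullet> c) + (V y n \<bullet> d) * (y \<bullet> d) = - (axdist y * del y n)"
  unfolding V_c V_d del_def by (simp add: algebra_simps)

lemma V_cross_n: "(n \<bullet> c) * (V y n \<bullet> d) - (n \<bullet> d) * (V y n \<bullet> c) = - axdist y"
proof -
  have "(n \<bullet> c) * (V y n \<bullet> d) - (n \<bullet> d) * (V y n \<bullet> c) =
     axdist y * (k * ((y \<bullet> c) * (n \<bullet> c) + (y \<bullet> d) * (n \<bullet> d)) - ((n \<bullet> c) * (n \<bullet> c) + (n \<bullet> d) * (n \<bullet> d)))"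
    unfolding V_c V_d by (simp add: algebra_simps)
  then show ?thesis unfolding eqs by (simp add: algebra_simps)
qed

lemma V_orth: "V y n \<bullet> y = 0" "V y n \<bullet> n = 0" "V y n \<bullet> K y = 0"
proof -
  have "V y n \<bullet> y = del y n * ((y \<bullet> a) * (y \<bullet> a) + (y \<bullet> b) * (y \<bullet> b))
      + ((V y n \<bullet> c) * (y \<bullet> c) + (V y n \<bullet> d) * (y \<bullet> d))"
    unfolding frame_inner[of "V y n" y] by (simp add: V_coords(1,2) algebra_simps)
  then show "V y n \<bullet> y = 0" unfolding V_dot eqs by simp
  have "V y n \<bullet> n = del y n * k * ((y \<bullet> a) * (y \<bullet> a) + (y \<bullet> b) * (y \<bullet> b))
      + ((V y n \<bullet> c) * (n \<bullet> c) + (V y n \<bullet> d) * (n \<bullet> d))"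
    unfolding frame_inner[of "V y n" n] by (simp add: V_coords(1,2) n_a n_b algebra_simps)
  also have "\<dots> = 0" unfolding eqs V_c V_d del_def by (simp add: algebra_simps)
  finally show "V y n \<bullet> n = 0" .
  show "V y n \<bullet> K y = 0" unfolding frame_inner[of "V y n" "K y"] K_coords V_coords(1,2) by simp
qed

lemma V_norm: "V y n \<bullet> V y n = axdist y"
proof -
  have "V y n \<bullet> V y n = del y n * del y n * ((y \<bullet> a) * (y \<bullet> a) + (y \<bullet> b) * (y \<bullet> b)) + axdist y * axdist y *
      (((n \<bullet> c) * (n \<bullet> c) + (n \<bullet> d) * (n \<bullet> d)) - 2 * k * ((y \<bullet> c) * (n \<bullet> c) + (y \<bullet> d) * (n \<bullet> d))
       + k * k * ((y \<bullet> c) * (y \<bullet> c) + (y \<bullet> d) * (y \<bullet> d)))"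
    unfolding frame_inner[of "V y n" "V y n"] V_coords(1,2) V_c V_d by (simp add: algebra_simps)
  then show ?thesis unfolding eqs using del_sq by (simp add: algebra_simps)
qed

text \<open>Counterpart of \<open>V_cnj_Z\<close> on the surface, in the form required by
  \<open>initial_match\<close> once \<open>mm\<close> is replaced by
  \<open>C - H * axdist\<close>.\<close>

lemma v_cnj_z: "zc (V y n) * cnj (zc y) = of_real (- axdist y * del y n) + \<i> * of_real (mm y n)"
  using V_dot V_cross by (auto simp: complex_eq_iff zc_def mm_k algebra_simps)

lemma norm_v: "zc y = 0 \<Longrightarrow> norm (zc (V y n)) = 1"
proof -
  assume "zc y = 0"
  then have z: "y \<bullet> c = 0" "y \<bullet> d = 0" by (auto simp: zc_def complex_eq_iff)
  then have 1: "axdist y = 1" using eqs(2) by simp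
  have "del y n = 0" using z by (simp add: del_def)
  then have "V y n \<bullet> V y n = (V y n \<bullet> c)\<^sup>2 + (V y n \<bullet> d)\<^sup>2"
    by (simp add: frame_inner[of "V y n" "V y n"] V_coords(1,2) power2_eq_square)
  then have "(norm (zc (V y n)))\<^sup>2 = 1" unfolding cmod_power2 using V_norm 1 by (simp add: zc_def)
  then show "norm (zc (V y n)) = 1" by (metis norm_ge_zero one_power2 power2_eq_imp_eq zero_le_one)
qed

lemma norm_z: "(norm (zc y))\<^sup>2 = 1 - axdist y"
  unfolding cmod_power2 using eqs(2) by (simp add: zc_def power2_eq_square)

lemma tangent_expand:
  assumes "w \<bullet> y = 0" "w \<bullet> n = 0"
  shows "w = ((w \<bullet> K y) / axdist y) *\<^sub>R K y + ((w \<bullet> V y n) / axdist y) *\<^sub>R V y n"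
proof -
  let ?r = "sqrt (axdist y)"
  have r: "?r * ?r = axdist y" "?r > 0" using ax by auto
  let ?e = "(1 / ?r) *\<^sub>R K y" and ?f = "(1 / ?r) *\<^sub>R V y n"
  have "w = (w \<bullet> y) *\<^sub>R y + (w \<bullet> n) *\<^sub>R n + (w \<bullet> ?e) *\<^sub>R ?e + (w \<bullet> ?f) *\<^sub>R ?f"
  proof (rule orthonormal4_expand)
    have q: "(1 / ?r) * ((1 / ?r) * axdist y) = 1" using r by (simp add: field_simps)
    show "?e \<bullet> ?e = 1" "?f \<bullet> ?f = 1"
      unfolding inner_scaleR_left inner_scaleR_right K_norm V_norm by (rule q)+
    show "y \<bullet> ?e = 0" using K_self by simp
    show "n \<bullet> ?e = 0" using nK by simp
    show "y \<bullet> ?f = 0" "n \<bullet> ?f = 0" "?e \<bullet> ?f = 0"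
      using V_orth by (simp_all add: inner_commute[of _ "V y n"])
  qed (fact yy nn yn)+
  then show ?thesis using assms r by (simp add: field_simps)
qed

text \<open>The structure equations: along a direction in which \<open>y\<close> moves by \<open>\<alpha> K + \<beta> V\<close>, tangency of
  the rotation field and the value of the mean curvature determine the motion of \<open>n\<close>.\<close>

lemma weingarten:
  fixes G L :: "real^2 \<Rightarrow> real^4"
  assumes G: "linear G" "inj G" and L: "linear L"
    and Gt: "\<And>v. G v \<bullet> y = 0" "\<And>v. G v \<bullet> n = 0" and Lt: "\<And>v. L v \<bullet> y = 0" "\<And>v. L v \<bullet> n = 0"
    and sym: "\<And>v w. L v \<bullet> G w = L w \<bullet> G v"
    and LK: "\<And>v. L v \<bullet> K y = - (n \<bullet> K (G v))"
    and tr: "\<And>v w. G v \<bullet> G v = 1 \<Longrightarrow> G w \<bullet> G w = 1 \<Longrightarrow> G v \<bullet> G w = 0 \<Longrightarrow> L v \<bullet> G v + L w \<bullet> G w = - (2 * H)"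
  shows "\<exists>v. G v = V y n"
    and "\<exists>\<alpha> \<beta>. G v = \<alpha> *\<^sub>R K y + \<beta> *\<^sub>R V y n \<and> L v = (k * \<alpha>) *\<^sub>R K y - (\<beta> * (2 * H + k)) *\<^sub>R V y n"
proof -
  \<comment> \<open>By dimension the tangent plane is the whole span of \<open>K y\<close> and
    \<open>V y n\<close>, so both vectors have preimages, called \<open>p\<close> and
    \<open>q\<close> below.\<close>
  have sub: "range G \<subseteq> span {K y, V y n}"
  proof
    fix w assume "w \<in> range G"
    then have "w = ((w \<bullet> K y) / axdist y) *\<^sub>R K y + ((w \<bullet> V y n) / axdist y) *\<^sub>R V y n"
      using tangent_expand[of w] Gt by blast
    then show "w \<in> span {K y, V y n}"
      by (metis insertCI span_add span_base span_scale)
  qed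
  have "dim (range G) = dim (UNIV :: (real^2) set)" using dim_image_eq[OF G(1)] G(2) by (simp add: inj_on_subset)
  then have "dim (range G) = 2" by simp
  moreover have "dim (span {K y, V y n}) \<le> 2"
    unfolding dim_span by (rule order_trans[OF dim_le_card']) (auto simp: card_insert_if)
  ultimately have "range G = span {K y, V y n}"
    by (intro subspace_dim_equal sub linear_subspace_image[OF G(1) subspace_UNIV] subspace_span) auto
  then have "K y \<in> range G" "V y n \<in> range G" by (simp_all add: span_base)
  then obtain p q where p: "G p = K y" and q: "G q = V y n" by (metis imageE)
  then show "\<exists>v. G v = V y n" by blast
  define \<alpha> \<beta> where "\<alpha> = (G v \<bullet> K y) / axdist y" and "\<beta> = (G v \<bullet> V y n) / axdist y"
  have Gv: "G v = \<alpha> *\<^sub>R K y + \<beta> *\<^sub>R V y n" unfolding \<alpha>_def \<beta>_def by (rule tangent_expand[OF Gt])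
  then have "G v = G (\<alpha> *\<^sub>R p + \<beta> *\<^sub>R q)" by (simp add: linear_add[OF G(1)] linear_scale[OF G(1)] p q)
  then have v: "v = \<alpha> *\<^sub>R p + \<beta> *\<^sub>R q" using G(2) by (simp add: inj_eq)
  \<comment> \<open>The hypothesis \<open>LK\<close> yields one row of the matrix of
    \<open>L\<close> in this frame; symmetry yields the remaining off-diagonal entry and the trace
    the remaining diagonal entry.\<close>
  have LK': "L w \<bullet> K y = k * (K y \<bullet> G w)" for w
    unfolding LK K_skew[of n] K_n by simp
  have LqK: "L q \<bullet> K y = 0" unfolding LK' q using V_orth(3) by (simp add: inner_commute)
  have LpV: "L p \<bullet> V y n = 0" using sym[of p q] LqK p q by simp
  have LpK: "L p \<bullet> K y = k * axdist y" unfolding LK' p K_norm ..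
  have LqV: "L q \<bullet> V y n = - ((2 * H + k) * axdist y)"
  proof -
    \<comment> \<open>Both frame vectors have squared length \<open>axdist y\<close>; scaling by
      \<open>r\<close> makes the trace hypothesis applicable.\<close>
    define r where "r = 1 / sqrt (axdist y)"
    have r: "r * r * axdist y = 1" using ax by (simp add: r_def)
    have "L (r *\<^sub>R p) \<bullet> G (r *\<^sub>R p) + L (r *\<^sub>R q) \<bullet> G (r *\<^sub>R q) = - (2 * H)"
      by (rule tr) (use r V_norm K_norm V_orth(3) in \<open>simp_all add: linear_scale[OF G(1)] p q inner_commute mult.assoc\<close>)
    then have "r * r * (L p \<bullet> K y) + r * r * (L q \<bullet> V y n) = - (2 * H)"
      by (simp add: linear_scale[OF G(1)] linear_scale[OF L] p q mult.assoc)
    then have "axdist y * (r * r * (L p \<bullet> K y) + r * r * (L q \<bullet> V y n)) = - (2 * H) * axdist y" by simp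
    moreover have "axdist y * (r * r * (L p \<bullet> K y) + r * r * (L q \<bullet> V y n))
        = (r * r * axdist y) * ((L p \<bullet> K y) + (L q \<bullet> V y n))" by (simp add: algebra_simps)
    ultimately show ?thesis unfolding r LpK by (simp add: algebra_simps)
  qed
  have 1: "L v \<bullet> K y = k * \<alpha> * axdist y"
    unfolding v by (simp add: linear_add[OF L] linear_scale[OF L] inner_add_left LpK LqK)
  have 2: "L v \<bullet> V y n = - (\<beta> * (2 * H + k)) * axdist y"
    unfolding v by (simp add: linear_add[OF L] linear_scale[OF L] inner_add_left LpV LqV)
  have "L v = (k * \<alpha>) *\<^sub>R K y - (\<beta> * (2 * H + k)) *\<^sub>R V y n"
    using tangent_expand[OF Lt, of v] ax unfolding 1 2 by simp
  then show "\<exists>\<alpha> \<beta>. G v = \<alpha> *\<^sub>R K y + \<beta> *\<^sub>R V y n \<and> L v = (k * \<alpha>) *\<^sub>R K y - (\<beta> * (2 * H + k)) *\<^sub>R V y n"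
    using Gv by blast
qed

text \<open>The left-hand sides are the product-rule derivatives of \<open>axdist\<close>,
  \<open>mm\<close>, \<open>del\<close>, \<open>zc\<close> and the last two coordinates of
  \<open>V\<close>. The coefficient \<alpha> cancels because all of these are invariant under the
  rotations. The second equation makes \<open>H * axdist + mm\<close> a constant of motion.\<close>

lemma state_derivatives:
  assumes y': "y' = \<alpha> *\<^sub>R K y + \<beta> *\<^sub>R V y n"
    and n': "n' = (k * \<alpha>) *\<^sub>R K y - (\<beta> * (2 * H + k)) *\<^sub>R V y n"
    and C: "C = H * axdist y + mm y n"
  shows "2 * (y \<bullet> a) * (y' \<bullet> a) + 2 * (y \<bullet> b) * (y' \<bullet> b) = \<beta> * (2 * axdist y * del y n)" (is ?X)
    and "(y' \<bullet> a) * (n \<bullet> a) + (y \<bullet> a) * (n' \<bullet> a) + ((y' \<bullet> b) * (n \<bullet> b) + (y \<bullet> b) * (n' \<bullet> b))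
      = - (H * (\<beta> * (2 * axdist y * del y n)))" (is ?M)
    and "(n' \<bullet> c) * (y \<bullet> d) + (n \<bullet> c) * (y' \<bullet> d) - ((n' \<bullet> d) * (y \<bullet> c) + (n \<bullet> d) * (y' \<bullet> c))
      = \<beta> * (C\<^sup>2 / axdist y - (1 + H\<^sup>2) * axdist y)" (is ?D)
    and "Complex (y' \<bullet> c) (y' \<bullet> d) = of_real \<beta> * zc (V y n)" (is ?Z)
    and "Complex
       (\<beta> * (2 * axdist y * del y n) * (n \<bullet> d) + axdist y * (n' \<bullet> d)
         - (- (H * (\<beta> * (2 * axdist y * del y n))) * (y \<bullet> d) + mm y n * (y' \<bullet> d)))
       (- (H * (\<beta> * (2 * axdist y * del y n))) * (y \<bullet> c) + mm y n * (y' \<bullet> c)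
         - (\<beta> * (2 * axdist y * del y n) * (n \<bullet> c) + axdist y * (n' \<bullet> c)))
      = of_real \<beta> * (2 * of_real (del y n) * zc (V y n)
          + 2 * \<i> * of_real C * (zc (V y n) - of_real (del y n) * zc y))" (is ?V)
proof -
  have yc: "y' \<bullet> a = - (\<alpha> * (y \<bullet> b)) + \<beta> * (del y n * (y \<bullet> a))" "y' \<bullet> b = \<alpha> * (y \<bullet> a) + \<beta> * (del y n * (y \<bullet> b))"
    "y' \<bullet> c = \<beta> * (V y n \<bullet> c)" "y' \<bullet> d = \<beta> * (V y n \<bullet> d)"
    unfolding y' by (simp_all add: inner_add_left K_coords V_coords(1,2))
  have nc: "n' \<bullet> a = - (k * \<alpha> * (y \<bullet> b)) - (\<beta> * (2 * H + k)) * (del y n * (y \<bullet> a))"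
    "n' \<bullet> b = k * \<alpha> * (y \<bullet> a) - (\<beta> * (2 * H + k)) * (del y n * (y \<bullet> b))"
    "n' \<bullet> c = - (\<beta> * (2 * H + k)) * (V y n \<bullet> c)" "n' \<bullet> d = - (\<beta> * (2 * H + k)) * (V y n \<bullet> d)"
    unfolding n' by (simp_all add: inner_diff_left K_coords V_coords(1,2))
  have Ck: "C = (H + k) * axdist y" unfolding C mm_k by (simp add: algebra_simps)
  have "2 * (y \<bullet> a) * (y' \<bullet> a) + 2 * (y \<bullet> b) * (y' \<bullet> b)
      = \<beta> * (2 * del y n) * ((y \<bullet> a) * (y \<bullet> a) + (y \<bullet> b) * (y \<bullet> b))"
    unfolding yc by (simp add: algebra_simps)
  then show ?X unfolding eqs by simp
  have "(y' \<bullet> a) * (n \<bullet> a) + (y \<bullet> a) * (n' \<bullet> a) + ((y' \<bullet> b) * (n \<bullet> b) + (y \<bullet> b) * (n' \<bullet> b))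
     = - (2 * H * \<beta> * del y n) * ((y \<bullet> a) * (y \<bullet> a) + (y \<bullet> b) * (y \<bullet> b))"
    unfolding yc nc n_a n_b by (simp add: algebra_simps)
  then show ?M unfolding eqs by simp
  have "(n' \<bullet> c) * (y \<bullet> d) + (n \<bullet> c) * (y' \<bullet> d) - ((n' \<bullet> d) * (y \<bullet> c) + (n \<bullet> d) * (y' \<bullet> c))
     = \<beta> * ((2 * H + k) * ((V y n \<bullet> d) * (y \<bullet> c) - (V y n \<bullet> c) * (y \<bullet> d)) + ((n \<bullet> c) * (V y n \<bullet> d) - (n \<bullet> d) * (V y n \<bullet> c)))"
    unfolding yc nc by (simp add: algebra_simps)
  also have "\<dots> = \<beta> * ((2 * H + k) * (k * axdist y) - axdist y)" unfolding V_cross V_cross_n by simp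
  also have "(2 * H + k) * (k * axdist y) - axdist y = C\<^sup>2 / axdist y - (1 + H\<^sup>2) * axdist y"
    unfolding Ck using ax by (simp add: field_simps power2_eq_square)
  finally show ?D .
  show ?Z unfolding yc by (simp add: complex_eq_iff zc_def)
  have nd: "axdist y * (n \<bullet> d) = V y n \<bullet> c + k * axdist y * (y \<bullet> d)" unfolding V_c by (simp add: algebra_simps)
  have nc': "axdist y * (n \<bullet> c) = k * axdist y * (y \<bullet> c) - V y n \<bullet> d" unfolding V_d by (simp add: algebra_simps)
  have "\<beta> * (2 * axdist y * del y n) * (n \<bullet> d) + axdist y * (n' \<bullet> d)
         - (- (H * (\<beta> * (2 * axdist y * del y n))) * (y \<bullet> d) + mm y n * (y' \<bullet> d))
      = \<beta> * (2 * del y n * (axdist y * (n \<bullet> d)) - axdist y * (2 * H + k) * (V y n \<bullet> d)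
          + 2 * H * axdist y * del y n * (y \<bullet> d) - k * axdist y * (V y n \<bullet> d))"
    unfolding yc nc mm_k by (simp add: algebra_simps)
  moreover have "- (H * (\<beta> * (2 * axdist y * del y n))) * (y \<bullet> c) + mm y n * (y' \<bullet> c)
         - (\<beta> * (2 * axdist y * del y n) * (n \<bullet> c) + axdist y * (n' \<bullet> c))
      = \<beta> * (- (2 * H * axdist y * del y n) * (y \<bullet> c) + k * axdist y * (V y n \<bullet> c)
          - 2 * del y n * (axdist y * (n \<bullet> c)) + axdist y * (2 * H + k) * (V y n \<bullet> c))"
    unfolding yc nc mm_k by (simp add: algebra_simps)
  ultimately show ?V unfolding nd nc' Ck
    by (simp add: complex_eq_iff zc_def algebra_simps)
qed

end

section \<open>Twice differentiable parametrizations\<close>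

text \<open>Schwarz's theorem. Two applications of the mean value theorem turn the second difference
  of \<open>f\<close> into a value of either mixed derivative near \<open>x\<close>, according to
  the order chosen; continuity then identifies the values at \<open>x\<close>.\<close>

lemma mixed_derivatives_eq:
  fixes f :: "'a::real_normed_vector \<Rightarrow> real"
  assumes U: "open U" "x \<in> U"
    and f: "\<And>y. y \<in> U \<Longrightarrow> (f has_derivative (\<lambda>u. D u y)) (at y)"
    and Dv: "\<And>y. y \<in> U \<Longrightarrow> (D v has_derivative (\<lambda>u. Dv u y)) (at y)"
    and Dw: "\<And>y. y \<in> U \<Longrightarrow> (D w has_derivative (\<lambda>u. Dw u y)) (at y)"
    and cont: "continuous_on U (Dv w)" "continuous_on U (Dw v)"
  shows "Dv w x = Dw v x"
proof -
  obtain e where e: "e > 0" "ball x e \<subseteq> U" using U open_contains_ball by blast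
  have line: "((\<lambda>s. F (y + s *\<^sub>R u)) has_real_derivative F' u (y + s *\<^sub>R u)) (at s)"
    if "(F has_derivative (\<lambda>u'. F' u' (y + s *\<^sub>R u))) (at (y + s *\<^sub>R u))" for F F' y u and s :: real
  proof -
    have "((\<lambda>s. y + s *\<^sub>R u) has_derivative (\<lambda>h. h *\<^sub>R u)) (at s)"
      by (auto intro!: derivative_eq_intros)
    from has_derivative_compose[OF this, of F "\<lambda>u'. F' u' (y + s *\<^sub>R u)"] that
    have "((\<lambda>s. F (y + s *\<^sub>R u)) has_derivative (\<lambda>h. F' (h *\<^sub>R u) (y + s *\<^sub>R u))) (at s)" by simp
    moreover have "F' (h *\<^sub>R u) (y + s *\<^sub>R u) = F' u (y + s *\<^sub>R u) * h" for h
      using linear_scale[OF has_derivative_linear[OF that], of h u] by simp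
    ultimately show ?thesis by (simp add: has_field_derivative_def)
  qed
  have key: "\<exists>p. norm (p - x) \<le> h * (norm a + norm b) \<and>
      f (x + h *\<^sub>R a + h *\<^sub>R b) - f (x + h *\<^sub>R a) - f (x + h *\<^sub>R b) + f x = h * h * E b p"
    if h: "0 < h" "h * (norm a + norm b) < e"
      and Da: "\<And>y. y \<in> U \<Longrightarrow> (D a has_derivative (\<lambda>u. E u y)) (at y)" for a b h E
  proof -
    have inU: "x + s *\<^sub>R a + t *\<^sub>R b \<in> U" and le: "norm (s *\<^sub>R a + t *\<^sub>R b) \<le> h * (norm a + norm b)"
      if "0 \<le> s" "s \<le> h" "0 \<le> t" "t \<le> h" for s t
    proof -
      have "norm (s *\<^sub>R a + t *\<^sub>R b) \<le> s * norm a + t * norm b"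
        using norm_triangle_ineq[of "s *\<^sub>R a" "t *\<^sub>R b"] that by simp
      also have "\<dots> \<le> h * norm a + h * norm b" using that by (intro add_mono mult_right_mono) auto
      finally show le: "norm (s *\<^sub>R a + t *\<^sub>R b) \<le> h * (norm a + norm b)" by (simp add: algebra_simps)
      moreover have "dist (x + (s *\<^sub>R a + t *\<^sub>R b)) x = norm (s *\<^sub>R a + t *\<^sub>R b)"
        by (simp only: dist_norm add_diff_cancel_left')
      ultimately have "x + (s *\<^sub>R a + t *\<^sub>R b) \<in> ball x e"
        using h(2) unfolding mem_ball dist_commute[of x] by linarith
      then show "x + s *\<^sub>R a + t *\<^sub>R b \<in> U" using e by (auto simp: add.assoc)
    qed
    define \<phi> where "\<phi> = (\<lambda>s. f ((x + h *\<^sub>R b) + s *\<^sub>R a) - f (x + s *\<^sub>R a))"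
    have "\<exists>z. 0 < z \<and> z < h \<and> \<phi> h - \<phi> 0 = (h - 0) * (D a ((x + h *\<^sub>R b) + z *\<^sub>R a) - D a (x + z *\<^sub>R a))"
    proof (rule MVT2[OF h(1)])
      fix s assume s: "0 \<le> s" "s \<le> h"
      have m: "(x + h *\<^sub>R b) + s *\<^sub>R a \<in> U" "x + s *\<^sub>R a \<in> U"
        using inU[of s h] inU[of s 0] s h by (simp_all add: algebra_simps)
      show "(\<phi> has_real_derivative D a ((x + h *\<^sub>R b) + s *\<^sub>R a) - D a (x + s *\<^sub>R a)) (at s)"
        unfolding \<phi>_def by (intro DERIV_diff line[of f D] f m)
    qed
    then obtain z where z: "0 < z" "z < h"
      "\<phi> h - \<phi> 0 = h * (D a ((x + z *\<^sub>R a) + h *\<^sub>R b) - D a ((x + z *\<^sub>R a) + 0 *\<^sub>R b))"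
      by (auto simp: algebra_simps)
    have "\<exists>q. 0 < q \<and> q < h \<and> D a ((x + z *\<^sub>R a) + h *\<^sub>R b) - D a ((x + z *\<^sub>R a) + 0 *\<^sub>R b)
        = (h - 0) * E b ((x + z *\<^sub>R a) + q *\<^sub>R b)"
    proof (rule MVT2[OF h(1)])
      fix s assume s: "0 \<le> s" "s \<le> h"
      show "((\<lambda>s. D a ((x + z *\<^sub>R a) + s *\<^sub>R b)) has_real_derivative E b ((x + z *\<^sub>R a) + s *\<^sub>R b)) (at s)"
        by (intro line[of "D a" E] Da inU) (use s z in auto)
    qed
    then obtain q where q: "0 < q" "q < h"
      "D a ((x + z *\<^sub>R a) + h *\<^sub>R b) - D a ((x + z *\<^sub>R a) + 0 *\<^sub>R b) = h * E b ((x + z *\<^sub>R a) + q *\<^sub>R b)"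
      by auto
    have "f (x + h *\<^sub>R a + h *\<^sub>R b) - f (x + h *\<^sub>R a) - f (x + h *\<^sub>R b) + f x = \<phi> h - \<phi> 0"
      by (simp add: \<phi>_def algebra_simps)
    also have "\<dots> = h * h * E b ((x + z *\<^sub>R a) + q *\<^sub>R b)" unfolding z q by simp
    finally show ?thesis using le[of z q] z q
      by (intro exI[of _ "(x + z *\<^sub>R a) + q *\<^sub>R b"]) (auto simp: algebra_simps)
  qed
  have "\<bar>Dv w x - Dw v x\<bar> < 2 * r" if r: "r > 0" for r
  proof -
    obtain d1 where d1: "d1 > 0" "\<And>y. y \<in> U \<Longrightarrow> dist y x < d1 \<Longrightarrow> dist (Dv w y) (Dv w x) < r"
      using cont(1) U r unfolding continuous_on_iff by meson
    obtain d2 where d2: "d2 > 0" "\<And>y. y \<in> U \<Longrightarrow> dist y x < d2 \<Longrightarrow> dist (Dw v y) (Dw v x) < r"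
      using cont(2) U r unfolding continuous_on_iff by meson
    define d where "d = min e (min d1 d2)"
    have d: "d > 0" "d \<le> e" "d \<le> d1" "d \<le> d2" using e d1 d2 by (auto simp: d_def)
    define h where "h = d / (norm v + norm w + 1)"
    have np: "norm v + norm w + 1 > 0" by (smt (verit) norm_ge_zero)
    have h: "0 < h" using d np by (simp add: h_def)
    have "h * (norm v + norm w) < h * (norm v + norm w + 1)" using h by (intro mult_strict_left_mono) auto
    also have "\<dots> = d" using np by (simp add: h_def)
    finally have hd: "h * (norm v + norm w) < d" .
    obtain p where p: "norm (p - x) \<le> h * (norm v + norm w)"
      "f (x + h *\<^sub>R v + h *\<^sub>R w) - f (x + h *\<^sub>R v) - f (x + h *\<^sub>R w) + f x = h * h * Dv w p"
      using key[OF h _ Dv] hd d by force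
    obtain q where q: "norm (q - x) \<le> h * (norm w + norm v)"
      "f (x + h *\<^sub>R w + h *\<^sub>R v) - f (x + h *\<^sub>R w) - f (x + h *\<^sub>R v) + f x = h * h * Dw v q"
      using key[OF h _ Dw, of v] hd d by (force simp: add.commute)
    have "f (x + h *\<^sub>R v + h *\<^sub>R w) - f (x + h *\<^sub>R v) - f (x + h *\<^sub>R w) + f x
        = f (x + h *\<^sub>R w + h *\<^sub>R v) - f (x + h *\<^sub>R w) - f (x + h *\<^sub>R v) + f x"
      by (simp add: add.assoc add.commute[of "h *\<^sub>R v"])
    then have "h * h * Dv w p = h * h * Dw v q" unfolding p q .
    then have "Dv w p = Dw v q" using h by simp
    have pd: "dist p x < d" and qd: "dist q x < d" using p q hd by (auto simp: dist_norm algebra_simps)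
    then have "p \<in> U" "q \<in> U" using d e(2) by (auto simp: subset_iff dist_commute)
    then have "dist (Dv w p) (Dv w x) < r" "dist (Dw v q) (Dw v x) < r"
      using d1(2)[OF _ less_le_trans[OF pd d(3)]] d2(2)[OF _ less_le_trans[OF qd d(4)]] by simp_all
    then show ?thesis using \<open>Dv w p = Dw v q\<close> by (simp add: dist_real_def)
  qed
  from this[of "\<bar>Dv w x - Dw v x\<bar> / 2"] show ?thesis by (cases "Dv w x = Dw v x") auto
qed

locale C2_chart =
  fixes U :: "(real^2) set" and g :: "real^2 \<Rightarrow> real^4"
  assumes openU: "open U" and C2: "C2_on U g"
    and sph: "\<And>x. x \<in> U \<Longrightarrow> norm (g x) = 1"
    and inj: "\<And>x. x \<in> U \<Longrightarrow> inj (\<lambda>v. dir_deriv g v x)"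
begin

lemma deriv: "x \<in> U \<Longrightarrow> (g has_derivative (\<lambda>v. dir_deriv g v x)) (at x)"
  using C2 openU unfolding C2_on_def dir_deriv_def
  by (simp add: differentiable_on_eq_differentiable_at flip: frechet_derivative_works)

lemma deriv2: "x \<in> U \<Longrightarrow> (dir_deriv g v has_derivative (\<lambda>w. dir_deriv (dir_deriv g v) w x)) (at x)"
proof -
  assume "x \<in> U"
  then have "dir_deriv g v differentiable (at x)"
    using C2 openU unfolding C2_on_def by (simp add: differentiable_on_eq_differentiable_at)
  then show ?thesis unfolding frechet_derivative_works dir_deriv_def[of "dir_deriv g v"] .
qed

lemma lin: "x \<in> U \<Longrightarrow> linear (\<lambda>v. dir_deriv g v x)"
  using deriv has_derivative_linear by blast

lemma lin2: "x \<in> U \<Longrightarrow> linear (\<lambda>w. dir_deriv (dir_deriv g v) w x)"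
  using deriv2 has_derivative_linear by blast

lemma dd_sym: "x \<in> U \<Longrightarrow> dir_deriv (dir_deriv g v) w x = dir_deriv (dir_deriv g w) v x"
proof (rule vector_eq_rdot[THEN iffD1], intro allI)
  fix z assume x: "x \<in> U"
  show "dir_deriv (dir_deriv g v) w x \<bullet> z = dir_deriv (dir_deriv g w) v x \<bullet> z"
    by (rule mixed_derivatives_eq[where f = "\<lambda>x. g x \<bullet> z" and D = "\<lambda>u y. dir_deriv g u y \<bullet> z"
          and Dv = "\<lambda>u y. dir_deriv (dir_deriv g v) u y \<bullet> z"
          and Dw = "\<lambda>u y. dir_deriv (dir_deriv g w) u y \<bullet> z", OF openU x])
      (use C2 in \<open>auto intro!: has_derivative_inner_left deriv deriv2 continuous_intros simp: C2_on_def\<close>)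
qed

lemma lin2': "x \<in> U \<Longrightarrow> linear (\<lambda>v. dir_deriv (dir_deriv g v) w x)"
  using lin2[of x w] by (simp add: dd_sym)

lemma sph_tangent: "x \<in> U \<Longrightarrow> dir_deriv g v x \<bullet> g x = 0"
proof -
  assume x: "x \<in> U"
  have "((\<lambda>x. g x \<bullet> g x) has_derivative (\<lambda>v. g x \<bullet> dir_deriv g v x + dir_deriv g v x \<bullet> g x)) (at x)"
    by (intro has_derivative_inner deriv x)
  moreover have "((\<lambda>x. g x \<bullet> g x) has_derivative (\<lambda>v. 0)) (at x)"
    by (rule has_derivative_transform_within_open[OF has_derivative_const openU x, of 1])
      (simp add: sph dot_square_norm)
  ultimately have "g x \<bullet> dir_deriv g v x + dir_deriv g v x \<bullet> g x = 0"
    using has_derivative_unique by (metis (no_types, lifting))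
  then show ?thesis by (simp add: inner_commute)
qed

end

lemma vec2_expand: "(v :: real^2) = (v $ 1) *\<^sub>R axis 1 1 + (v $ 2) *\<^sub>R axis 2 1"
  by (simp add: vec_eq_iff forall_2 axis_def)

text \<open>For a symmetric bilinear form \<open>B\<close>, its trace with respect to a scalar product with Gram
  matrix \<open>(E, F; F, G)\<close>.\<close>

lemma trace_formula:
  fixes B Q :: "real^2 \<Rightarrow> real^2 \<Rightarrow> real"
  assumes B: "\<And>w. linear (\<lambda>v. B v w)" "\<And>v w. B v w = B w v"
    and Q: "\<And>w. linear (\<lambda>v. Q v w)" "\<And>v w. Q v w = Q w v"
    and on: "Q v v = 1" "Q w w = 1" "Q v w = 0"
  shows "B v v + B w w = (B (axis 1 1) (axis 1 1) * Q (axis 2 1) (axis 2 1)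
      - 2 * B (axis 1 1) (axis 2 1) * Q (axis 1 1) (axis 2 1)
      + B (axis 2 1) (axis 2 1) * Q (axis 1 1) (axis 1 1))
      / (Q (axis 1 1) (axis 1 1) * Q (axis 2 1) (axis 2 1) - (Q (axis 1 1) (axis 2 1))\<^sup>2)"
proof -
  let ?e = "axis 1 1 :: real^2" and ?f = "axis 2 1 :: real^2"
  have bil: "R u u' = (u$1) * (u'$1) * R ?e ?e + ((u$1) * (u'$2) + (u$2) * (u'$1)) * R ?e ?f + (u$2) * (u'$2) * R ?f ?f"
    if R: "\<And>w. linear (\<lambda>v. R v w)" "\<And>v w. R v w = R w v" for R :: "real^2 \<Rightarrow> real^2 \<Rightarrow> real" and u u'
  proof -
    have l: "R u w = (u$1) * R ?e w + (u$2) * R ?f w" for u w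
      by (subst vec2_expand[of u]) (simp add: linear_add[OF R(1)] linear_scale[OF R(1)])
    show ?thesis
      unfolding l[of u u'] R(2)[of ?e u'] R(2)[of ?f u'] l[of u'] R(2)[of ?f ?e]
      by (simp add: algebra_simps)
  qed
  define E F G where "E = Q ?e ?e" and "F = Q ?e ?f" and "G = Q ?f ?f"
  define a b c d where "a = v$1" and "b = v$2" and "c = w$1" and "d = w$2"
  have q: "a * a * E + 2 * a * b * F + b * b * G = 1" "c * c * E + 2 * c * d * F + d * d * G = 1"
    "a * c * E + (a * d + b * c) * F + b * d * G = 0"
    using on bil[OF Q, of v v] bil[OF Q, of w w] bil[OF Q, of v w]
    by (simp_all add: E_def F_def G_def a_def b_def c_def d_def algebra_simps)
  \<comment> \<open>The determinant of the orthonormal pair in coordinates. Its square times the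
    adjugate of the Gram matrix is the inverse Gram matrix; \<open>mE\<close>, \<open>mG\<close> and
    \<open>mF\<close> identify its entries with those of v v^T + w w^T.\<close>
  define m where "m = a * d - b * c"
  have "m * m * (E * G - F * F) = (a * a * E + 2 * a * b * F + b * b * G) * (c * c * E + 2 * c * d * F + d * d * G)
      - (a * c * E + (a * d + b * c) * F + b * d * G) * (a * c * E + (a * d + b * c) * F + b * d * G)"
    by (simp add: m_def algebra_simps)
  then have det: "m * m * (E * G - F * F) = 1" unfolding q by simp
  then have m0: "m \<noteq> 0" "E * G - F * F \<noteq> 0" by auto
  have mE: "m * m * E = d * d + b * b"
  proof -
    have "m * m * E = d * d * (a * a * E + 2 * a * b * F + b * b * G) + b * b * (c * c * E + 2 * c * d * F + d * d * G)
       - 2 * b * d * (a * c * E + (a * d + b * c) * F + b * d * G)" by (simp add: m_def algebra_simps)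
    then show ?thesis unfolding q by simp
  qed
  have mG: "m * m * G = a * a + c * c"
  proof -
    have "m * m * G = c * c * (a * a * E + 2 * a * b * F + b * b * G) + a * a * (c * c * E + 2 * c * d * F + d * d * G)
       - 2 * a * c * (a * c * E + (a * d + b * c) * F + b * d * G)" by (simp add: m_def algebra_simps)
    then show ?thesis unfolding q by simp
  qed
  have mF: "m * m * F = - (a * b + c * d)"
  proof -
    have "m * m * F = - (c * d * (a * a * E + 2 * a * b * F + b * b * G)) - a * b * (c * c * E + 2 * c * d * F + d * d * G)
       + (a * d + b * c) * (a * c * E + (a * d + b * c) * F + b * d * G)" by (simp add: m_def algebra_simps)
    then show ?thesis unfolding q by simp
  qed
  have "B v v + B w w = (a * a + c * c) * B ?e ?e + 2 * (a * b + c * d) * B ?e ?f + (d * d + b * b) * B ?f ?f"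
    using bil[OF B, of v v] bil[OF B, of w w] by (simp add: a_def b_def c_def d_def algebra_simps)
  also have "\<dots> = m * m * (B ?e ?e * G - 2 * B ?e ?f * F + B ?f ?f * E)"
  proof -
    have mF': "a * b + c * d = - (m * m * F)" using mF by simp
    show ?thesis unfolding mG[symmetric] mE[symmetric] mF' by (simp add: algebra_simps)
  qed
  also have "\<dots> = (B ?e ?e * G - 2 * B ?e ?f * F + B ?f ?f * E) / (E * G - F\<^sup>2)"
  proof -
    have "m * m = 1 / (E * G - F * F)" using det m0(2) by (simp add: nonzero_eq_divide_eq)
    then show ?thesis by (simp add: power2_eq_square)
  qed
  finally show ?thesis unfolding E_def F_def G_def .
qed

text \<open>\<open>L\<close> is the differential of the unit normal field, that is, minus the shape
  operator, so its trace is \<open>- (2 * H)\<close>. All data are taken at the one point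
  \<open>x\<close>, so that the property passes to smaller chart domains.\<close>

definition cmc_at :: "real \<Rightarrow> (real^2 \<Rightarrow> real^4) \<Rightarrow> (real^2 \<Rightarrow> real^4) \<Rightarrow> real^2 \<Rightarrow> (real^2 \<Rightarrow> real^4) \<Rightarrow> bool" where
  "cmc_at H g N x L \<longleftrightarrow> norm (g x) = 1 \<and> inj (\<lambda>v. dir_deriv g v x) \<and>
     (g has_derivative (\<lambda>v. dir_deriv g v x)) (at x) \<and> (N has_derivative L) (at x) \<and> unit_normal g x (N x) \<and>
     (\<forall>v. dir_deriv g v x \<bullet> g x = 0) \<and> (\<forall>v. L v \<bullet> g x = 0) \<and> (\<forall>v. L v \<bullet> N x = 0) \<and>
     (\<forall>v w. L v \<bullet> dir_deriv g w x = L w \<bullet> dir_deriv g v x) \<and>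
     (\<forall>v w. fund1 g x v v = 1 \<longrightarrow> fund1 g x w w = 1 \<longrightarrow> fund1 g x v w = 0 \<longrightarrow>
        L v \<bullet> dir_deriv g v x + L w \<bullet> dir_deriv g w x = - (2 * H))"

section \<open>Unit normal fields and the mean curvature\<close>

context C2_chart
begin

lemma unit_normal_unique:
  assumes x: "x \<in> U" and n: "unit_normal g x n" and m: "unit_normal g x m"
    and on: "fund1 g x v v = 1" "fund1 g x w w = 1" "fund1 g x v w = 0"
  shows "n = m \<or> n = - m"
proof -
  have "n = (n \<bullet> g x) *\<^sub>R g x + (n \<bullet> m) *\<^sub>R m + (n \<bullet> dir_deriv g v x) *\<^sub>R dir_deriv g v x
      + (n \<bullet> dir_deriv g w x) *\<^sub>R dir_deriv g w x"
    using m on sph[OF x] sph_tangent[OF x]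
    by (intro orthonormal4_expand) (auto simp: unit_normal_def fund1_def dot_square_norm inner_commute)
  then have e: "n = (n \<bullet> m) *\<^sub>R m" using n by (simp add: unit_normal_def)
  have "norm n = \<bar>n \<bullet> m\<bar> * norm m" using arg_cong[OF e, of norm] unfolding norm_scaleR .
  then have "\<bar>n \<bullet> m\<bar> = 1" using n m by (simp add: unit_normal_def)
  then consider "n \<bullet> m = 1" | "n \<bullet> m = -1" by linarith
  then show ?thesis
  proof cases
    case 1
    show ?thesis using e unfolding 1 by simp
  next
    case 2
    show ?thesis using e unfolding 2 by simp
  qed
qed

text \<open>Strict Cauchy-Schwarz: the Gram determinant times \<open>G\<close> is the squared length
  of \<open>G *\<^sub>R g1 - F *\<^sub>R g2\<close>, the image of a nonzero vector under an
  injective differential.\<close>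

lemma gram_pos:
  assumes "x \<in> U"
  shows "(dir_deriv g (axis 1 1) x \<bullet> dir_deriv g (axis 1 1) x) * (dir_deriv g (axis 2 1) x \<bullet> dir_deriv g (axis 2 1) x)
     - (dir_deriv g (axis 1 1) x \<bullet> dir_deriv g (axis 2 1) x)\<^sup>2 > 0"
proof -
  let ?e = "axis 1 1 :: real^2" and ?f = "axis 2 1 :: real^2"
  define g1 g2 where "g1 = dir_deriv g ?e x" and "g2 = dir_deriv g ?f x"
  define E F G where "E = g1 \<bullet> g1" and "F = g1 \<bullet> g2" and "G = g2 \<bullet> g2"
  have g2: "g2 \<noteq> 0"
  proof
    assume "g2 = 0"
    then have "dir_deriv g ?f x = dir_deriv g 0 x"
      using linear_0[OF lin[OF assms]] by (simp add: g2_def)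
    then have "?f = 0" by (rule injD[OF inj[OF assms]])
    then show False by (simp add: axis_eq_0_iff)
  qed
  then have G: "G > 0" by (simp add: G_def)
  have w: "dir_deriv g (G *\<^sub>R ?e - F *\<^sub>R ?f) x = G *\<^sub>R g1 - F *\<^sub>R g2"
    by (simp add: linear_diff[OF lin[OF assms]] linear_scale[OF lin[OF assms]] g1_def g2_def)
  have n0: "G *\<^sub>R g1 - F *\<^sub>R g2 \<noteq> 0"
  proof
    assume "G *\<^sub>R g1 - F *\<^sub>R g2 = 0"
    then have "dir_deriv g (G *\<^sub>R ?e - F *\<^sub>R ?f) x = dir_deriv g 0 x"
      using linear_0[OF lin[OF assms]] w by simp
    then have "G *\<^sub>R ?e - F *\<^sub>R ?f = 0" by (rule injD[OF inj[OF assms]])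
    then have "(G *\<^sub>R ?e - F *\<^sub>R ?f) $ 1 = 0" by simp
    then show False using G by (simp add: axis_def)
  qed
  have "(G *\<^sub>R g1 - F *\<^sub>R g2) \<bullet> (G *\<^sub>R g1 - F *\<^sub>R g2) = G * (E * G - F\<^sup>2)"
    by (simp add: inner_diff_left inner_diff_right E_def F_def G_def inner_commute power2_eq_square algebra_simps)
  then have "0 < G * (E * G - F\<^sup>2)" using n0 by (metis inner_gt_zero_iff)
  then have "0 < E * G - F\<^sup>2" using G by (rule zero_less_mult_pos)
  then show ?thesis by (simp add: E_def F_def G_def g1_def g2_def)
qed

text \<open>The fixed vector \<open>n0\<close> is projected orthogonally to \<open>g x\<close> and
  to the tangent plane, with the inverse Gram matrix, and then normalized. The projection equals
  \<open>n0\<close> at \<open>x0\<close>, so by continuity it does not vanish nearby.\<close>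

lemma normal_field_exists:
  assumes x0: "x0 \<in> U" and n0: "unit_normal g x0 n0"
  obtains r N where "r > 0" "ball x0 r \<subseteq> U" "N x0 = n0"
    "\<And>x. x \<in> ball x0 r \<Longrightarrow> unit_normal g x (N x)" "\<And>x. x \<in> ball x0 r \<Longrightarrow> N differentiable (at x)"
proof -
  let ?e = "axis 1 1 :: real^2" and ?f = "axis 2 1 :: real^2"
  define g1 g2 where "g1 = dir_deriv g ?e" and "g2 = dir_deriv g ?f"
  define E F G where "E = (\<lambda>x. g1 x \<bullet> g1 x)" and "F = (\<lambda>x. g1 x \<bullet> g2 x)" and "G = (\<lambda>x. g2 x \<bullet> g2 x)"
  define dt where "dt = (\<lambda>x. E x * G x - F x * F x)"
  define m where "m = (\<lambda>x. n0 - (n0 \<bullet> g x) *\<^sub>R g x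
     - (((n0 \<bullet> g1 x) * G x - (n0 \<bullet> g2 x) * F x) / dt x) *\<^sub>R g1 x
     - (((n0 \<bullet> g2 x) * E x - (n0 \<bullet> g1 x) * F x) / dt x) *\<^sub>R g2 x)"
  have dt: "dt x > 0" if "x \<in> U" for x
    using gram_pos[OF that] by (simp add: dt_def E_def F_def G_def g1_def g2_def power2_eq_square)
  have dg: "g differentiable (at x)" "g1 differentiable (at x)" "g2 differentiable (at x)" if "x \<in> U" for x
    using deriv[OF that] deriv2[OF that] by (auto simp: g1_def g2_def differentiable_def)
  have dm: "m differentiable (at x)" if "x \<in> U" for x
    unfolding m_def dt_def E_def F_def G_def
    using dg[OF that] dt[OF that] unfolding dt_def E_def F_def G_def
    by (intro differentiable_diff differentiable_scaleR differentiable_inner differentiable_divide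
        differentiable_mult differentiable_const) auto
  have tan: "g1 x \<bullet> g x = 0" "g2 x \<bullet> g x = 0" if "x \<in> U" for x
    using sph_tangent[OF that] by (auto simp: g1_def g2_def)
  have m1: "m x \<bullet> g1 x = 0" "m x \<bullet> g2 x = 0" if "x \<in> U" for x
  proof -
    let ?p = "n0 \<bullet> g1 x" and ?q = "n0 \<bullet> g2 x"
    have tan': "g x \<bullet> g1 x = 0" "g x \<bullet> g2 x = 0" "g2 x \<bullet> g1 x = g1 x \<bullet> g2 x"
      using tan[OF that] by (auto simp: inner_commute)
    have "m x \<bullet> g1 x = ?p - ((?p * G x - ?q * F x) / dt x) * E x - ((?q * E x - ?p * F x) / dt x) * F x"
      using tan' by (simp add: m_def inner_diff_left E_def F_def G_def)
    also have "\<dots> = ?p - ((?p * G x - ?q * F x) * E x + (?q * E x - ?p * F x) * F x) / dt x"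
      by (simp add: add_divide_distrib)
    also have "(?p * G x - ?q * F x) * E x + (?q * E x - ?p * F x) * F x = ?p * dt x"
      by (simp add: dt_def algebra_simps)
    finally show "m x \<bullet> g1 x = 0" using dt[OF that] by simp
    have "m x \<bullet> g2 x = ?q - ((?p * G x - ?q * F x) / dt x) * F x - ((?q * E x - ?p * F x) / dt x) * G x"
      using tan' by (simp add: m_def inner_diff_left E_def F_def G_def)
    also have "\<dots> = ?q - ((?p * G x - ?q * F x) * F x + (?q * E x - ?p * F x) * G x) / dt x"
      by (simp add: add_divide_distrib)
    also have "(?p * G x - ?q * F x) * F x + (?q * E x - ?p * F x) * G x = ?q * dt x"
      by (simp add: dt_def algebra_simps)
    finally show "m x \<bullet> g2 x = 0" using dt[OF that] by simp
  qed
  have my: "m x \<bullet> g x = 0" if "x \<in> U" for x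
    using tan[OF that] sph[OF that] by (simp add: m_def inner_diff_left dot_square_norm)
  have mt: "m x \<bullet> dir_deriv g v x = 0" if "x \<in> U" for x v
    using m1[OF that]
    by (subst vec2_expand[of v])
      (simp add: linear_add[OF lin[OF that]] linear_scale[OF lin[OF that]] inner_add_right g1_def g2_def)
  have m0: "m x0 = n0" using n0 by (simp add: m_def unit_normal_def g1_def g2_def)
  have "continuous (at x0) m" by (rule differentiable_imp_continuous_within[OF dm[OF x0]])
  then obtain r1 where r1: "r1 > 0" "\<And>x. dist x x0 < r1 \<Longrightarrow> dist (m x) (m x0) < 1"
    unfolding continuous_at_eps_delta using zero_less_one by blast
  obtain r2 where r2: "r2 > 0" "ball x0 r2 \<subseteq> U" using x0 openU open_contains_ball by blast
  define r where "r = min r1 r2"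
  have nz: "m x \<noteq> 0" if "x \<in> ball x0 r" for x
  proof
    assume "m x = 0"
    then have "norm n0 < 1" using r1(2)[of x] that m0 by (simp add: r_def dist_commute)
    then show False using n0 by (simp add: unit_normal_def)
  qed
  have inU: "x \<in> U" if "x \<in> ball x0 r" for x using that r2 by (auto simp: r_def)
  show ?thesis
  proof (rule that[of r "\<lambda>x. inverse (norm (m x)) *\<^sub>R m x"])
    show "r > 0" "ball x0 r \<subseteq> U" using r1 r2 inU by (auto simp: r_def)
    show "inverse (norm (m x0)) *\<^sub>R m x0 = n0" using n0 unfolding m0 by (simp add: unit_normal_def)
    fix x assume x: "x \<in> ball x0 r"
    show "unit_normal g x (inverse (norm (m x)) *\<^sub>R m x)"
      using nz[OF x] my[OF inU[OF x]] mt[OF inU[OF x]] by (simp add: unit_normal_def)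
    have "(\<lambda>x. norm (m x)) differentiable (at x)"
      using differentiable_chain_at[OF dm[OF inU[OF x]] differentiable_norm_at[OF nz[OF x]]]
      by (simp only: o_def)
    then show "(\<lambda>x. inverse (norm (m x)) *\<^sub>R m x) differentiable (at x)"
      using nz[OF x] dm[OF inU[OF x]] by (intro differentiable_scaleR differentiable_inverse) auto
  qed
qed

text \<open>Differentiation of the constants \<open>N x \<bullet> g x\<close>,
  \<open>N x \<bullet> N x\<close> and \<open>N x \<bullet> dir_deriv g w x\<close>.\<close>

lemma weingarten_fund2:
  assumes x: "x \<in> B" and B: "open B" "B \<subseteq> U" and N: "\<And>x. x \<in> B \<Longrightarrow> unit_normal g x (N x)"
    and L: "(N has_derivative L) (at x)"
  shows "L v \<bullet> g x = 0" "L v \<bullet> N x = 0" "L v \<bullet> dir_deriv g w x = - fund2 g x (N x) w v"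
proof -
  have xU: "x \<in> U" using x B by auto
  have zero: "(\<lambda>v. N x \<bullet> h' v + L v \<bullet> h x) = (\<lambda>v. 0)"
    if h: "(h has_derivative h') (at x)" and z: "\<And>y. y \<in> B \<Longrightarrow> N y \<bullet> h y = c" for h h' and c :: real
  proof (rule has_derivative_unique)
    show "((\<lambda>x. N x \<bullet> h x) has_derivative (\<lambda>v. N x \<bullet> h' v + L v \<bullet> h x)) (at x)"
      by (intro has_derivative_inner L h)
    show "((\<lambda>x. N x \<bullet> h x) has_derivative (\<lambda>v. 0)) (at x)"
      by (rule has_derivative_transform_within_open[OF has_derivative_const B(1) x, of c]) (simp add: z)
  qed
  have "N x \<bullet> dir_deriv g v x + L v \<bullet> g x = 0"
    using zero[OF deriv[OF xU], of 0] N by (simp add: unit_normal_def fun_eq_iff)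
  then show "L v \<bullet> g x = 0" using N[OF x] by (simp add: unit_normal_def)
  have "N x \<bullet> L v + L v \<bullet> N x = 0"
    using zero[OF L, of 1] N by (simp add: unit_normal_def fun_eq_iff dot_square_norm)
  then show "L v \<bullet> N x = 0" by (simp add: inner_commute)
  have "N x \<bullet> dir_deriv (dir_deriv g w) v x + L v \<bullet> dir_deriv g w x = 0"
    using zero[OF deriv2[OF xU], of w 0] N by (simp add: unit_normal_def fun_eq_iff)
  then show "L v \<bullet> dir_deriv g w x = - fund2 g x (N x) w v" by (simp add: fund2_def inner_commute)
qed

text \<open>Twice the mean curvature with respect to \<open>N\<close>, written with the coordinate
  axes. In contrast to principal directions this expression is visibly continuous in the
  point.\<close>

definition trace2 :: "(real^2 \<Rightarrow> real^4) \<Rightarrow> real^2 \<Rightarrow> real" where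
  "trace2 N x = (fund2 g x (N x) (axis 1 1) (axis 1 1) * fund1 g x (axis 2 1) (axis 2 1)
      - 2 * fund2 g x (N x) (axis 1 1) (axis 2 1) * fund1 g x (axis 1 1) (axis 2 1)
      + fund2 g x (N x) (axis 2 1) (axis 2 1) * fund1 g x (axis 1 1) (axis 1 1))
      / (fund1 g x (axis 1 1) (axis 1 1) * fund1 g x (axis 2 1) (axis 2 1) - (fund1 g x (axis 1 1) (axis 2 1))\<^sup>2)"

lemma trace2:
  assumes x: "x \<in> U" and on: "fund1 g x v v = 1" "fund1 g x w w = 1" "fund1 g x v w = 0"
  shows "fund2 g x (N x) v v + fund2 g x (N x) w w = trace2 N x"
  unfolding trace2_def
proof (rule trace_formula[OF _ _ _ _ on])
  show "linear (\<lambda>v. fund2 g x (N x) v w)" for w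
    unfolding fund2_def
    by (rule linearI) (simp_all add: linear_add[OF lin2'[OF x]] linear_scale[OF lin2'[OF x]] inner_add_left)
  show "linear (\<lambda>v. fund1 g x v w)" for w
    unfolding fund1_def
    by (rule linearI) (simp_all add: linear_add[OF lin[OF x]] linear_scale[OF lin[OF x]] inner_add_left)
qed (simp_all add: fund1_def fund2_def dd_sym[OF x] inner_commute)

text \<open>The hypothesis chooses a normal at each point separately. For a differentiable field
  \<open>N\<close> through the normal chosen at \<open>x0\<close> it only gives
  \<open>trace2 N = \<plusminus> 2 * H\<close>; continuity selects the plus sign near
  \<open>x0\<close>.\<close>

lemma cmc_field_exists:
  assumes cmc: "\<And>x. x \<in> U \<Longrightarrow> \<exists>n \<kappa>1 \<kappa>2. unit_normal g x n \<and> principal_curvatures g x n \<kappa>1 \<kappa>2 \<and> H = (\<kappa>1 + \<kappa>2) / 2"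
    and x0: "x0 \<in> U" and H: "H \<ge> 0"
  obtains r N where "r > 0" "ball x0 r \<subseteq> U" "\<And>x. x \<in> ball x0 r \<Longrightarrow> \<exists>L. cmc_at H g N x L"
proof -
  have tr_pc: "\<kappa>1 + \<kappa>2 = trace2 (\<lambda>_. n) x" if "x \<in> U" "principal_curvatures g x n \<kappa>1 \<kappa>2" for x n \<kappa>1 \<kappa>2
    using that trace2[OF that(1), of _ _ "\<lambda>_. n"] unfolding principal_curvatures_def by metis
  obtain n0 \<kappa>1 \<kappa>2 where n0: "unit_normal g x0 n0" "principal_curvatures g x0 n0 \<kappa>1 \<kappa>2" "H = (\<kappa>1 + \<kappa>2) / 2"
    using cmc[OF x0] by blast
  obtain r1 N where r1: "r1 > 0" "ball x0 r1 \<subseteq> U" "N x0 = n0"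
    and N: "\<And>x. x \<in> ball x0 r1 \<Longrightarrow> unit_normal g x (N x)" "\<And>x. x \<in> ball x0 r1 \<Longrightarrow> N differentiable (at x)"
    using normal_field_exists[OF x0 n0(1)] by metis
  have "trace2 N x0 = trace2 (\<lambda>_. n0) x0" unfolding trace2_def r1(3) ..
  moreover have "trace2 (\<lambda>_. n0) x0 = 2 * H" using tr_pc[OF x0 n0(2)] n0(3) by simp
  ultimately have tr0: "trace2 N x0 = 2 * H" by (rule trans)
  have pm: "trace2 N x = 2 * H \<or> trace2 N x = - (2 * H)" if x: "x \<in> ball x0 r1" for x
  proof -
    have xU: "x \<in> U" using x r1 by auto
    obtain n \<kappa>1 \<kappa>2 where n: "unit_normal g x n" "principal_curvatures g x n \<kappa>1 \<kappa>2" "H = (\<kappa>1 + \<kappa>2) / 2"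
      using cmc[OF xU] by blast
    then obtain v w where on: "fund1 g x v v = 1" "fund1 g x w w = 1" "fund1 g x v w = 0"
      unfolding principal_curvatures_def by blast
    have t: "trace2 (\<lambda>_. n) x = 2 * H" using tr_pc[OF xU n(2)] n(3) by simp
    have "N x = n \<or> N x = - n" by (rule unit_normal_unique[OF xU N(1)[OF x] n(1) on])
    then show ?thesis
      using t trace2[OF xU on, of N] trace2[OF xU on, of "\<lambda>_. n"] by (auto simp: fund2_def)
  qed
  have cont: "continuous_on (ball x0 r1) (trace2 N)"
  proof -
    have cN: "continuous_on (ball x0 r1) N"
      by (intro continuous_at_imp_continuous_on ballI differentiable_imp_continuous_within N(2))
    have c1: "continuous_on (ball x0 r1) (dir_deriv g v)" for v
      using C2 continuous_on_subset[OF _ r1(2)] unfolding C2_on_def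
      by (blast intro: differentiable_imp_continuous_on)
    have c2: "continuous_on (ball x0 r1) (dir_deriv (dir_deriv g v) w)" for v w
      using C2 continuous_on_subset[OF _ r1(2)] unfolding C2_on_def by blast
    have nz: "\<forall>x\<in>ball x0 r1. (dir_deriv g (axis 1 1) x \<bullet> dir_deriv g (axis 1 1) x) * (dir_deriv g (axis 2 1) x \<bullet> dir_deriv g (axis 2 1) x)
     - (dir_deriv g (axis 1 1) x \<bullet> dir_deriv g (axis 2 1) x)\<^sup>2 \<noteq> 0"
    proof
      fix x assume "x \<in> ball x0 r1"
      then have "x \<in> U" using r1(2) by blast
      from gram_pos[OF this] show "(dir_deriv g (axis 1 1) x \<bullet> dir_deriv g (axis 1 1) x) * (dir_deriv g (axis 2 1) x \<bullet> dir_deriv g (axis 2 1) x)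
        - (dir_deriv g (axis 1 1) x \<bullet> dir_deriv g (axis 2 1) x)\<^sup>2 \<noteq> 0"
        by (rule less_imp_neq[THEN not_sym])
    qed
    show ?thesis unfolding trace2_def[abs_def] fund1_def fund2_def
      by (intro continuous_on_divide continuous_on_diff continuous_on_add continuous_on_mult
          continuous_on_inner continuous_on_power continuous_on_const c1 c2 cN nz)
  qed
  obtain r where r: "r > 0" "r \<le> r1" "\<And>x. x \<in> ball x0 r \<Longrightarrow> trace2 N x = 2 * H"
  proof (cases "H = 0")
    case True
    then show ?thesis using that[of r1] r1 pm by auto
  next
    case False
    then have H0: "2 * H > 0" using H by simp
    \<comment> \<open>A deviation below \<open>2 * H\<close> from the value at \<open>x0\<close>
      excludes the value \<open>- (2 * H)\<close>.\<close>
    obtain d where d: "d > 0" "\<And>x. x \<in> ball x0 r1 \<Longrightarrow> dist x x0 < d \<Longrightarrow> dist (trace2 N x) (trace2 N x0) < 2 * H"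
      using cont r1(1) H0 unfolding continuous_on_iff by (meson centre_in_ball)
    show ?thesis
    proof (rule that[of "min d r1"])
      fix x assume "x \<in> ball x0 (min d r1)"
      then have "x \<in> ball x0 r1" "dist (trace2 N x) (2 * H) < 2 * H" using d(2)[of x] tr0 by (auto simp: dist_commute)
      then show "trace2 N x = 2 * H" using pm[of x] H0 by (auto simp: dist_real_def)
    qed (use d r1 in auto)
  qed
  show ?thesis
  proof (rule that[of r N])
    show "r > 0" "ball x0 r \<subseteq> U" using r r1 by auto
    fix x assume x: "x \<in> ball x0 r"
    have x1: "x \<in> ball x0 r1" and xU: "x \<in> U" using x r r1 by auto
    obtain L where L: "(N has_derivative L) (at x)" using N(2)[OF x1] by (auto simp: differentiable_def)
    note W = weingarten_fund2[OF x1 open_ball r1(2) N(1) L]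
    have W3: "L v \<bullet> dir_deriv g w x = - fund2 g x (N x) w v" for v w
      by (rule weingarten_fund2(3)[OF x1 open_ball r1(2) N(1) L])
    have "cmc_at H g N x L" unfolding cmc_at_def
    proof (intro conjI allI impI)
      show "L v \<bullet> dir_deriv g w x = L w \<bullet> dir_deriv g v x" for v w
        using dd_sym[OF xU, of w v] W3[of v w] W3[of w v] by (simp only: fund2_def)
      show "L v \<bullet> dir_deriv g v x + L w \<bullet> dir_deriv g w x = - (2 * H)"
        if "fund1 g x v v = 1" "fund1 g x w w = 1" "fund1 g x v w = 0" for v w
        using trace2[OF xU that, of N] r(3)[OF x] W3[of v v] W3[of w w] by linarith
    qed (use W sph[OF xU] inj[OF xU] deriv[OF xU] L N(1)[OF x1] sph_tangent[OF xU] in auto)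
    then show "\<exists>L. cmc_at H g N x L" by blast
  qed
qed

end

section \<open>Tangency of the rotation field\<close>

lemma local_param_C2_chart:
  assumes "immersed_surface_S3 M f" "local_param M f U \<phi>"
  shows "C2_chart U (f \<circ> \<phi>)"
proof
  have sub: "\<phi> ` U \<subseteq> M" using assms(2) unfolding local_param_def by (meson openin_imp_subset)
  show "norm ((f \<circ> \<phi>) x) = 1" if "x \<in> U" for x
  proof -
    have "\<phi> x \<in> M" using sub that by blast
    then have "f (\<phi> x) \<in> sphere 0 1" using assms(1) unfolding immersed_surface_S3_def by blast
    then show ?thesis by simp
  qed
qed (use assms(2) in \<open>auto simp: local_param_def\<close>)

context C2_chart
begin

text \<open>The tangent plane is contained in the orthogonal complement of \<open>g x\<close> and
  \<open>n\<close>, and both have dimension 2.\<close>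

lemma tangent_onto:
  assumes x: "x \<in> U" and n: "unit_normal g x n" and w: "w \<bullet> g x = 0" "w \<bullet> n = 0"
  shows "\<exists>v. dir_deriv g v x = w"
proof -
  let ?G = "\<lambda>v. dir_deriv g v x"
  define T where "T = {w \<in> UNIV. \<forall>u \<in> span {g x, n}. orthogonal u w}"
  have T: "w \<in> T \<longleftrightarrow> w \<bullet> g x = 0 \<and> w \<bullet> n = 0" for w
  proof
    assume "w \<in> T"
    then show "w \<bullet> g x = 0 \<and> w \<bullet> n = 0"
      using span_base[of _ "{g x, n}"] by (auto simp: T_def orthogonal_def inner_commute)
  next
    assume "w \<bullet> g x = 0 \<and> w \<bullet> n = 0"
    then have "orthogonal w u" if "u \<in> span {g x, n}" for u
      by (intro orthogonal_to_span[OF that]) (auto simp: orthogonal_def)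
    then show "w \<in> T" by (auto simp: T_def orthogonal_commute)
  qed
  have "dim (span {g x, n}) = 2"
  proof -
    have o: "g x \<bullet> n = 0" "g x \<noteq> 0" "n \<noteq> 0" "g x \<noteq> n"
      using n sph[OF x] by (auto simp: unit_normal_def inner_commute dot_square_norm)
    then have "independent {g x, n}"
      by (intro pairwise_orthogonal_independent) (auto simp: pairwise_def orthogonal_def inner_commute)
    then show ?thesis using o(4) by (simp add: dim_eq_card_independent)
  qed
  moreover have "dim T + dim (span {g x, n}) = dim (UNIV :: (real^4) set)"
    unfolding T_def by (rule dim_subspace_orthogonal_to_vectors) auto
  ultimately have dT: "dim T = 2" by simp
  have "dim (range ?G) = dim (UNIV :: (real^2) set)"
    by (rule dim_image_eq[OF lin[OF x]]) (use inj[OF x] in simp)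
  then have dR: "dim (range ?G) = 2" by simp
  have "subspace T" by (auto simp: subspace_def T inner_add_left)
  moreover have "range ?G \<subseteq> T" using sph_tangent[OF x] n by (auto simp: T unit_normal_def inner_commute)
  ultimately have "range ?G = T"
    using dT dR by (intro subspace_dim_equal linear_subspace_image[OF lin[OF x] subspace_UNIV]) auto
  then show ?thesis using w T by (metis imageE)
qed

end

text \<open>The velocity of the rotations at angle 0. It is \<open>K\<close> of
  \<open>frame4\<close>, expressed by \<open>a\<close> and \<open>b\<close> alone.\<close>

definition rot_field :: "real^4 \<Rightarrow> real^4 \<Rightarrow> real^4 \<Rightarrow> real^4" where
  "rot_field a b y = (y \<bullet> a) *\<^sub>R b - (y \<bullet> b) *\<^sub>R a"

lemma rot_alt: "rot a b \<theta> y = y + (cos \<theta> - 1) *\<^sub>R ((y \<bullet> a) *\<^sub>R a + (y \<bullet> b) *\<^sub>R b) + sin \<theta> *\<^sub>R rot_field a b y"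
  by (simp add: rot_def rot_field_def algebra_simps)

text \<open>By second countability countably many charts cover \<open>M\<close>, and the cone over
  each is the differentiable image of a 3-dimensional domain in R^4. The radial parameter is added
  so that Lebesgue measure of R^4 can be used for a subset of the sphere.\<close>

lemma cone_negligible:
  assumes surf: "immersed_surface_S3 M f"
  shows "negligible {\<rho> *\<^sub>R y | \<rho> y. y \<in> f ` M}"
proof -
  define \<F> where "\<F> = {\<phi> ` U | U \<phi>. local_param M f U \<phi>}"
  have "openin (top_of_set M) W" if "W \<in> \<F>" for W
    using that by (auto simp: \<F>_def local_param_def)
  then obtain \<F>' where F': "\<F>' \<subseteq> \<F>" "countable \<F>'" "\<Union>\<F>' = \<Union>\<F>"
    using Lindelof_openin by metis
  have cov: "M \<subseteq> \<Union>\<F>'"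
    unfolding F'(3) \<F>_def using surf unfolding immersed_surface_S3_def by blast
  have neg: "negligible {\<rho> *\<^sub>R y | \<rho> y. y \<in> f ` W}" if W: "W \<in> \<F>'" for W
  proof -
    obtain U \<phi> where lp: "local_param M f U \<phi>" and WU: "W = \<phi> ` U" using W F'(1) by (auto simp: \<F>_def)
    interpret C2_chart U "f \<circ> \<phi>" by (rule local_param_C2_chart[OF surf lp])
    define h where "h = (\<lambda>p :: (real^2) \<times> real. snd p *\<^sub>R (f \<circ> \<phi>) (fst p))"
    have "h differentiable (at p)" if "fst p \<in> U" for p
    proof -
      have "((\<lambda>p. (f \<circ> \<phi>) (fst p)) has_derivative (\<lambda>q. dir_deriv (f \<circ> \<phi>) (fst q) (fst p))) (at p)"
        by (rule has_derivative_compose[OF has_derivative_fst[OF has_derivative_ident] deriv[OF that]])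
      then show ?thesis unfolding h_def
        by (intro differentiable_scaleR) (auto simp: differentiable_def intro!: derivative_eq_intros exI)
    qed
    then have "h differentiable_on (U \<times> UNIV)"
      by (auto intro: differentiable_at_imp_differentiable_on)
    then have "negligible (h ` (U \<times> UNIV))"
      by (rule negligible_differentiable_image_lowdim[rotated]) simp
    moreover have "{\<rho> *\<^sub>R y | \<rho> y. y \<in> f ` W} \<subseteq> h ` (U \<times> UNIV)"
      by (force simp: WU h_def)
    ultimately show ?thesis by (rule negligible_subset)
  qed
  have "negligible (\<Union>W\<in>\<F>'. {\<rho> *\<^sub>R y | \<rho> y. y \<in> f ` W})"
    using F'(2) neg by (intro negligible_countable_Union) auto
  moreover have "{\<rho> *\<^sub>R y | \<rho> y. y \<in> f ` M} \<subseteq> (\<Union>W\<in>\<F>'. {\<rho> *\<^sub>R y | \<rho> y. y \<in> f ` W})"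
  proof
    fix u assume "u \<in> {\<rho> *\<^sub>R y | \<rho> y. y \<in> f ` M}"
    then obtain \<rho> m where u: "u = \<rho> *\<^sub>R f m" "m \<in> M" by auto
    then obtain W where "W \<in> \<F>'" "m \<in> W" using cov by (meson UnionE subsetD)
    then show "u \<in> (\<Union>W\<in>\<F>'. {\<rho> *\<^sub>R y | \<rho> y. y \<in> f ` W})" using u(1) by blast
  qed
  ultimately show ?thesis by (rule negligible_subset)
qed

text \<open>If the rotation field had a normal component, then it, the position vector and the
  tangent plane would span R^4. Rotating and scaling the chart would then be a map from a
  4-dimensional domain with surjective derivative at one point, and its image would have interior
  points although it lies in the negligible cone.\<close>

lemma rotation_tangent:
  assumes surf: "immersed_surface_S3 M f" and lp: "local_param M f U \<phi>" and x: "x \<in> U"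
    and n: "unit_normal (f \<circ> \<phi>) x n"
    and rot: "\<And>\<theta>. rot a b \<theta> ` (f ` M) \<subseteq> f ` M"
  shows "n \<bullet> rot_field a b ((f \<circ> \<phi>) x) = 0"
proof (rule ccontr)
  assume nK: "n \<bullet> rot_field a b ((f \<circ> \<phi>) x) \<noteq> 0"
  interpret C2_chart U "f \<circ> \<phi>" by (rule local_param_C2_chart[OF surf lp])
  let ?g = "f \<circ> \<phi>" and ?K = "rot_field a b"
  let ?y = "?g x" and ?G = "\<lambda>v. dir_deriv (f \<circ> \<phi>) v x"
  define P where "P = (\<lambda>y :: real^4. (y \<bullet> a) *\<^sub>R a + (y \<bullet> b) *\<^sub>R b)"
  have blP: "bounded_linear P"
    unfolding P_def by (intro bounded_linear_intros)
  have blK: "bounded_linear ?K"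
    unfolding rot_field_def[abs_def] by (intro bounded_linear_intros)
  define \<Psi> where "\<Psi> = (\<lambda>p :: (real^2) \<times> real \<times> real. snd (snd p) *\<^sub>R
    (?g (fst p) + (cos (fst (snd p)) - 1) *\<^sub>R P (?g (fst p)) + sin (fst (snd p)) *\<^sub>R ?K (?g (fst p))))"
  define S where "S = U \<times> (UNIV :: (real \<times> real) set)"
  have oS: "open S" unfolding S_def using openU by (intro open_Times) auto
  define \<Psi>' where "\<Psi>' = (\<lambda>q :: (real^2) \<times> real \<times> real. ?G (fst q) + fst (snd q) *\<^sub>R ?K ?y + snd (snd q) *\<^sub>R ?y)"
  have gd: "((\<lambda>p :: (real^2) \<times> real \<times> real. ?g (fst p)) has_derivative (\<lambda>q. dir_deriv ?g (fst q) (fst p))) (at p)"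
    if "fst p \<in> U" for p
    by (rule has_derivative_compose[OF has_derivative_fst[OF has_derivative_ident] deriv[OF that]])
  have der: "(\<Psi> has_derivative \<Psi>') (at (x, 0, 1))"
    unfolding \<Psi>_def
    by (rule has_derivative_eq_rhs, (rule derivative_intros gd bounded_linear.has_derivative[OF blP] bounded_linear.has_derivative[OF blK] | simp add: x)+)
      (simp add: \<Psi>'_def fun_eq_iff algebra_simps)
  have contg: "continuous_on S (\<lambda>p. ?g (fst p))"
    by (intro continuous_at_imp_continuous_on ballI has_derivative_continuous[OF gd]) (auto simp: S_def)
  have cont: "continuous_on S \<Psi>"
    unfolding \<Psi>_def
    by (intro continuous_intros contg bounded_linear.continuous_on[OF blP] bounded_linear.continuous_on[OF blK])
  have lin': "linear \<Psi>'" using der has_derivative_linear by blast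
  have "\<exists>q. \<Psi>' q = w" for w
  proof -
    \<comment> \<open>The multiple \<open>s\<close> of the rotation field removes the normal
      component of \<open>w\<close>, the multiple \<open>r\<close> of the position removes the
      radial one, and \<open>w2\<close> is tangent.\<close>
    define s where "s = (w \<bullet> n) / (n \<bullet> ?K ?y)"
    define w1 where "w1 = w - s *\<^sub>R ?K ?y"
    define r where "r = w1 \<bullet> ?y"
    define w2 where "w2 = w1 - r *\<^sub>R ?y"
    have yn: "?y \<bullet> n = 0" using n by (simp add: unit_normal_def inner_commute)
    have yy: "?y \<bullet> ?y = 1" using sph[OF x] by (simp add: dot_square_norm)
    have "s * (n \<bullet> ?K ?y) = w \<bullet> n" using nK by (simp add: s_def)
    then have "w1 \<bullet> n = 0"
      unfolding w1_def inner_diff_left inner_scaleR_left inner_commute[of "?K ?y" n] by simp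
    then have "w2 \<bullet> n = 0" "w2 \<bullet> ?y = 0" using yn yy by (auto simp: w2_def r_def inner_diff_left)
    then obtain v where v: "?G v = w2" using tangent_onto[OF x n] by blast
    have "\<Psi>' (v, s, r) = w" unfolding \<Psi>'_def by (simp add: v[unfolded o_def] v w2_def w1_def)
    then show "\<exists>q. \<Psi>' q = w" by (rule exI)
  qed
  then have surj: "surj \<Psi>'" unfolding surj_def by metis
  then obtain g' where g': "linear g'" "\<Psi>' \<circ> g' = id"
    using linear_surjective_right_inverse[OF lin'] by blast
  have "\<Psi> (x, 0, 1) \<in> interior (\<Psi> ` S)"
    by (rule sussmann_open_mapping[OF oS cont _ der _ g'(2)])
      (use x oS g'(1) in \<open>auto simp: S_def interior_open linear_conv_bounded_linear\<close>)
  moreover have "\<Psi> ` S \<subseteq> {\<rho> *\<^sub>R y | \<rho> y. y \<in> f ` M}"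
  proof
    fix w assume "w \<in> \<Psi> ` S"
    then obtain z \<theta> \<rho> where z: "z \<in> U" "w = \<Psi> (z, \<theta>, \<rho>)" by (auto simp: S_def)
    have "\<phi> z \<in> M" using lp z(1) unfolding local_param_def by (meson imageI openin_imp_subset subsetD)
    then have "rot a b \<theta> (?g z) \<in> f ` M" using rot[of \<theta>] by auto
    moreover have "w = \<rho> *\<^sub>R rot a b \<theta> (?g z)" unfolding z(2) \<Psi>_def rot_alt P_def by simp
    ultimately show "w \<in> {\<rho> *\<^sub>R y | \<rho> y. y \<in> f ` M}" by blast
  qed
  ultimately have "interior (\<Psi> ` S) \<noteq> {}" "negligible (interior (\<Psi> ` S))"
    using cone_negligible[OF surf] interior_subset negligible_subset by (blast, meson order_trans)
  then show False using open_not_negligible[OF open_interior] by blast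
qed

section \<open>The profile equations on a surface\<close>

context frame4
begin

lemma cmc_normal_pt:
  assumes "cmc_at H g N x L" "N x \<bullet> K (g x) = 0" "axdist (g x) > 0"
  shows "normal_pt a b c d (g x) (N x)"
  using assms by unfold_locales (auto simp: cmc_at_def unit_normal_def dot_square_norm inner_commute)

text \<open>The rate at which the profile parameter advances when the chart point moves with
  velocity \<open>w\<close>.\<close>

definition speed :: "(real^2 \<Rightarrow> real^4) \<Rightarrow> (real^2 \<Rightarrow> real^4) \<Rightarrow> real^2 \<Rightarrow> real^2 \<Rightarrow> real" where
  "speed g N w x = (dir_deriv g w x \<bullet> V (g x) (N x)) / axdist (g x)"

text \<open>Differentiating the tangency relation \<open>N x \<bullet> K (g x) = 0\<close> supplies
  the hypothesis \<open>LK\<close> of \<open>weingarten\<close>.\<close>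

lemma moving_frame:
  assumes B: "open B" "x \<in> B"
    and cmc: "cmc_at H g N x L" and NK: "\<And>x. x \<in> B \<Longrightarrow> N x \<bullet> K (g x) = 0" and ax: "axdist (g x) > 0"
  shows "\<exists>w. dir_deriv g w x = V (g x) (N x)"
    and "\<exists>\<alpha>. dir_deriv g w x = \<alpha> *\<^sub>R K (g x) + speed g N w x *\<^sub>R V (g x) (N x) \<and>
      L w = (normal_pt.k a b (g x) (N x) * \<alpha>) *\<^sub>R K (g x)
        - (speed g N w x * (2 * H + normal_pt.k a b (g x) (N x))) *\<^sub>R V (g x) (N x)"
proof -
  interpret normal_pt a b c d "g x" "N x" by (rule cmc_normal_pt[OF cmc NK[OF B(2)] ax])
  have g: "(g has_derivative (\<lambda>v. dir_deriv g v x)) (at x)" and L: "(N has_derivative L) (at x)"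
    using cmc by (auto simp: cmc_at_def)
  have LK: "L v \<bullet> K (g x) = - (N x \<bullet> K (dir_deriv g v x))" for v
  proof -
    have "((\<lambda>x. N x \<bullet> K (g x)) has_derivative (\<lambda>v. N x \<bullet> K (dir_deriv g v x) + L v \<bullet> K (g x))) (at x)"
      using linear_K by (intro has_derivative_inner L bounded_linear.has_derivative[OF _ g])
        (simp add: linear_conv_bounded_linear)
    moreover have "((\<lambda>x. N x \<bullet> K (g x)) has_derivative (\<lambda>v. 0)) (at x)"
      by (rule has_derivative_transform_within_open[OF has_derivative_const B, of 0]) (simp add: NK)
    ultimately have "(\<lambda>v. N x \<bullet> K (dir_deriv g v x) + L v \<bullet> K (g x)) = (\<lambda>v. 0)"
      by (rule has_derivative_unique)
    then show ?thesis by (metis add.commute eq_neg_iff_add_eq_0)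
  qed
  note W = weingarten[of "\<lambda>v. dir_deriv g v x" L H]
  have prem: "linear (\<lambda>v. dir_deriv g v x)" "inj (\<lambda>v. dir_deriv g v x)" "linear L"
    "\<And>v. dir_deriv g v x \<bullet> g x = 0" "\<And>v. dir_deriv g v x \<bullet> N x = 0"
    "\<And>v. L v \<bullet> g x = 0" "\<And>v. L v \<bullet> N x = 0"
    "\<And>v w. L v \<bullet> dir_deriv g w x = L w \<bullet> dir_deriv g v x"
    "\<And>v w. dir_deriv g v x \<bullet> dir_deriv g v x = 1 \<Longrightarrow> dir_deriv g w x \<bullet> dir_deriv g w x = 1 \<Longrightarrow>
      dir_deriv g v x \<bullet> dir_deriv g w x = 0 \<Longrightarrow> L v \<bullet> dir_deriv g v x + L w \<bullet> dir_deriv g w x = - (2 * H)"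
    using cmc has_derivative_linear[OF g] has_derivative_linear[OF L]
    by (auto simp: cmc_at_def unit_normal_def fund1_def inner_commute)
  show "\<exists>w. dir_deriv g w x = V (g x) (N x)" by (rule W(1)[OF prem(1-8) LK prem(9)])
  obtain \<alpha> \<beta> where ab: "dir_deriv g w x = \<alpha> *\<^sub>R K (g x) + \<beta> *\<^sub>R V (g x) (N x)"
    "L w = (k * \<alpha>) *\<^sub>R K (g x) - (\<beta> * (2 * H + k)) *\<^sub>R V (g x) (N x)"
    using W(2)[OF prem(1-8) LK prem(9), of w] by blast
  have "dir_deriv g w x \<bullet> V (g x) (N x) = \<beta> * axdist (g x)"
    unfolding ab(1) inner_add_left inner_scaleR_left V_norm inner_commute[of "K (g x)"] V_orth(3) by simp
  then have "speed g N w x = \<beta>" using ax by (simp add: speed_def)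
  then show "\<exists>\<alpha>. dir_deriv g w x = \<alpha> *\<^sub>R K (g x) + speed g N w x *\<^sub>R V (g x) (N x) \<and>
      L w = (k * \<alpha>) *\<^sub>R K (g x) - (speed g N w x * (2 * H + k)) *\<^sub>R V (g x) (N x)"
    using ab by blast
qed

lemma speed_V:
  assumes "normal_pt a b c d (g x) (N x)" "dir_deriv g w x = V (g x) (N x)"
  shows "speed g N w x = 1"
  using normal_pt.V_norm[OF assms(1)] normal_pt.ax[OF assms(1)] by (simp add: speed_def assms(2))

text \<open>Straight lines of the chart replace integral curves of \<open>V\<close>: by
  \<open>state_derivatives\<close> only the component of the velocity along \<open>V\<close> enters,
  as the factor \<open>speed\<close>.\<close>

lemma curve_flow:
  fixes x0 w :: "real^2"
  defines "\<gamma> \<equiv> \<lambda>s. x0 + s *\<^sub>R w"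
  assumes B: "open B" "\<gamma> s \<in> B"
    and cmc: "cmc_at H g N (\<gamma> s) L" and NK: "\<And>x. x \<in> B \<Longrightarrow> N x \<bullet> K (g x) = 0" and ax: "axdist (g (\<gamma> s)) > 0"
    and C: "C = H * axdist (g (\<gamma> s)) + mm (g (\<gamma> s)) (N (\<gamma> s))"
  shows "profile_flow H C (speed g N w (\<gamma> s)) (\<lambda>s. axdist (g (\<gamma> s))) (\<lambda>s. del (g (\<gamma> s)) (N (\<gamma> s)))
      (\<lambda>s. zc (g (\<gamma> s))) (\<lambda>s. zc (V (g (\<gamma> s)) (N (\<gamma> s)))) (at s) s"
    and "((\<lambda>s. H * axdist (g (\<gamma> s)) + mm (g (\<gamma> s)) (N (\<gamma> s))) has_real_derivative 0) (at s)"
proof -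
  let ?x = "\<gamma> s"
  interpret normal_pt a b c d "g ?x" "N ?x" by (rule cmc_normal_pt[OF cmc NK[OF B(2)] ax])
  define y' n' where "y' = dir_deriv g w ?x" and "n' = L w"
  obtain \<alpha> where \<alpha>: "y' = \<alpha> *\<^sub>R K (g ?x) + speed g N w ?x *\<^sub>R V (g ?x) (N ?x)"
    "n' = (k * \<alpha>) *\<^sub>R K (g ?x) - (speed g N w ?x * (2 * H + k)) *\<^sub>R V (g ?x) (N ?x)"
    using moving_frame(2)[OF B cmc NK ax, of w] unfolding y'_def n'_def by blast
  note SD = state_derivatives[OF \<alpha> C]
  have g: "(g has_derivative (\<lambda>v. dir_deriv g v ?x)) (at ?x)" and L: "(N has_derivative L) (at ?x)"
    using cmc by (auto simp: cmc_at_def)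
  have \<gamma>d: "(\<gamma> has_derivative (\<lambda>h. h *\<^sub>R w)) (at s)"
    unfolding \<gamma>_def by (auto intro!: derivative_eq_intros)
  have yd: "((\<lambda>s. g (\<gamma> s) \<bullet> e) has_real_derivative y' \<bullet> e) (at s)" for e
  proof -
    have "((\<lambda>s. g (\<gamma> s) \<bullet> e) has_derivative (\<lambda>h. dir_deriv g (h *\<^sub>R w) ?x \<bullet> e)) (at s)"
      by (intro has_derivative_inner_left has_derivative_compose[OF \<gamma>d g])
    then show ?thesis
      by (simp add: has_field_derivative_def y'_def linear_scale[OF has_derivative_linear[OF g]] mult_commute_abs)
  qed
  have nd: "((\<lambda>s. N (\<gamma> s) \<bullet> e) has_real_derivative n' \<bullet> e) (at s)" for e
  proof -
    have "((\<lambda>s. N (\<gamma> s) \<bullet> e) has_derivative (\<lambda>h. L (h *\<^sub>R w) \<bullet> e)) (at s)"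
      by (intro has_derivative_inner_left has_derivative_compose[OF \<gamma>d L])
    then show ?thesis
      by (simp add: has_field_derivative_def n'_def linear_scale[OF has_derivative_linear[OF L]] mult_commute_abs)
  qed
  have Xd: "((\<lambda>s. axdist (g (\<gamma> s))) has_real_derivative speed g N w ?x * (2 * axdist (g ?x) * del (g ?x) (N ?x))) (at s)"
    unfolding SD(1)[symmetric] unfolding axdist_def
    by (auto intro!: derivative_eq_intros yd simp: power2_eq_square)
  have Md: "((\<lambda>s. mm (g (\<gamma> s)) (N (\<gamma> s))) has_real_derivative
      - (H * (speed g N w ?x * (2 * axdist (g ?x) * del (g ?x) (N ?x))))) (at s)"
    unfolding SD(2)[symmetric] unfolding mm_def
    by (auto intro!: derivative_eq_intros yd nd)
  have Dd: "((\<lambda>s. del (g (\<gamma> s)) (N (\<gamma> s))) has_real_derivative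
      speed g N w ?x * (C\<^sup>2 / axdist (g ?x) - (1 + H\<^sup>2) * axdist (g ?x))) (at s)"
    unfolding SD(3)[symmetric] unfolding del_def
    by (auto intro!: derivative_eq_intros yd nd)
  have Zd: "((\<lambda>s. zc (g (\<gamma> s))) has_vector_derivative of_real (speed g N w ?x) * zc (V (g ?x) (N ?x))) (at s)"
    unfolding SD(4)[symmetric] unfolding zc_def has_vector_derivative_complex_iff
    by (simp add: yd)
  have Vd: "((\<lambda>s. zc (V (g (\<gamma> s)) (N (\<gamma> s)))) has_vector_derivative of_real (speed g N w ?x) *
      (2 * of_real (del (g ?x) (N ?x)) * zc (V (g ?x) (N ?x))
          + 2 * \<i> * of_real C * (zc (V (g ?x) (N ?x)) - of_real (del (g ?x) (N ?x)) * zc (g ?x)))) (at s)"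
    unfolding SD(5)[symmetric] unfolding zc_def V_coords(3,4) has_vector_derivative_complex_iff complex.sel
    by (intro conjI; rule DERIV_cong, (rule DERIV_diff DERIV_mult Xd Md yd nd)+) (simp_all add: algebra_simps)
  show "profile_flow H C (speed g N w ?x) (\<lambda>s. axdist (g (\<gamma> s))) (\<lambda>s. del (g (\<gamma> s)) (N (\<gamma> s)))
      (\<lambda>s. zc (g (\<gamma> s))) (\<lambda>s. zc (V (g (\<gamma> s)) (N (\<gamma> s)))) (at s) s"
    unfolding profile_flow_def using Xd Dd Zd Vd by blast
  have "((\<lambda>s. H * axdist (g (\<gamma> s)) + mm (g (\<gamma> s)) (N (\<gamma> s))) has_real_derivative
     H * (speed g N w ?x * (2 * axdist (g ?x) * del (g ?x) (N ?x))) +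
     - (H * (speed g N w ?x * (2 * axdist (g ?x) * del (g ?x) (N ?x))))) (at s)"
    by (intro DERIV_add DERIV_cmult Xd Md)
  then show "((\<lambda>s. H * axdist (g (\<gamma> s)) + mm (g (\<gamma> s)) (N (\<gamma> s))) has_real_derivative 0) (at s)"
    by simp
qed

end

section \<open>Comparison of surface and model along segments\<close>

lemma profile_flow_scale:
  assumes "profile_flow H C \<beta> X D Z V F s"
  shows "profile_flow H C \<beta> X D (\<lambda>s. u * Z s) (\<lambda>s. u * V s) F s"
proof -
  have "((\<lambda>s. u * Z s) has_vector_derivative u * (of_real \<beta> * V s)) F"
    using assms unfolding profile_flow_def by (intro has_vector_derivative_mult_right) auto
  moreover have "((\<lambda>s. u * V s) has_vector_derivative
      u * (of_real \<beta> * (2 * of_real (D s) * V s + 2 * \<i> * of_real C * (V s - of_real (D s) * Z s)))) F"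
    using assms unfolding profile_flow_def by (intro has_vector_derivative_mult_right) auto
  ultimately show ?thesis using assms unfolding profile_flow_def by (simp add: algebra_simps)
qed

lemma profile_flow_mono:
  assumes "profile_flow H C \<beta> X D Z V (at s) s"
  shows "profile_flow H C \<beta> X D Z V (at s within S) s"
  using assms unfolding profile_flow_def
  by (auto intro: has_field_derivative_at_within has_vector_derivative_at_within)

locale profile_match = fr: frame4 a b c d + mo: model_profile H C C1 C2
  for a b c d :: "real^4" and H C C1 C2 :: real +
  fixes u :: complex
begin

text \<open>The factor \<open>u\<close> is a rotation of the (c, d)-plane when its modulus is 1. The
  last clause ensures that the system on the surface has the same constant as the model.\<close>

definition match_pt :: "real^4 \<Rightarrow> real^4 \<Rightarrow> real \<Rightarrow> bool" where
  "match_pt y n t \<longleftrightarrow> fr.axdist y = mo.X t \<and> fr.del y n = mo.Del t \<and> fr.zc y = u * mo.Z t \<and>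
     fr.zc (fr.V y n) = u * mo.V t \<and> H * fr.axdist y + fr.mm y n = C"

text \<open>Both the state along the segment and the model composed with \<tau> solve the system
  with the same factor \<beta>, and they agree at 0; \<open>profile_flow_unique\<close>
  applies.\<close>

lemma segment_match:
  fixes x0 w :: "real^2"
  defines "\<gamma> \<equiv> \<lambda>s. x0 + s *\<^sub>R w"
  assumes B: "open B" "\<And>s. s \<in> {0..1} \<Longrightarrow> \<gamma> s \<in> B"
    and cmc: "\<And>x. x \<in> B \<Longrightarrow> \<exists>L. cmc_at H g N x L"
    and NK: "\<And>x. x \<in> B \<Longrightarrow> N x \<bullet> fr.K (g x) = 0"
    and cont: "continuous_on B (dir_deriv g w)"
    and ax: "\<And>s. s \<in> {0..1} \<Longrightarrow> fr.axdist (g (\<gamma> s)) > 0"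
    and m0: "match_pt (g x0) (N x0) t0"
  obtains \<tau> where "\<tau> 0 = t0" "continuous_on {0..1} \<tau>"
    "\<And>s. s \<in> {0..1} \<Longrightarrow> (\<tau> has_real_derivative fr.speed g N w (\<gamma> s)) (at s within {0..1})"
    "\<And>s. s \<in> {0..1} \<Longrightarrow> match_pt (g (\<gamma> s)) (N (\<gamma> s)) (\<tau> s)"
proof -
  define \<beta> where "\<beta> = (\<lambda>s. fr.speed g N w (\<gamma> s))"
  have cg: "continuous_on {0..1} \<gamma>" unfolding \<gamma>_def by (intro continuous_intros)
  have img: "\<gamma> ` {0..1} \<subseteq> B" using B(2) by auto
  have cgB: "continuous_on B g" "continuous_on B N"
    using cmc unfolding cmc_at_def by (meson continuous_at_imp_continuous_on has_derivative_continuous)+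
  note comp = continuous_on_compose2[OF _ cg img]
  have c1: "continuous_on {0..1} (\<lambda>s. g (\<gamma> s))" and c2: "continuous_on {0..1} (\<lambda>s. N (\<gamma> s))"
    and c3: "continuous_on {0..1} (\<lambda>s. dir_deriv g w (\<gamma> s))"
    using comp[OF cgB(1)] comp[OF cgB(2)] comp[OF cont] by auto
  have "\<forall>s\<in>{0..1}. fr.axdist (g (\<gamma> s)) \<noteq> 0" using ax by force
  then have c\<beta>: "continuous_on {0..1} \<beta>"
    unfolding \<beta>_def fr.speed_def fr.V_def fr.axdist_def fr.mm_def fr.del_def
    by (intro continuous_intros c1 c2 c3)
  \<comment> \<open>The model time is the integral of the speed, so that the model read at this time
    obeys the system with factor \<beta>.\<close>
  define \<tau> where "\<tau> = (\<lambda>s. t0 + integral {0..s} \<beta>)"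
  have d\<tau>: "(\<tau> has_real_derivative \<beta> s) (at s within {0..1})" if "s \<in> {0..1}" for s
    unfolding \<tau>_def using integral_has_real_derivative[OF c\<beta> that]
    by (auto intro!: derivative_eq_intros)
  have \<tau>0: "\<tau> 0 = t0" by (simp add: \<tau>_def)
  have \<gamma>0: "\<gamma> 0 = x0" by (simp add: \<gamma>_def)
  note m0' = m0[folded \<gamma>0, unfolded match_pt_def]
  have const: "H * fr.axdist (g (\<gamma> s)) + fr.mm (g (\<gamma> s)) (N (\<gamma> s)) = C" if s: "s \<in> {0..1}" for s
  proof -
    have "((\<lambda>s. H * fr.axdist (g (\<gamma> s)) + fr.mm (g (\<gamma> s)) (N (\<gamma> s))) has_real_derivative 0) (at s within {0..1})"
      if s: "s \<in> {0..1}" for s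
    proof -
      obtain L where L: "cmc_at H g N (\<gamma> s) L" using cmc B(2) s by blast
      show ?thesis unfolding \<gamma>_def
        by (rule has_field_derivative_at_within[OF fr.curve_flow(2)[OF B(1) B(2)[OF s, unfolded \<gamma>_def]
                L[unfolded \<gamma>_def] NK ax[OF s, unfolded \<gamma>_def] refl]])
    qed
    from has_field_derivative_zero_constant[OF _ this] obtain c0
      where "\<And>s. s \<in> {0..1} \<Longrightarrow> H * fr.axdist (g (\<gamma> s)) + fr.mm (g (\<gamma> s)) (N (\<gamma> s)) = c0" by auto
    moreover have "H * fr.axdist (g (\<gamma> 0)) + fr.mm (g (\<gamma> 0)) (N (\<gamma> 0)) = C" using m0' by blast
    ultimately show ?thesis using s by (metis atLeastAtMost_iff order_refl zero_le_one)
  qed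
  have match: "match_pt (g (\<gamma> s)) (N (\<gamma> s)) (\<tau> s)" if s: "s \<in> {0..1}" for s
  proof -
    have "fr.axdist (g (\<gamma> s)) = (mo.X \<circ> \<tau>) s \<and> fr.del (g (\<gamma> s)) (N (\<gamma> s)) = (mo.Del \<circ> \<tau>) s \<and>
       fr.zc (g (\<gamma> s)) = u * (mo.Z \<circ> \<tau>) s \<and> fr.zc (fr.V (g (\<gamma> s)) (N (\<gamma> s))) = u * (mo.V \<circ> \<tau>) s"
    proof (rule profile_flow_unique[OF _ _ _ c\<beta> _ _ _ _ s, where H = H and C = C])
      fix s :: real assume s: "s \<in> {0..1}"
      obtain L where L: "cmc_at H g N (\<gamma> s) L" using cmc B(2) s by blast
      show "profile_flow H C (\<beta> s) (\<lambda>s. fr.axdist (g (\<gamma> s))) (\<lambda>s. fr.del (g (\<gamma> s)) (N (\<gamma> s)))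
          (\<lambda>s. fr.zc (g (\<gamma> s))) (\<lambda>s. fr.zc (fr.V (g (\<gamma> s)) (N (\<gamma> s)))) (at s within {0..1}) s"
        unfolding \<beta>_def \<gamma>_def
        by (rule profile_flow_mono[OF fr.curve_flow(1)[OF B(1) B(2)[OF s, unfolded \<gamma>_def]
                L[unfolded \<gamma>_def] NK ax[OF s, unfolded \<gamma>_def] const[OF s, unfolded \<gamma>_def, symmetric]]])
      show "profile_flow H C (\<beta> s) (mo.X \<circ> \<tau>) (mo.Del \<circ> \<tau>) (\<lambda>s. u * (mo.Z \<circ> \<tau>) s) (\<lambda>s. u * (mo.V \<circ> \<tau>) s)
          (at s within {0..1}) s"
        by (rule profile_flow_scale[OF mo.flow_compose[OF d\<tau>[OF s]]])
      show "0 < fr.axdist (g (\<gamma> s)) \<and> 0 < (mo.X \<circ> \<tau>) s" using ax[OF s] mo.X_pos by simp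
    qed (use m0' \<tau>0 in auto)
    then show ?thesis using const[OF s] by (simp add: match_pt_def)
  qed
  have "continuous_on {0..1} \<tau>" using d\<tau> DERIV_continuous_on by blast
  then show ?thesis using that[OF \<tau>0 _ d\<tau>[unfolded \<beta>_def] match] by blast
qed

end

section \<open>Adapted charts\<close>

lemma inj_derivative_lower_bound:
  fixes g :: "'a::euclidean_space \<Rightarrow> 'b::euclidean_space"
  assumes g: "(g has_derivative G) (at x)" and inj: "inj G"
  obtains k r where "k > 0" "r > 0" "\<And>y. norm (y - x) < r \<Longrightarrow> k * norm (y - x) \<le> norm (g y - g x)"
proof -
  obtain B where B: "B > 0" "\<And>v. B * norm v \<le> norm (G v)"
    using linear_inj_bounded_below_pos[OF has_derivative_linear[OF g] inj] by blast
  have "B / 2 > 0" using B by simp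
  then obtain r where r: "r > 0"
    "\<And>y. norm (y - x) < r \<Longrightarrow> norm (g y - g x - G (y - x)) \<le> B / 2 * norm (y - x)"
    using g unfolding has_derivative_at_alt by metis
  show ?thesis
  proof (rule that[of "B / 2" r])
    fix y assume y: "norm (y - x) < r"
    have "norm (G (y - x)) \<le> norm (g y - g x) + norm (g y - g x - G (y - x))"
      using norm_triangle_ineq4[of "g y - g x" "g y - g x - G (y - x)"] by simp
    then show "B / 2 * norm (y - x) \<le> norm (g y - g x)"
      using r(2)[OF y] B(2)[of "y - x"] by (simp add: field_simps)
  qed (use r B in auto)
qed

lemma derivative_upper_bound:
  assumes g: "(g has_derivative G) (at x)"
  obtains k r where "k > 0" "r > 0" "\<And>y. norm (y - x) < r \<Longrightarrow> norm (g y - g x) \<le> k * norm (y - x)"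
proof -
  obtain B where B: "B > 0" "\<And>v. norm (G v) \<le> norm v * B"
    using bounded_linear.pos_bounded[OF has_derivative_bounded_linear[OF g]] by blast
  obtain r where r: "r > 0"
    "\<And>y. norm (y - x) < r \<Longrightarrow> norm (g y - g x - G (y - x)) \<le> 1 * norm (y - x)"
    using g zero_less_one unfolding has_derivative_at_alt by metis
  show ?thesis
  proof (rule that[of "B + 1" r])
    fix y assume y: "norm (y - x) < r"
    have "norm (g y - g x) \<le> norm (g y - g x - G (y - x)) + norm (G (y - x))"
      using norm_triangle_ineq[of "g y - g x - G (y - x)" "G (y - x)"] by simp
    then show "norm (g y - g x) \<le> (B + 1) * norm (y - x)"
      using r(2)[OF y] B(2)[of "y - x"] by (simp add: algebra_simps)
  qed (use r B in auto)
qed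

lemma local_param_subset: "local_param M f U \<phi> \<Longrightarrow> \<phi> ` U \<subseteq> M"
  unfolding local_param_def by (meson openin_imp_subset)

lemma local_param_continuous: "local_param M f U \<phi> \<Longrightarrow> continuous_on U \<phi>"
  unfolding local_param_def homeomorphism_def by blast

lemma local_param_restrict:
  assumes lp: "local_param M f U \<phi>" and B: "open B" "B \<subseteq> U"
  shows "local_param M f B \<phi>"
proof -
  obtain \<phi>' where h: "homeomorphism U (\<phi> ` U) \<phi> \<phi>'" using lp unfolding local_param_def by blast
  have "openin (top_of_set U) B" using B by (simp add: openin_open_eq open_subset)
  then have "openin (top_of_set (\<phi> ` U)) (\<phi> ` B)" by (rule homeomorphism_imp_open_map[OF h])
  then have o: "openin (top_of_set M) (\<phi> ` B)"
    using lp unfolding local_param_def by (blast intro: openin_trans)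
  have "homeomorphism B (\<phi> ` B) \<phi> \<phi>'"
    by (rule homeomorphism_of_subsets[OF h B(2)]) (use B in auto)
  moreover have "C2_on B (f \<circ> \<phi>)"
    using lp B unfolding local_param_def C2_on_def
    by (meson continuous_on_subset differentiable_on_subset)
  ultimately show ?thesis using lp B o unfolding local_param_def by blast
qed

text \<open>\<open>h\<close> is the coordinate change from \<phi>' to \<phi>, and \<open>W\<close>
  is the entire overlap in the coordinates of \<phi>'. The coordinate change is recorded as a
  continuous map.\<close>

definition transition_map ::
  "(real^2) set \<Rightarrow> (real^2 \<Rightarrow> 'm) \<Rightarrow> (real^2) set \<Rightarrow> (real^2 \<Rightarrow> 'm) \<Rightarrow> (real^2) set \<Rightarrow> (real^2 \<Rightarrow> real^2) \<Rightarrow> bool" where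
  "transition_map U \<phi> U' \<phi>' W h \<longleftrightarrow> open W \<and> W \<subseteq> U' \<and> continuous_on W h \<and> W = {z \<in> U'. \<phi>' z \<in> \<phi> ` U} \<and>
     (\<forall>z\<in>W. h z \<in> U \<and> \<phi> (h z) = \<phi>' z) \<and> (\<forall>x\<in>U. \<forall>z\<in>W. \<phi> x = \<phi>' z \<longrightarrow> h z = x)"

lemma transition_mapD:
  assumes "transition_map U \<phi> U' \<phi>' W h"
  shows "open W" "W \<subseteq> U'" "continuous_on W h" "W = {z \<in> U'. \<phi>' z \<in> \<phi> ` U}"
    "z \<in> W \<Longrightarrow> h z \<in> U" "z \<in> W \<Longrightarrow> \<phi> (h z) = \<phi>' z" "x \<in> U \<Longrightarrow> z \<in> W \<Longrightarrow> \<phi> x = \<phi>' z \<Longrightarrow> h z = x"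
  using assms unfolding transition_map_def by blast+

lemma transition:
  assumes lp: "local_param M f U \<phi>" and lp': "local_param M f U' \<phi>'"
  obtains W h where "transition_map U \<phi> U' \<phi>' W h"
proof -
  obtain \<phi>i where h: "homeomorphism U (\<phi> ` U) \<phi> \<phi>i" using lp unfolding local_param_def by blast
  define W where "W = U' \<inter> \<phi>' -` (\<phi> ` U)"
  have "openin (top_of_set U') W" unfolding W_def
    by (rule continuous_openin_preimage[where T = M])
      (use lp lp' local_param_continuous[OF lp'] local_param_subset[OF lp'] in \<open>auto simp: local_param_def\<close>)
  then have oW: "open W" using lp' unfolding local_param_def by (meson openin_open_trans)
  have cont: "continuous_on W (\<lambda>z. \<phi>i (\<phi>' z))"
    by (rule continuous_on_compose2[of "\<phi> ` U"])
      (use h local_param_continuous[OF lp'] in \<open>auto simp: homeomorphism_def W_def intro: continuous_on_subset\<close>)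
  show ?thesis
    by (rule that[of W "\<lambda>z. \<phi>i (\<phi>' z)"])
      (use h oW cont in \<open>auto simp: transition_map_def W_def homeomorphism_def\<close>)
qed

text \<open>On the overlap the second immersion is the first one after \<open>h\<close>. The lower
  bound for the first and the upper bound for the second give
  \<open>norm (h z - x) \<le> (k2 / k1) * norm (z - x')\<close>, so the vanishing derivative of the
  component along \<open>n\<close> carries over although only continuity of \<open>h\<close> is
  available.\<close>

lemma unit_normal_transfer:
  assumes surf: "immersed_surface_S3 M f" and lp: "local_param M f U \<phi>" and lp': "local_param M f U' \<phi>'"
    and x: "x \<in> U" "x' \<in> U'" "\<phi> x = \<phi>' x'" and n: "unit_normal (f \<circ> \<phi>) x n"
  shows "unit_normal (f \<circ> \<phi>') x' n"
proof -
  interpret c: C2_chart U "f \<circ> \<phi>" by (rule local_param_C2_chart[OF surf lp])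
  interpret c': C2_chart U' "f \<circ> \<phi>'" by (rule local_param_C2_chart[OF surf lp'])
  let ?g = "f \<circ> \<phi>" and ?g' = "f \<circ> \<phi>'"
  obtain W h where tm: "transition_map U \<phi> U' \<phi>' W h"
    by (rule transition[OF lp lp'])
  note W = transition_mapD[OF tm]
  have xW: "x' \<in> W" using x unfolding W(4) by force
  have hx: "h x' = x" by (rule W(7)[OF x(1) xW x(3)])
  obtain k1 r1 where l: "k1 > 0" "r1 > 0" "\<And>y. norm (y - x) < r1 \<Longrightarrow> k1 * norm (y - x) \<le> norm (?g y - ?g x)"
    using inj_derivative_lower_bound[OF c.deriv[OF x(1)] c.inj[OF x(1)]] by blast
  obtain k2 r2 where up: "k2 > 0" "r2 > 0" "\<And>y. norm (y - x') < r2 \<Longrightarrow> norm (?g' y - ?g' x') \<le> k2 * norm (y - x')"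
    using derivative_upper_bound[OF c'.deriv[OF x(2)]] by blast
  have nd: "((\<lambda>z. n \<bullet> ?g z) has_derivative (\<lambda>v. 0)) (at x)"
    using has_derivative_inner_right[OF c.deriv[OF x(1)], of n] n by (simp add: unit_normal_def)
  have "((\<lambda>z. n \<bullet> ?g' z) has_derivative (\<lambda>v. 0)) (at x')"
    unfolding has_derivative_at_alt
  proof (intro conjI allI impI)
    fix e :: real assume e: "e > 0"
    \<comment> \<open>Compensates the Lipschitz bound \<open>k2 / k1\<close> of the coordinate
      change at \<open>x'\<close>.\<close>
    define e' where "e' = e * k1 / k2"
    have e': "e' > 0" using e l up by (simp add: e'_def)
    obtain r3 where r3: "r3 > 0" "\<And>y. norm (y - x) < r3 \<Longrightarrow> norm (n \<bullet> ?g y - n \<bullet> ?g x - 0) \<le> e' * norm (y - x)"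
      using nd e' unfolding has_derivative_at_alt by metis
    have "min r1 r3 > 0" using l r3 by simp
    moreover have "isCont h x'" using W(1,3) xW continuous_on_eq_continuous_at by blast
    ultimately obtain r4 where r4: "r4 > 0" "\<And>z. dist z x' < r4 \<Longrightarrow> dist (h z) (h x') < min r1 r3"
      unfolding continuous_at_eps_delta by blast
    obtain r5 where r5: "r5 > 0" "ball x' r5 \<subseteq> W" using W(1) xW open_contains_ball by blast
    show "\<exists>d>0. \<forall>y. norm (y - x') < d \<longrightarrow> norm (n \<bullet> ?g' y - n \<bullet> ?g' x' - 0) \<le> e * norm (y - x')"
    proof (intro exI conjI allI impI)
      show "0 < min r2 (min r4 r5)" using up r4 r5 by simp
      fix z assume z: "norm (z - x') < min r2 (min r4 r5)"
      then have zW: "z \<in> W" using r5 by (auto simp: dist_norm norm_minus_commute)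
      have hz: "norm (h z - x) < min r1 r3" using r4(2)[of z] z hx by (simp add: dist_norm)
      have gz: "?g' z = ?g (h z)" "?g' x' = ?g x" using W(6)[OF zW] x(3) by auto
      have "norm (n \<bullet> ?g' z - n \<bullet> ?g' x' - 0) \<le> e' * norm (h z - x)"
        using r3(2)[of "h z"] hz unfolding gz by simp
      also have "\<dots> \<le> e' * (norm (?g' z - ?g' x') / k1)"
      proof (intro mult_left_mono)
        have "k1 * norm (h z - x) \<le> norm (?g (h z) - ?g x)" using l(3) hz by simp
        then show "norm (h z - x) \<le> norm (?g' z - ?g' x') / k1"
          unfolding gz using l(1) by (simp add: pos_le_divide_eq mult.commute)
      qed (use e' in simp)
      also have "\<dots> \<le> e' * (k2 * norm (z - x') / k1)"
        using up(3)[of z] z e' l(1) by (intro mult_left_mono divide_right_mono) auto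
      also have "\<dots> = e * norm (z - x')" using l(1) up(1) by (simp add: e'_def)
      finally show "norm (n \<bullet> ?g' z - n \<bullet> ?g' x' - 0) \<le> e * norm (z - x')" .
    qed
  qed simp
  moreover have "((\<lambda>z. n \<bullet> ?g' z) has_derivative (\<lambda>v. n \<bullet> dir_deriv ?g' v x')) (at x')"
    by (rule has_derivative_inner_right[OF c'.deriv[OF x(2)]])
  ultimately have "(\<lambda>v. n \<bullet> dir_deriv ?g' v x') = (\<lambda>v. 0)" by (metis has_derivative_unique)
  then show ?thesis using n x(3) by (simp add: unit_normal_def fun_eq_iff)
qed

section \<open>Charts with a normal field of prescribed mean curvature\<close>

definition good_chart ::
  "real \<Rightarrow> 'm::topological_space set \<Rightarrow> ('m \<Rightarrow> real^4) \<Rightarrow> (real^2) set \<Rightarrow> (real^2 \<Rightarrow> 'm) \<Rightarrow> (real^2 \<Rightarrow> real^4) \<Rightarrow> bool" where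
  "good_chart H M f B \<phi> N \<longleftrightarrow> local_param M f B \<phi> \<and> (\<forall>x\<in>B. \<exists>L. cmc_at H (f \<circ> \<phi>) N x L)"

lemma good_chart_exists:
  assumes "H \<ge> 0" "immersed_surface_S3 M f" "constant_mean_curvature M f H" "m \<in> M"
  obtains B \<phi> N x where "good_chart H M f B \<phi> N" "x \<in> B" "\<phi> x = m"
proof -
  obtain U \<phi> x where U: "local_param M f U \<phi>" "x \<in> U" "\<phi> x = m"
    using assms(2,4) unfolding immersed_surface_S3_def by (metis imageE)
  interpret C2_chart U "f \<circ> \<phi>" by (rule local_param_C2_chart[OF assms(2) U(1)])
  obtain r N where r: "r > 0" "ball x r \<subseteq> U" "\<And>z. z \<in> ball x r \<Longrightarrow> \<exists>L. cmc_at H (f \<circ> \<phi>) N z L"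
    using cmc_field_exists[OF _ U(2) assms(1)] assms(3) U(1) unfolding constant_mean_curvature_def by metis
  have "good_chart H M f (ball x r) \<phi> N"
    unfolding good_chart_def using local_param_restrict[OF U(1) open_ball r(2)] r(3) by blast
  then show ?thesis using that r(1) U(3) by force
qed

text \<open>Reversing the normal changes the sign of the trace, which leaves mean curvature 0
  unchanged.\<close>

lemma good_chart_minus:
  assumes "good_chart 0 M f B \<phi> N"
  shows "good_chart 0 M f B \<phi> (\<lambda>x. - N x)"
proof -
  have "cmc_at 0 (f \<circ> \<phi>) (\<lambda>x. - N x) x (\<lambda>v. - L v)" if "cmc_at 0 (f \<circ> \<phi>) N x L" for x L
    using that unfolding cmc_at_def unit_normal_def
    by (auto intro: has_derivative_minus simp: neg_eq_iff_add_eq_0)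
  then show ?thesis using assms unfolding good_chart_def by blast
qed

locale rot_surface = frame4 a b c d for a b c d :: "real^4" +
  fixes M :: "'m::{t2_space,second_countable_topology} set" and f :: "'m \<Rightarrow> real^4" and H :: real
  assumes H0: "H \<ge> 0" and surf: "immersed_surface_S3 M f" and cmc: "constant_mean_curvature M f H"
    and rot: "\<And>\<theta>. rot a b \<theta> ` (f ` M) \<subseteq> f ` M"
begin

lemma good_chartD:
  assumes "good_chart H M f B \<phi> N"
  shows "local_param M f B \<phi>" "open B" "C2_chart B (f \<circ> \<phi>)"
    and "x \<in> B \<Longrightarrow> \<exists>L. cmc_at H (f \<circ> \<phi>) N x L"
    and "x \<in> B \<Longrightarrow> unit_normal (f \<circ> \<phi>) x (N x)"
    and "x \<in> B \<Longrightarrow> N x \<bullet> K ((f \<circ> \<phi>) x) = 0"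
    and "continuous_on B N" "continuous_on B (f \<circ> \<phi>)" "continuous_on B (dir_deriv (f \<circ> \<phi>) w)"
proof -
  show lp: "local_param M f B \<phi>" using assms unfolding good_chart_def by blast
  then show "open B" unfolding local_param_def by blast
  interpret C2_chart B "f \<circ> \<phi>" by (rule local_param_C2_chart[OF surf lp])
  show "C2_chart B (f \<circ> \<phi>)" by unfold_locales
  show c: "\<exists>L. cmc_at H (f \<circ> \<phi>) N x L" if "x \<in> B" for x using assms that unfolding good_chart_def by blast
  then show n: "unit_normal (f \<circ> \<phi>) x (N x)" if "x \<in> B" for x using that unfolding cmc_at_def by blast
  show "x \<in> B \<Longrightarrow> N x \<bullet> K ((f \<circ> \<phi>) x) = 0"
    using rotation_tangent[OF surf lp _ n rot] by (simp add: K_def rot_field_def)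
  show "continuous_on B N" "continuous_on B (f \<circ> \<phi>)"
    by (intro continuous_at_imp_continuous_on ballI; use c in \<open>force simp: cmc_at_def dest: has_derivative_continuous\<close>)+
  show "continuous_on B (dir_deriv (f \<circ> \<phi>) w)"
    using C2 unfolding C2_on_def by (blast intro: differentiable_imp_continuous_on)
qed

lemma continuous_axdist:
  assumes "good_chart H M f B \<phi> N"
  shows "continuous_on B (\<lambda>z. axdist (f (\<phi> z)))"
  using good_chartD(8)[OF assms] unfolding axdist_def o_def by (intro continuous_intros)

lemma good_chart_ball:
  assumes gc: "good_chart H M f B \<phi> N" and x: "x \<in> B" "axdist (f (\<phi> x)) > 0" "open W" "x \<in> W"
  obtains r where "r > 0" "ball x r \<subseteq> B" "ball x r \<subseteq> W" "\<forall>z\<in>ball x r. axdist (f (\<phi> z)) > 0"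
proof -
  have "openin (top_of_set B) (B \<inter> (\<lambda>z. axdist (f (\<phi> z))) -` {0<..})"
    by (rule continuous_openin_preimage_gen[OF continuous_axdist[OF gc] open_greaterThan])
  then have "open (B \<inter> (\<lambda>z. axdist (f (\<phi> z))) -` {0<..})"
    using good_chartD(2)[OF gc] openin_open_trans by blast
  then have "open (B \<inter> (\<lambda>z. axdist (f (\<phi> z))) -` {0<..} \<inter> W)" using x(3) by (rule open_Int)
  moreover have "x \<in> B \<inter> (\<lambda>z. axdist (f (\<phi> z))) -` {0<..} \<inter> W" using x by simp
  ultimately obtain r where "r > 0" "ball x r \<subseteq> B \<inter> (\<lambda>z. axdist (f (\<phi> z))) -` {0<..} \<inter> W"
    using open_contains_ball by meson
  then show ?thesis by (intro that[of r]) auto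
qed

text \<open>At an axis point the rotation field vanishes, and differentiating its tangency shows
  that the normal lies in the (c, d)-plane as well. The tangent plane is then the (a, b)-plane, so
  the projection \<open>F\<close> to that plane has an injective derivative and takes the value 0
  only at \<open>x\<close> in a small ball.\<close>

lemma axis_isolated:
  assumes gc: "good_chart H M f B \<phi> N" and x: "x \<in> B" "axdist (f (\<phi> x)) = 0"
  obtains r where "r > 0" "ball x r \<subseteq> B" "\<And>z. z \<in> ball x r \<Longrightarrow> z \<noteq> x \<Longrightarrow> axdist (f (\<phi> z)) > 0"
proof -
  note gcD = good_chartD[OF gc]
  interpret C2_chart B "f \<circ> \<phi>" by (rule gcD(3))
  let ?g = "f \<circ> \<phi>" let ?G = "\<lambda>v. dir_deriv ?g v x" let ?n = "N x" let ?y = "?g x"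
  have ya: "?y \<bullet> a = 0" "?y \<bullet> b = 0" using x(2) by (simp_all add: axdist_def sum_power2_eq_zero_iff)
  have n: "unit_normal ?g x ?n" by (rule gcD(5)[OF x(1)])
  obtain L where cm: "cmc_at H ?g N x L" using gcD(4)[OF x(1)] by blast
  have L: "(N has_derivative L) (at x)" using cm unfolding cmc_at_def by blast
  have nK: "?n \<bullet> K (?G v) = 0" for v
  proof -
    have "((\<lambda>x. N x \<bullet> K (?g x)) has_derivative (\<lambda>v. ?n \<bullet> K (?G v) + L v \<bullet> K ?y)) (at x)"
      using linear_K by (intro has_derivative_inner L bounded_linear.has_derivative[OF _ deriv[OF x(1)]])
        (simp add: linear_conv_bounded_linear)
    moreover have "((\<lambda>x. N x \<bullet> K (?g x)) has_derivative (\<lambda>v. 0)) (at x)"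
      by (rule has_derivative_transform_within_open[OF has_derivative_const gcD(2) x(1), of 0]) (simp only: gcD(6))
    ultimately have "(\<lambda>v. ?n \<bullet> K (?G v) + L v \<bullet> K ?y) = (\<lambda>v. 0)" by (rule has_derivative_unique)
    then have "?n \<bullet> K (?G v) + L v \<bullet> K ?y = 0" by (rule fun_cong)
    moreover have "L v \<bullet> K ?y = 0" unfolding K_def ya by simp
    ultimately show ?thesis by linarith
  qed
  \<comment> \<open>\<open>K ?n\<close> is orthogonal to the position and to the normal, hence
    tangent; inserting it into \<open>nK\<close> makes its squared length, \<open>axdist ?n\<close>,
    vanish.\<close>
  have "K ?n \<bullet> ?y = - (?n \<bullet> K ?y)" using K_skew[of ?n ?y] by simp
  then have "K ?n \<bullet> ?y = 0" using ya by (simp add: K_def)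
  moreover have "K ?n \<bullet> ?n = 0" using K_self by (simp add: inner_commute)
  ultimately obtain v where "?G v = K ?n" using tangent_onto[OF x(1) n] by blast
  then have "?n \<bullet> K (K ?n) = 0" using nK[of v] by simp
  then have "axdist ?n = 0" unfolding K_skew[of ?n "K ?n"] K_norm by simp
  then have na: "?n \<bullet> a = 0" "?n \<bullet> b = 0" by (simp_all add: axdist_def sum_power2_eq_zero_iff)
  have "v = 0" if v: "?G v \<bullet> a = 0" "?G v \<bullet> b = 0" for v
  proof -
    define p q y3 y4 n3 n4 where "p = ?G v \<bullet> c" and "q = ?G v \<bullet> d" and "y3 = ?y \<bullet> c" and "y4 = ?y \<bullet> d"
      and "n3 = ?n \<bullet> c" and "n4 = ?n \<bullet> d"
    have e1: "p * y3 + q * y4 = 0"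
      using sph_tangent[OF x(1), of v] frame_inner[of "?G v" ?y] v ya by (simp add: p_def q_def y3_def y4_def)
    have e2: "p * n3 + q * n4 = 0"
      using n frame_inner[of "?G v" ?n] v na by (simp add: p_def q_def n3_def n4_def unit_normal_def inner_commute)
    have e3: "y3 * y3 + y4 * y4 = 1" "n3 * n3 + n4 * n4 = 1" "y3 * n3 + y4 * n4 = 0"
      using sph[OF x(1)] n frame_inner[of ?y ?y] frame_inner[of ?n ?n] frame_inner[of ?y ?n] ya na
      by (simp_all add: y3_def y4_def n3_def n4_def unit_normal_def dot_square_norm inner_commute)
    have "(y3 * n4 - y4 * n3) * (y3 * n4 - y4 * n3) = (y3 * y3 + y4 * y4) * (n3 * n3 + n4 * n4) - (y3 * n3 + y4 * n4) * (y3 * n3 + y4 * n4)"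
      by (simp add: algebra_simps)
    \<comment> \<open>Position and normal form an orthonormal basis of the (c, d)-plane, so a
      tangent vector in that plane is 0.\<close>
    then have det: "y3 * n4 - y4 * n3 \<noteq> 0" unfolding e3 by auto
    have "p * (y3 * n4 - y4 * n3) = (p * y3 + q * y4) * n4 - (p * n3 + q * n4) * y4" by (simp add: algebra_simps)
    then have "p = 0" unfolding e1 e2 using det by simp
    have "q * (y3 * n4 - y4 * n3) = (p * n3 + q * n4) * y3 - (p * y3 + q * y4) * n3" by (simp add: algebra_simps)
    then have "q = 0" unfolding e1 e2 using det by simp
    have "?G v = 0" using frame_expand[of "?G v"] v \<open>p = 0\<close> \<open>q = 0\<close> by (simp add: p_def q_def)
    then have "?G v = ?G 0" using linear_0[OF lin[OF x(1)]] by simp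
    then show "v = 0" by (rule injD[OF inj[OF x(1)]])
  qed
  note ker = this
  define F where "F = (\<lambda>z. (?g z \<bullet> a, ?g z \<bullet> b))"
  have Fd: "(F has_derivative (\<lambda>v. (?G v \<bullet> a, ?G v \<bullet> b))) (at x)"
    unfolding F_def by (intro has_derivative_Pair has_derivative_inner_left deriv[OF x(1)])
  have Fi: "inj (\<lambda>v. (?G v \<bullet> a, ?G v \<bullet> b))"
    unfolding linear_injective_0[OF has_derivative_linear[OF Fd]] using ker by (auto simp: zero_prod_def)
  obtain k r1 where r1: "k > 0" "r1 > 0" "\<And>y. norm (y - x) < r1 \<Longrightarrow> k * norm (y - x) \<le> norm (F y - F x)"
    using inj_derivative_lower_bound[OF Fd Fi] by blast
  obtain r2 where r2: "r2 > 0" "ball x r2 \<subseteq> B" using gcD(2) x(1) open_contains_ball by blast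
  show ?thesis
  proof (rule that[of "min r1 r2"])
    fix z assume z: "z \<in> ball x (min r1 r2)" "z \<noteq> x"
    have "0 < k * norm (z - x)" using r1(1) z(2) by simp
    also have "\<dots> \<le> norm (F z - F x)" using r1(3)[of z] z(1) by (simp add: dist_norm norm_minus_commute)
    finally have "F z \<noteq> 0" using ya by (simp add: F_def zero_prod_def)
    then have "?g z \<bullet> a \<noteq> 0 \<or> ?g z \<bullet> b \<noteq> 0" by (simp add: F_def zero_prod_def)
    then show "axdist (f (\<phi> z)) > 0" by (auto simp: axdist_def sum_power2_gt_zero_iff)
  qed (use r1 r2 in auto)
qed

lemma moment_constant:
  assumes gc: "good_chart H M f B \<phi> N" and S: "convex S" "S \<subseteq> B" "\<And>z. z \<in> S \<Longrightarrow> axdist (f (\<phi> z)) > 0"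
    and z: "z1 \<in> S" "z2 \<in> S"
  shows "H * axdist (f (\<phi> z1)) + mm (f (\<phi> z1)) (N z1) = H * axdist (f (\<phi> z2)) + mm (f (\<phi> z2)) (N z2)"
proof -
  note gcD = good_chartD[OF gc]
  define \<gamma> where "\<gamma> = (\<lambda>s. z1 + s *\<^sub>R (z2 - z1))"
  define m where "m = (\<lambda>s. H * axdist ((f \<circ> \<phi>) (\<gamma> s)) + mm ((f \<circ> \<phi>) (\<gamma> s)) (N (\<gamma> s)))"
  have in_S: "\<gamma> s \<in> S" if "s \<in> {0..1}" for s
    using convexD_alt[OF S(1) z, of s] that by (simp add: \<gamma>_def algebra_simps)
  have "(m has_real_derivative 0) (at s within {0..1})" if s: "s \<in> {0..1}" for s
  proof -
    have B: "\<gamma> s \<in> B" and ax: "axdist ((f \<circ> \<phi>) (\<gamma> s)) > 0" using in_S[OF s] S by auto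
    obtain L where L: "cmc_at H (f \<circ> \<phi>) N (\<gamma> s) L" using gcD(4)[OF B] by blast
    show ?thesis unfolding m_def \<gamma>_def
      by (rule has_field_derivative_at_within[OF curve_flow(2)[OF gcD(2) B[unfolded \<gamma>_def]
            L[unfolded \<gamma>_def] gcD(6) ax[unfolded \<gamma>_def] refl]])
  qed
  from has_field_derivative_zero_constant[OF _ this] have "m 0 = m 1" by force
  then show ?thesis by (simp add: m_def \<gamma>_def)
qed

text \<open>A constant squared distance makes the system stationary: its first equation gives
  \<open>del = 0\<close> on the ball, and the second then gives
  \<open>C\<^sup>2 = (1 + H\<^sup>2) * x0\<^sup>2\<close>.\<close>

lemma constant_axdist:
  assumes gc: "good_chart H M f B \<phi> N" and r: "r > 0" "ball x r \<subseteq> B"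
    and ax: "\<And>z. z \<in> ball x r \<Longrightarrow> axdist (f (\<phi> z)) = x0" and x0: "x0 > 0"
  shows "(H * x0 + mm (f (\<phi> x)) (N x))\<^sup>2 = (1 + H\<^sup>2) * x0\<^sup>2"
proof -
  note gcD = good_chartD[OF gc]
  let ?g = "f \<circ> \<phi>"
  have flow: "\<exists>w. profile_flow H (H * axdist (?g z) + mm (?g z) (N z)) 1 (\<lambda>s. axdist (?g (z + s *\<^sub>R w)))
      (\<lambda>s. del (?g (z + s *\<^sub>R w)) (N (z + s *\<^sub>R w)))
      (\<lambda>s. zc (?g (z + s *\<^sub>R w))) (\<lambda>s. zc (V (?g (z + s *\<^sub>R w)) (N (z + s *\<^sub>R w)))) (at 0) 0"
    if z: "z \<in> ball x r" for z
  proof -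
    have B: "z \<in> B" and az: "axdist (?g z) > 0" using z r ax x0 by auto
    obtain L where L: "cmc_at H ?g N z L" using gcD(4)[OF B] by blast
    obtain w where w: "dir_deriv ?g w z = V (?g z) (N z)"
      using moving_frame(1)[OF gcD(2) B L gcD(6) az] by blast
    have sp: "speed ?g N w z = 1" by (rule speed_V[of ?g z N w, OF cmc_normal_pt[OF L gcD(6)[OF B] az] w])
    show ?thesis
      using curve_flow(1)[OF gcD(2), of z 0 w H ?g N L "H * axdist (?g z) + mm (?g z) (N z)"] B L gcD(6) az sp
      by auto
  qed
  have near: "\<forall>\<^sub>F s in at (0::real). z + s *\<^sub>R w \<in> ball x r" if z: "z \<in> ball x r" for z w
  proof -
    have "((\<lambda>s. z + s *\<^sub>R w) \<longlongrightarrow> z + 0 *\<^sub>R w) (at 0)" by (intro tendsto_intros)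
    then have "((\<lambda>s. z + s *\<^sub>R w) \<longlongrightarrow> z) (at 0)" by simp
    then show ?thesis using topological_tendstoD open_ball z by blast
  qed
  have zero: "D = 0" if "(h has_real_derivative D) (at 0)" "\<forall>\<^sub>F s in at 0. h s = k" "h 0 = k" for h :: "real \<Rightarrow> real" and D k
  proof -
    have "((\<lambda>s. k) has_real_derivative D) (at 0)"
      using that has_field_derivative_cong_eventually[of h "\<lambda>_. k" 0 UNIV D] by simp
    then show ?thesis by (rule DERIV_unique[OF _ DERIV_const])
  qed
  have del0: "del (?g z) (N z) = 0" if z: "z \<in> ball x r" for z
  proof -
    obtain w where "((\<lambda>s. axdist (?g (z + s *\<^sub>R w))) has_real_derivative 1 * (2 * axdist (?g z) * del (?g z) (N z))) (at 0)"
      using flow[OF z] unfolding profile_flow_def by auto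
    moreover have "\<forall>\<^sub>F s in at 0. axdist (?g (z + s *\<^sub>R w)) = x0"
      using near[OF z, of w] by (rule eventually_mono) (simp add: ax)
    ultimately have "1 * (2 * axdist (?g z) * del (?g z) (N z)) = 0"
      by (rule zero) (use ax z in simp)
    then show ?thesis using ax[OF z] x0 by simp
  qed
  have x: "x \<in> ball x r" using r by simp
  obtain w where w: "((\<lambda>s. del (?g (x + s *\<^sub>R w)) (N (x + s *\<^sub>R w))) has_real_derivative
      1 * ((H * axdist (?g x) + mm (?g x) (N x))\<^sup>2 / axdist (?g x) - (1 + H\<^sup>2) * axdist (?g x))) (at 0)"
    using flow[OF x] unfolding profile_flow_def by auto
  have "\<forall>\<^sub>F s in at 0. del (?g (x + s *\<^sub>R w)) (N (x + s *\<^sub>R w)) = 0"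
    using near[OF x] by (rule eventually_mono) (rule del0)
  with w have "1 * ((H * axdist (?g x) + mm (?g x) (N x))\<^sup>2 / axdist (?g x) - (1 + H\<^sup>2) * axdist (?g x)) = 0"
    by (rule zero) (use del0[OF x] in simp)
  then show ?thesis using ax[OF x] x0 by (simp add: field_simps power2_eq_square)
qed

lemma normals_agree_or_opposite:
  assumes gc: "good_chart H M f B \<phi> N" and gc': "good_chart H M f B' \<phi>' N'"
    and x: "x \<in> B" "x' \<in> B'" "\<phi> x = \<phi>' x'"
  shows "N x = N' x' \<or> N x = - N' x'"
proof -
  interpret C2_chart B' "f \<circ> \<phi>'" by (rule good_chartD(3)[OF gc'])
  obtain n \<kappa>1 \<kappa>2 where "principal_curvatures (f \<circ> \<phi>') x' n \<kappa>1 \<kappa>2"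
    using cmc good_chartD(1)[OF gc'] x(2) unfolding constant_mean_curvature_def by blast
  then obtain v w where "fund1 (f \<circ> \<phi>') x' v v = 1" "fund1 (f \<circ> \<phi>') x' w w = 1" "fund1 (f \<circ> \<phi>') x' v w = 0"
    unfolding principal_curvatures_def by blast
  then show ?thesis
    by (rule unit_normal_unique[OF x(2) unit_normal_transfer[OF surf good_chartD(1)[OF gc] good_chartD(1)[OF gc'] x good_chartD(5)[OF gc x(1)]]
          good_chartD(5)[OF gc' x(2)]])
qed

text \<open>If the two normals were opposite near a point, then \<open>H axdist + mm\<close> and \<open>H axdist - mm\<close>
  would both be constant there, so that the surface would be a rotational tube; on a tube the
  mean curvature determines the normal.\<close>

lemma normals_agree:
  assumes H: "H > 0" and gc: "good_chart H M f B \<phi> N" and gc': "good_chart H M f B' \<phi>' N'"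
    and x: "x \<in> B" "x' \<in> B'" "\<phi> x = \<phi>' x'" and ax: "axdist (f (\<phi> x)) > 0"
  shows "N x = N' x'"
proof (rule ccontr)
  assume "N x \<noteq> N' x'"
  then have opp: "N x = - N' x'" using normals_agree_or_opposite[OF gc gc' x] by blast
  note gcD = good_chartD[OF gc] and gcD' = good_chartD[OF gc']
  obtain W h where tm: "transition_map B' \<phi>' B \<phi> W h"
    by (rule transition[OF gcD'(1) gcD(1)])
  note W = transition_mapD[OF tm]
  have xW: "x \<in> W" using x unfolding W(4) by force
  have hx: "h x = x'" using W(7)[OF x(2) xW] x(3) by simp
  have ax': "axdist (f (\<phi>' x')) > 0" using ax x(3) by simp
  obtain r' where r': "r' > 0" "ball x' r' \<subseteq> B'" "\<forall>z\<in>ball x' r'. axdist (f (\<phi>' z)) > 0"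
    using good_chart_ball[OF gc' x(2) ax' open_UNIV UNIV_I] .
  \<comment> \<open>The sign of this inner product distinguishes equal from opposite normals, so
    being opposite is an open condition.\<close>
  have cN: "continuous_on W (\<lambda>z. N z \<bullet> N' (h z))"
    by (intro continuous_intros continuous_on_subset[OF gcD(7) W(2)] continuous_on_compose2[OF gcD'(7) W(3)])
      (use W(5) in auto)
  have "open (W \<inter> (\<lambda>z. N z \<bullet> N' (h z)) -` {..<0})" "open (W \<inter> h -` ball x' r')"
    using continuous_open_preimage[OF cN W(1)] continuous_open_preimage[OF W(3,1)] by auto
  then have oQ: "open ((W \<inter> (\<lambda>z. N z \<bullet> N' (h z)) -` {..<0}) \<inter> (W \<inter> h -` ball x' r'))" by (rule open_Int)
  have "N x \<bullet> N' (h x) < 0"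
    using gcD'(5)[OF x(2)] unfolding hx opp by (simp add: unit_normal_def dot_square_norm)
  then have xQ: "x \<in> (W \<inter> (\<lambda>z. N z \<bullet> N' (h z)) -` {..<0}) \<inter> (W \<inter> h -` ball x' r')"
    using xW hx r'(1) by simp
  obtain r where r: "r > 0" "ball x r \<subseteq> B"
    and rW: "ball x r \<subseteq> (W \<inter> (\<lambda>z. N z \<bullet> N' (h z)) -` {..<0}) \<inter> (W \<inter> h -` ball x' r')"
    and rp: "\<forall>z\<in>ball x r. axdist (f (\<phi> z)) > 0"
    using good_chart_ball[OF gc x(1) ax oQ xQ] .
  define x0 where "x0 = axdist (f (\<phi> x))"
  have const: "axdist (f (\<phi> z)) = x0" if z: "z \<in> ball x r" for z
  proof -
    have zW: "z \<in> W" "N z \<bullet> N' (h z) < 0" "h z \<in> ball x' r'" using rW z by auto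
    have "N z = N' (h z) \<or> N z = - N' (h z)"
      by (rule normals_agree_or_opposite[OF gc gc']) (use zW W r z in auto)
    then have Nz: "N' (h z) = - N z"
      using zW(2) inner_ge_zero[of "N z"] by (metis add.inverse_inverse not_le)
    have c1: "H * axdist (f (\<phi> z)) + mm (f (\<phi> z)) (N z) = H * axdist (f (\<phi> x)) + mm (f (\<phi> x)) (N x)"
      by (rule moment_constant[OF gc convex_ball r(2) bspec[OF rp] z]) (use r in auto)
    have "H * axdist (f (\<phi>' (h z))) + mm (f (\<phi>' (h z))) (N' (h z)) = H * axdist (f (\<phi>' x')) + mm (f (\<phi>' x')) (N' x')"
      by (rule moment_constant[OF gc' convex_ball r'(2) bspec[OF r'(3)] zW(3)]) (use r' in auto)
    then have c2: "H * axdist (f (\<phi> z)) - mm (f (\<phi> z)) (N z) = H * axdist (f (\<phi> x)) - mm (f (\<phi> x)) (N x)"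
      unfolding W(6)[OF zW(1)] Nz x(3)[symmetric] opp by (simp add: mm_def)
    \<comment> \<open>In the sum of the two constants \<open>mm\<close> cancels.\<close>
    from c1 c2 have "H * axdist (f (\<phi> z)) = H * axdist (f (\<phi> x))" by linarith
    then show ?thesis using H by (simp add: x0_def)
  qed
  have x0: "x0 > 0" using ax by (simp add: x0_def)
  have 1: "(H * x0 + mm (f (\<phi> x)) (N x))\<^sup>2 = (1 + H\<^sup>2) * x0\<^sup>2"
    by (rule constant_axdist[OF gc r(1,2) const x0])
  \<comment> \<open>The reverse transition carries the constancy of \<open>axdist\<close> into the
    second chart, where the opposite normal yields a second quadratic equation.\<close>
  obtain W' h' where tm': "transition_map B \<phi> B' \<phi>' W' h'"
    by (rule transition[OF gcD(1) gcD'(1)])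
  note W' = transition_mapD[OF tm']
  have xW': "x' \<in> W'" using x unfolding W'(4) by force
  have hx': "h' x' = x" using W'(7)[OF x(1) xW'] x(3) by simp
  have oQ': "open (W' \<inter> h' -` ball x r)" using continuous_open_preimage[OF W'(3,1)] by auto
  have xQ': "x' \<in> W' \<inter> h' -` ball x r" using xW' hx' r(1) by simp
  obtain s where s: "s > 0" "ball x' s \<subseteq> B'" "ball x' s \<subseteq> W' \<inter> h' -` ball x r"
    using good_chart_ball[OF gc' x(2) ax' oQ' xQ'] .
  have "axdist (f (\<phi>' z)) = x0" if z: "z \<in> ball x' s" for z
  proof -
    have "z \<in> W'" "h' z \<in> ball x r" using s(3) z by auto
    then show ?thesis using const[of "h' z"] W'(6) by simp
  qed
  from constant_axdist[OF gc' s(1,2) this x0] have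
    2: "(H * x0 + mm (f (\<phi>' x')) (N' x'))\<^sup>2 = (1 + H\<^sup>2) * x0\<^sup>2" .
  define q where "q = mm (f (\<phi> x)) (N x)"
  have "mm (f (\<phi>' x')) (N' x') = - q" unfolding q_def opp x(3) by (simp add: mm_def)
  then have 3: "(H * x0 - q)\<^sup>2 = (1 + H\<^sup>2) * x0\<^sup>2" using 2 by simp
  \<comment> \<open>Both signs of \<open>q\<close> satisfy the same quadratic equation; this forces
    \<open>q = 0\<close> and then
    \<open>H\<^sup>2 * x0\<^sup>2 = (1 + H\<^sup>2) * x0\<^sup>2\<close>.\<close>
  have "4 * (H * x0) * q = (H * x0 + q)\<^sup>2 - (H * x0 - q)\<^sup>2" by (simp add: power2_eq_square algebra_simps)
  also have "\<dots> = 0" using 1 3 unfolding q_def by simp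
  finally have "q = 0" using H x0 by simp
  then show False using 3 x0 by (simp add: power_mult_distrib algebra_simps)
qed

end

section \<open>The matched part of the surface is everything off the axis\<close>

context rot_surface
begin

text \<open>In a chart an open singleton of \<open>M\<close> would become an open singleton of the
  plane. This makes punctured neighbourhoods nonempty in \<open>off_axis_matched\<close>.\<close>

lemma not_isolated: "m \<in> M \<Longrightarrow> \<not> openin (top_of_set M) {m}"
proof
  assume m: "m \<in> M" and o: "openin (top_of_set M) {m}"
  obtain U \<phi> x where U: "local_param M f U \<phi>" "x \<in> U" "\<phi> x = m"
    using surf m unfolding immersed_surface_S3_def by (metis imageE)
  obtain \<phi>' where h: "homeomorphism U (\<phi> ` U) \<phi> \<phi>'" using U(1) unfolding local_param_def by blast
  have "openin (top_of_set U) (U \<inter> \<phi> -` {m})"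
    by (rule continuous_openin_preimage[OF local_param_continuous[OF U(1)] _ o])
      (use local_param_subset[OF U(1)] in auto)
  moreover have "U \<inter> \<phi> -` {m} = {x}"
    using h U(2,3) by (auto simp: homeomorphism_def) (metis)
  ultimately have "open {x}" using U(1) unfolding local_param_def by (metis openin_open_trans)
  then show False by (simp add: not_open_singleton)
qed

lemma singleton_inter:
  assumes "openin (top_of_set M) W" "openin (top_of_set M) W'" "m \<in> M" "W \<inter> W' = {m}"
  shows False
  using openin_Int[OF assms(1,2)] not_isolated[OF assms(3)] assms(4) by simp

lemma image_open:
  assumes gc: "good_chart H M f B \<phi> N" and S: "open S" "S \<subseteq> B"
  shows "openin (top_of_set M) (\<phi> ` S)"
  using local_param_restrict[OF good_chartD(1)[OF gc] S] unfolding local_param_def by blast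

lemma off_axis_point: "\<exists>m\<in>M. axdist (f m) > 0"
proof -
  obtain m where m: "m \<in> M" using surf unfolding immersed_surface_S3_def by blast
  obtain B \<phi> N x where gc: "good_chart H M f B \<phi> N" "x \<in> B" "\<phi> x = m"
    using good_chart_exists[OF H0 surf cmc m] .
  have sub: "\<phi> ` B \<subseteq> M" by (rule local_param_subset[OF good_chartD(1)[OF gc(1)]])
  show ?thesis
  proof (cases "axdist (f (\<phi> x)) = 0")
    case True
    obtain r where r: "r > 0" "ball x r \<subseteq> B" "\<And>z. z \<in> ball x r \<Longrightarrow> z \<noteq> x \<Longrightarrow> axdist (f (\<phi> z)) > 0"
      using axis_isolated[OF gc(1,2) True] by blast
    define z where "z = x + (r / 2) *\<^sub>R axis 1 1"
    have "z \<in> ball x r" "z \<noteq> x" using r(1) by (auto simp: z_def dist_norm axis_eq_0_iff)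
    then show ?thesis using r sub by blast
  next
    case False
    moreover have "axdist (f (\<phi> x)) \<ge> 0" by (simp add: axdist_def)
    ultimately show ?thesis using gc m by (intro bexI[of _ m]) auto
  qed
qed

end

section \<open>Matched points and attained times\<close>

locale rot_profile = rot_surface a b c d M f H + profile_match a b c d H C C1 C2 u
  for a b c d :: "real^4" and M :: "'m::{t2_space,second_countable_topology} set" and f :: "'m \<Rightarrow> real^4"
    and H C C1 C2 :: real and u :: complex
begin

text \<open>The chart and its normal are quantified away, so a point may match with either
  orientation and at several times.\<close>

definition matched :: "'m \<Rightarrow> real \<Rightarrow> bool" where
  "matched m t \<longleftrightarrow> (\<exists>B \<phi> N x. good_chart H M f B \<phi> N \<and> x \<in> B \<and> \<phi> x = m \<and> match_pt (f m) (N x) t)"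

definition J0 :: "real set" where "J0 = {t. \<exists>m. matched m t}"

lemma matchedI:
  "good_chart H M f B \<phi> N \<Longrightarrow> x \<in> B \<Longrightarrow> match_pt (f (\<phi> x)) (N x) t \<Longrightarrow> matched (\<phi> x) t"
  unfolding matched_def by blast

lemma matched_M: "matched m t \<Longrightarrow> m \<in> M"
  unfolding matched_def using good_chartD(1) local_param_subset by blast

lemma matched_axdist: "matched m t \<Longrightarrow> axdist (f m) = mo.X t" "matched m t \<Longrightarrow> axdist (f m) > 0"
  unfolding matched_def match_pt_def using mo.X_pos by auto

lemma matched_path:
  assumes gc: "good_chart H M f B \<phi> N" and S: "\<And>s. s \<in> {0..1} \<Longrightarrow> z + s *\<^sub>R w \<in> B"
    "\<And>s. s \<in> {0..1} \<Longrightarrow> axdist (f (\<phi> (z + s *\<^sub>R w))) > 0"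
    and m: "match_pt (f (\<phi> z)) (N z) t"
  obtains \<tau> where "\<tau> 0 = t" "continuous_on {0..1} \<tau>" "\<tau> ` {0..1} \<subseteq> J0"
    "(\<tau> has_real_derivative speed (f \<circ> \<phi>) N w z) (at 0 within {0..1})"
    "match_pt (f (\<phi> (z + w))) (N (z + w)) (\<tau> 1)"
proof -
  note gcD = good_chartD[OF gc]
  obtain \<tau> where \<tau>: "\<tau> 0 = t" "continuous_on {0..1} \<tau>"
    "\<And>s. s \<in> {0..1} \<Longrightarrow> (\<tau> has_real_derivative speed (f \<circ> \<phi>) N w (z + s *\<^sub>R w)) (at s within {0..1})"
    "\<And>s. s \<in> {0..1} \<Longrightarrow> match_pt ((f \<circ> \<phi>) (z + s *\<^sub>R w)) (N (z + s *\<^sub>R w)) (\<tau> s)"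
    by (rule segment_match[where ?x0.0 = z and w = w and ?t0.0 = t and g = "f \<circ> \<phi>" and N = N and B = B,
          OF gcD(2) S(1) gcD(4) gcD(6) gcD(9)]) (use S(2) m in auto)
  have "\<tau> s \<in> J0" if "s \<in> {0..1}" for s
    using matchedI[OF gc S(1)[OF that], of "\<tau> s"] \<tau>(4)[OF that] by (auto simp: J0_def)
  then have img: "\<tau> ` {0..1} \<subseteq> J0" by blast
  show ?thesis by (rule that[OF \<tau>(1,2) img]) (use \<tau>(3)[of 0] \<tau>(4)[of 1] in auto)
qed

text \<open>The model time varies continuously along the segment and all its values are attained, so
  it stays in one component of \<open>J0\<close>.\<close>

lemma matched_segment:
  assumes gc: "good_chart H M f B \<phi> N" and S: "convex S" "S \<subseteq> B" "\<And>z. z \<in> S \<Longrightarrow> axdist (f (\<phi> z)) > 0"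
    and z: "z1 \<in> S" "z2 \<in> S" and m: "match_pt (f (\<phi> z1)) (N z1) t"
  shows "\<exists>t'. matched (\<phi> z2) t' \<and> connected_component J0 t t'"
proof -
  have inS: "z1 + s *\<^sub>R (z2 - z1) \<in> S" if "s \<in> {0..1}" for s
    using convexD_alt[OF S(1) z, of s] that by (simp add: algebra_simps)
  obtain \<tau> :: "real \<Rightarrow> real" where \<tau>: "\<tau> 0 = t" "continuous_on {0..1} \<tau>" "\<tau> ` {0..1} \<subseteq> J0"
    "(\<tau> has_real_derivative speed (f \<circ> \<phi>) N (z2 - z1) z1) (at 0 within {0..1})"
    "match_pt (f (\<phi> (z1 + (z2 - z1)))) (N (z1 + (z2 - z1))) (\<tau> 1)"
    using matched_path[OF gc subsetD[OF S(2) inS] S(3)[OF inS] m] .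
  have "matched (\<phi> z2) (\<tau> 1)" using matchedI[OF gc, of z2] S(2) z(2) \<tau>(5) by auto
  moreover have "connected (\<tau> ` {0..1})" by (rule connected_continuous_image[OF \<tau>(2)]) simp
  then have "connected_component J0 t (\<tau> 1)"
    unfolding connected_component_def using \<tau>(1,3) by (intro exI[of _ "\<tau> ` {0..1}"]) (auto intro: rev_image_eqI[of 0])
  ultimately show ?thesis by blast
qed

text \<open>Moving the chart point so that the image starts in the direction \<open>V\<close> or
  \<open>- V\<close> changes the model time with nonzero derivative, so later and earlier times are
  attained; the times along each path form a connected set and fill the gaps to
  \<open>t\<close>.\<close>

lemma open_J0: "open J0"
proof (subst open_contains_ball, intro ballI)
  fix t assume "t \<in> J0"
  then obtain B \<phi> N x where gc: "good_chart H M f B \<phi> N" "x \<in> B" and mt: "match_pt (f (\<phi> x)) (N x) t"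
    unfolding J0_def matched_def by auto
  note gcD = good_chartD[OF gc(1)]
  have ax: "axdist (f (\<phi> x)) > 0" using matched_axdist(2)[OF matchedI[OF gc mt]] .
  obtain r where r: "r > 0" "ball x r \<subseteq> B" "\<forall>z\<in>ball x r. axdist (f (\<phi> z)) > 0"
    using good_chart_ball[OF gc ax open_UNIV UNIV_I] .
  obtain L where L: "cmc_at H (f \<circ> \<phi>) N x L" using gcD(4)[OF gc(2)] by blast
  have ax': "axdist ((f \<circ> \<phi>) x) > 0" using ax by simp
  obtain w where w: "dir_deriv (f \<circ> \<phi>) w x = V ((f \<circ> \<phi>) x) (N x)"
    using moving_frame(1)[OF gcD(2) gc(2) L gcD(6) ax'] by blast
  have sp: "speed (f \<circ> \<phi>) N w x = 1"
    by (rule speed_V[of "f \<circ> \<phi>" x N w, OF cmc_normal_pt[OF L gcD(6)[OF gc(2)] ax'] w])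
  \<comment> \<open>Keeps the segments from \<open>x\<close> with direction
    \<open>\<plusminus> \<delta> *\<^sub>R w\<close> inside the ball.\<close>
  define \<delta> where "\<delta> = r / (norm w + 1)"
  have np: "norm w + 1 > 0" using norm_ge_zero[of w] by linarith
  have \<delta>: "\<delta> > 0" using r(1) np by (simp add: \<delta>_def)
  have "\<delta> * norm w < \<delta> * (norm w + 1)" using \<delta> by simp
  also have "\<dots> = r" using np by (simp add: \<delta>_def)
  finally have \<delta>w: "\<delta> * norm w < r" .
  have reach: "\<exists>(\<tau> :: real \<Rightarrow> real) (h :: real). \<tau> 0 = t \<and> connected (\<tau> ` {0..1}) \<and> \<tau> ` {0..1} \<subseteq> J0 \<and> h \<in> {0..1} \<and> k * (\<tau> h - t) > 0"
    if k: "k = 1 \<or> k = -1" for k :: real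
  proof -
    define w' where "w' = (k * \<delta>) *\<^sub>R w"
    have inb: "x + s *\<^sub>R w' \<in> ball x r" if "s \<in> {0..1}" for s
    proof -
      have "dist (x + s *\<^sub>R w') x = s * (\<delta> * norm w)"
        using that k \<delta> by (auto simp: dist_norm w'_def abs_mult)
      also have "\<dots> \<le> 1 * (\<delta> * norm w)" using that \<delta> by (intro mult_right_mono) auto
      finally show ?thesis using \<delta>w by (simp add: dist_commute)
    qed
    obtain \<tau> :: "real \<Rightarrow> real" where \<tau>: "\<tau> 0 = t" "continuous_on {0..1} \<tau>" "\<tau> ` {0..1} \<subseteq> J0"
      "(\<tau> has_real_derivative speed (f \<circ> \<phi>) N w' x) (at 0 within {0..1})"
      "match_pt (f (\<phi> (x + w'))) (N (x + w')) (\<tau> 1)"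
      using matched_path[OF gc(1) subsetD[OF r(2) inb] bspec[OF r(3) inb] mt] .
    have "speed (f \<circ> \<phi>) N w' x = k * \<delta>"
      using sp linear_scale[OF C2_chart.lin[OF gcD(3) gc(2)], of "k * \<delta>" w]
      by (simp add: speed_def w'_def)
    then have d: "(\<tau> has_real_derivative k * \<delta>) (at 0 within {0..1})" using \<tau>(4) by simp
    have "((\<lambda>s. k * \<tau> s) has_real_derivative k * (k * \<delta>)) (at 0 within {0..1})"
      by (rule DERIV_cmult[OF d])
    moreover have "k * (k * \<delta>) > 0" using k \<delta> by auto
    ultimately obtain e where e: "e > 0" "\<And>h. h > 0 \<Longrightarrow> 0 + h \<in> {0..1} \<Longrightarrow> h < e \<Longrightarrow> k * \<tau> 0 < k * \<tau> (0 + h)"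
      using has_real_derivative_pos_inc_right by metis
    define h where "h = min (e / 2) 1"
    have h: "h > 0" "h \<in> {0..1}" "h < e" using e(1) by (auto simp: h_def)
    then have "k * (\<tau> h - t) > 0" using e(2)[of h] \<tau>(1) by (simp add: algebra_simps)
    moreover have "connected (\<tau> ` {0..1})" by (rule connected_continuous_image[OF \<tau>(2)]) simp
    ultimately show ?thesis using \<tau>(1,3) h(2) by (intro exI[of _ \<tau>] exI[of _ h] conjI)
  qed
  obtain \<tau>1 :: "real \<Rightarrow> real" and h1 where 1: "\<tau>1 0 = t" "connected (\<tau>1 ` {0..1})" "\<tau>1 ` {0..1} \<subseteq> J0" "h1 \<in> {0..1}" "\<tau>1 h1 > t"
    using reach[of 1] by auto
  obtain \<tau>2 :: "real \<Rightarrow> real" and h2 where 2: "\<tau>2 0 = t" "connected (\<tau>2 ` {0..1})" "\<tau>2 ` {0..1} \<subseteq> J0" "h2 \<in> {0..1}" "\<tau>2 h2 < t"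
    using reach[of "-1"] by auto
  have z: "(0::real) \<in> {0..1}" by simp
  have "{t..\<tau>1 h1} \<subseteq> J0"
    using connected_contains_Icc[OF 1(2), of t "\<tau>1 h1"] 1 imageI[OF z, of \<tau>1] by auto
  moreover have "{\<tau>2 h2..t} \<subseteq> J0"
    using connected_contains_Icc[OF 2(2), of "\<tau>2 h2" t] 2 imageI[OF z, of \<tau>2] by auto
  ultimately have "ball t (min (\<tau>1 h1 - t) (t - \<tau>2 h2)) \<subseteq> J0"
    by (auto simp: dist_real_def subset_iff abs_less_iff) (smt (verit))
  then show "\<exists>e>0. ball t e \<subseteq> J0" using 1(5) 2(5) by (intro exI[of _ "min (\<tau>1 h1 - t) (t - \<tau>2 h2)"]) simp
qed

text \<open>Cauchy-Schwarz in the rotation plane and the unit length of the normal bound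
  \<open>mm\<close> by the distance from the axis. The bound tends to 0 at the axis.\<close>

lemma moment_bound:
  assumes "matched m t"
  shows "\<bar>C\<bar> \<le> H * axdist (f m) + sqrt (axdist (f m))"
proof -
  obtain B \<phi> N x where gc: "good_chart H M f B \<phi> N" "x \<in> B" "\<phi> x = m" and mt: "match_pt (f m) (N x) t"
    using assms unfolding matched_def by auto
  have n: "N x \<bullet> N x = 1" using good_chartD(5)[OF gc(1,2)] by (simp add: unit_normal_def dot_square_norm)
  have "axdist (N x) \<le> N x \<bullet> N x" unfolding frame_inner[of "N x" "N x"] axdist_def by (simp add: power2_eq_square)
  then have an: "axdist (N x) \<le> 1" using n by simp
  have "(mm (f m) (N x))\<^sup>2 \<le> axdist (f m) * axdist (N x)"
  proof -
    have "axdist (f m) * axdist (N x) - (mm (f m) (N x))\<^sup>2 = ((f m \<bullet> a) * (N x \<bullet> b) - (f m \<bullet> b) * (N x \<bullet> a))\<^sup>2"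
      by (simp add: axdist_def mm_def power2_eq_square algebra_simps)
    then show ?thesis using zero_le_power2[of "(f m \<bullet> a) * (N x \<bullet> b) - (f m \<bullet> b) * (N x \<bullet> a)"] by linarith
  qed
  also have "\<dots> \<le> axdist (f m) * 1" using an by (intro mult_left_mono) (auto simp: axdist_def)
  finally have "\<bar>mm (f m) (N x)\<bar> \<le> sqrt (axdist (f m))" by (simp add: real_le_rsqrt)
  moreover have "H * axdist (f m) + mm (f m) (N x) = C" using mt unfolding match_pt_def by blast
  moreover have "H * axdist (f m) \<ge> 0" using H0 by (simp add: axdist_def)
  ultimately show ?thesis by linarith
qed

context
  fixes t0 :: real
  assumes t0: "t0 \<in> J0"
begin

text \<open>Passing to the component of \<open>t0\<close> makes the parameter set connected;
  \<open>A\<close> collects the points matched at times of this component only.\<close>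

definition J :: "real set" where "J = connected_component_set J0 t0"
definition A :: "'m set" where "A = {m. \<exists>t\<in>J. matched m t}"

lemma J: "open J" "connected J" "t0 \<in> J" "J \<subseteq> J0"
  using t0 open_J0 by (auto simp: J_def open_connected_component connected_component_subset connected_component_refl)

text \<open>The match at \<open>\<phi> z1\<close> may come from another chart, so its normal must
  first be compared with \<open>N\<close>. For \<open>H > 0\<close> they agree; for
  \<open>H = 0\<close> the chart may be used with the normal \<open>- N\<close>.\<close>

lemma A_local:
  assumes gc: "good_chart H M f B \<phi> N" and S: "convex S" "S \<subseteq> B" "\<And>z. z \<in> S \<Longrightarrow> axdist (f (\<phi> z)) > 0"
    and z: "z1 \<in> S" "z2 \<in> S" and m: "\<phi> z1 \<in> A"
  shows "\<phi> z2 \<in> A"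
proof -
  obtain t B' \<phi>' N' x' where t: "t \<in> J" and gc': "good_chart H M f B' \<phi>' N'" "x' \<in> B'" "\<phi>' x' = \<phi> z1"
    and mt: "match_pt (f (\<phi> z1)) (N' x') t"
    using m unfolding A_def matched_def by auto
  have zB: "z1 \<in> B" using S(2) z(1) by blast
  have fin: "\<phi> z2 \<in> A" if gc1: "good_chart H M f B \<phi> N1" and eq: "N1 z1 = N' x'" for N1
  proof -
    have m1: "match_pt (f (\<phi> z1)) (N1 z1) t" using mt eq by simp
    obtain t' where "matched (\<phi> z2) t'" "connected_component J0 t t'"
      using matched_segment[OF gc1 S z m1] by blast
    then show ?thesis using t unfolding A_def J_def by (auto intro: connected_component_trans)
  qed
  have "N z1 = N' x' \<or> (H = 0 \<and> - N z1 = N' x')"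
  proof (cases "H = 0")
    case True
    then show ?thesis using normals_agree_or_opposite[OF gc gc'(1) zB gc'(2) gc'(3)[symmetric]] by auto
  next
    case False
    then have "H > 0" using H0 by simp
    then show ?thesis using normals_agree[OF _ gc gc'(1) zB gc'(2) gc'(3)[symmetric] S(3)[OF z(1)]] by blast
  qed
  then show ?thesis
  proof (elim disjE conjE)
    assume h: "H = 0" "- N z1 = N' x'"
    have "good_chart H M f B \<phi> (\<lambda>x. - N x)" using good_chart_minus gc unfolding h(1) by blast
    from fin[OF this] h(2) show ?thesis by simp
  qed (rule fin[OF gc])
qed

lemma off_axis_dichotomy:
  assumes m: "m \<in> M" "axdist (f m) > 0"
  shows "\<exists>W. openin (top_of_set M) W \<and> m \<in> W \<and> (W \<subseteq> A \<or> W \<inter> A = {})"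
proof -
  obtain B \<phi> N x where gc: "good_chart H M f B \<phi> N" "x \<in> B" "\<phi> x = m"
    using good_chart_exists[OF H0 surf cmc m(1)] .
  obtain r where r: "r > 0" "ball x r \<subseteq> B" "\<forall>z\<in>ball x r. axdist (f (\<phi> z)) > 0"
    using good_chart_ball[OF gc(1,2) m(2)[folded gc(3)] open_UNIV UNIV_I] .
  have "\<phi> ` ball x r \<subseteq> A \<or> \<phi> ` ball x r \<inter> A = {}"
    using A_local[OF gc(1) convex_ball r(2) bspec[OF r(3)]] by blast
  moreover have "m \<in> \<phi> ` ball x r" using gc(3) r(1) by force
  ultimately show ?thesis using image_open[OF gc(1) open_ball r(2)] by blast
qed

lemma A_open: "openin (top_of_set M) A"
proof (subst openin_subopen, intro ballI)
  fix m assume m: "m \<in> A"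
  then have "m \<in> M" "axdist (f m) > 0" using matched_M matched_axdist(2) by (auto simp: A_def)
  from off_axis_dichotomy[OF this] m show "\<exists>T. openin (top_of_set M) T \<and> m \<in> T \<and> T \<subseteq> A" by blast
qed

text \<open>Off the axis this is \<open>off_axis_dichotomy\<close>. At an axis point, a small
  punctured disc lies off the axis and is connected, and membership in \<open>A\<close> is locally
  constant on it.\<close>

lemma punctured_dichotomy:
  assumes m: "m \<in> M"
  shows "\<exists>W. openin (top_of_set M) W \<and> m \<in> W \<and> (W - {m} \<subseteq> A \<or> (W - {m}) \<inter> A = {})"
proof (cases "axdist (f m) > 0")
  case True
  from off_axis_dichotomy[OF m this] show ?thesis by blast
next
  case False
  moreover have "axdist (f m) \<ge> 0" by (simp add: axdist_def)
  ultimately have ax: "axdist (f m) = 0" by simp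
  obtain B \<phi> N x where gc: "good_chart H M f B \<phi> N" "x \<in> B" "\<phi> x = m"
    using good_chart_exists[OF H0 surf cmc m] .
  obtain r where r: "r > 0" "ball x r \<subseteq> B" "\<And>z. z \<in> ball x r \<Longrightarrow> z \<noteq> x \<Longrightarrow> axdist (f (\<phi> z)) > 0"
    using axis_isolated[OF gc(1,2) ax[folded gc(3)]] by blast
  define Q where "Q = \<phi> ` (ball x r - {x})"
  have QM: "Q \<subseteq> M" using local_param_subset[OF good_chartD(1)[OF gc(1)]] r(2) by (auto simp: Q_def)
  have "connected Q" unfolding Q_def
    by (rule connected_continuous_image[OF continuous_on_subset[OF local_param_continuous[OF good_chartD(1)[OF gc(1)]]]
          connected_punctured_ball]) (use r(2) in auto)
  then have R: "p \<in> A \<longleftrightarrow> q \<in> A" if "p \<in> Q" "q \<in> Q" for p q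
  proof (rule connected_equivalence_relation[OF _ that])
    fix p assume p: "p \<in> Q"
    obtain z where "z \<in> ball x r" "z \<noteq> x" "p = \<phi> z" using p unfolding Q_def by blast
    then have "axdist (f p) > 0" using r(3) by simp
    then obtain W where W: "openin (top_of_set M) W" "p \<in> W" "W \<subseteq> A \<or> W \<inter> A = {}"
      using off_axis_dichotomy p QM by blast
    have "openin (top_of_set Q) (Q \<inter> W)" using W(1) QM openin_subtopology_Int2
      by (metis openin_Int openin_subset_trans openin_open inf.assoc inf.absorb_iff1 inf_commute)
    then show "\<exists>T. openin (top_of_set Q) T \<and> p \<in> T \<and> (\<forall>q\<in>T. (p \<in> A) = (q \<in> A))"
      using W p by (intro exI[of _ "Q \<inter> W"]) auto
  qed auto
  have "\<phi> ` ball x r - {m} \<subseteq> Q" using gc(3) by (auto simp: Q_def)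
  then have "\<phi> ` ball x r - {m} \<subseteq> A \<or> (\<phi> ` ball x r - {m}) \<inter> A = {}" using R by blast
  moreover have "m \<in> \<phi> ` ball x r" using gc(3) r(1) by force
  ultimately show ?thesis using image_open[OF gc(1) open_ball r(2)] by blast
qed

text \<open>Connectedness is given for \<open>M\<close>, not for its part off the axis. The property
  \<open>P\<close>, that a punctured neighbourhood lies in \<open>A\<close>, is meaningful at axis
  points too and is locally constant on all of \<open>M\<close>; it therefore spreads from
  \<open>m0\<close> everywhere.\<close>

lemma off_axis_matched:
  assumes m: "m \<in> M" "axdist (f m) > 0"
  shows "m \<in> A"
proof -
  define P where "P m \<longleftrightarrow> (\<exists>W. openin (top_of_set M) W \<and> m \<in> W \<and> W - {m} \<subseteq> A)" for m
  \<comment> \<open>A punctured neighbourhood inside \<open>A\<close> and one disjoint from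
    \<open>A\<close> would intersect in the empty set, leaving \<open>m\<close> isolated.\<close>
  have notP: "\<not> P m" if "m \<in> M" "openin (top_of_set M) W" "m \<in> W" "(W - {m}) \<inter> A = {}" for m W
  proof
    assume "P m"
    then obtain W' where "openin (top_of_set M) W'" "m \<in> W'" "W' - {m} \<subseteq> A" unfolding P_def by blast
    then show False using singleton_inter[of W W' m] that by blast
  qed
  obtain m0 where "matched m0 t0" using t0 by (auto simp: J0_def)
  then have m0: "m0 \<in> A" using J(3) by (auto simp: A_def)
  then have m0M: "m0 \<in> M" using matched_M by (auto simp: A_def)
  have "connected M" using surf unfolding immersed_surface_S3_def by blast
  then have "P m0 \<longleftrightarrow> P m"
  proof (rule connected_equivalence_relation[OF _ m0M m(1)])
    fix p assume p: "p \<in> M"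
    obtain W where W: "openin (top_of_set M) W" "p \<in> W" "W - {p} \<subseteq> A \<or> (W - {p}) \<inter> A = {}"
      using punctured_dichotomy[OF p] by blast
    have "P p \<longleftrightarrow> P q" if q: "q \<in> W" for q
    proof (cases "q = p")
      case False
      have qM: "q \<in> M" using W(1) q openin_imp_subset by blast
      from W(3) show ?thesis
      proof
        assume s: "W - {p} \<subseteq> A"
        then have "q \<in> A" using q False by blast
        then have "P q" unfolding P_def using A_open by blast
        moreover have "P p" unfolding P_def using W s by blast
        ultimately show ?thesis by blast
      next
        assume s: "(W - {p}) \<inter> A = {}"
        have "openin (top_of_set M) (W - {p})"
          using openin_Int[OF W(1), of "M - {p}"] openin_delete[OF openin_subtopology_self, of M p]
          by (metis W(1) openin_delete)
        then have "\<not> P q" using notP[OF qM, of "W - {p}"] q False s by blast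
        moreover have "\<not> P p" using notP[OF p W(1,2)] s by blast
        ultimately show ?thesis by blast
      qed
    qed simp
    then show "\<exists>T. openin (top_of_set M) T \<and> p \<in> T \<and> (\<forall>q\<in>T. P p = P q)" using W by blast
  qed auto
  moreover have "P m0" unfolding P_def using A_open m0 by blast
  ultimately have Pm: "P m" by blast
  obtain W where W: "openin (top_of_set M) W" "m \<in> W" "W \<subseteq> A \<or> W \<inter> A = {}"
    using off_axis_dichotomy[OF m] by blast
  then show "m \<in> A" using notP[OF m(1) W(1,2)] Pm by blast
qed

text \<open>All points close to an axis point, other than itself, are off the axis and hence
  matched; \<open>moment_bound\<close> bounds \<open>\<bar>C\<bar>\<close> there by the continuous
  function \<open>q\<close>, which vanishes at the axis point.\<close>

lemma axis_point_C:
  assumes m: "m \<in> M" "axdist (f m) = 0"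
  shows "C = 0"
proof (rule ccontr)
  assume C: "C \<noteq> 0"
  obtain B \<phi> N x where gc: "good_chart H M f B \<phi> N" "x \<in> B" "\<phi> x = m"
    using good_chart_exists[OF H0 surf cmc m(1)] .
  obtain r where r: "r > 0" "ball x r \<subseteq> B" "\<And>z. z \<in> ball x r \<Longrightarrow> z \<noteq> x \<Longrightarrow> axdist (f (\<phi> z)) > 0"
    using axis_isolated[OF gc(1,2) m(2)[folded gc(3)]] by blast
  define q where "q = (\<lambda>z. H * axdist (f (\<phi> z)) + sqrt (axdist (f (\<phi> z))))"
  have "continuous_on B q" unfolding q_def by (intro continuous_intros continuous_axdist[OF gc(1)])
  then have "isCont q x" using gc(2) good_chartD(2)[OF gc(1)] continuous_on_eq_continuous_at by blast
  moreover have "q x = 0" using m(2) gc(3) by (simp add: q_def)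
  moreover have "\<bar>C\<bar> > 0" using C by simp
  ultimately obtain d where d: "d > 0" "\<And>z. dist z x < d \<Longrightarrow> dist (q z) 0 < \<bar>C\<bar>"
    unfolding continuous_at_eps_delta by metis
  define z where "z = x + (min r d / 2) *\<^sub>R axis 1 1"
  have "dist z x = min r d / 2" using r(1) d(1) by (simp add: z_def dist_norm)
  then have z: "dist z x < r" "dist z x < d" "z \<noteq> x" using r(1) d(1) by auto
  then have zb: "z \<in> ball x r" by (simp add: dist_commute)
  have "\<phi> z \<in> M" using local_param_subset[OF good_chartD(1)[OF gc(1)]] r(2) zb by blast
  then have "\<phi> z \<in> A" using off_axis_matched r(3)[OF zb z(3)] by blast
  then obtain t where "matched (\<phi> z) t" unfolding A_def by blast
  from moment_bound[OF this] d(2)[OF z(2)] show False by (simp add: q_def)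
qed

end

end

section \<open>The parametrization\<close>

context rot_profile
begin

text \<open>The last two vectors absorb the factor \<open>u\<close>: the coordinates of
  \<open>u * Z\<close> with respect to \<open>c\<close>, \<open>d\<close> are those of
  \<open>Z\<close> with respect to \<open>e 3\<close>, \<open>e 4\<close>.\<close>

definition e :: "4 \<Rightarrow> real^4" where
  "e i = (if i = 1 then a else if i = 2 then b else if i = 3 then Re u *\<^sub>R c + Im u *\<^sub>R d
     else Re u *\<^sub>R d - Im u *\<^sub>R c)"

lemma e_simps: "e 1 = a" "e 2 = b" "e 3 = Re u *\<^sub>R c + Im u *\<^sub>R d" "e 4 = Re u *\<^sub>R d - Im u *\<^sub>R c"
  by (simp_all add: e_def)

lemma orthonormal_e:
  assumes "norm u = 1"
  shows "orthonormal_basis e"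
proof -
  have "(Re u)\<^sup>2 + (Im u)\<^sup>2 = 1" using assms by (metis cmod_power2 one_power2)
  then have "Re u * Re u + Im u * Im u = 1" by (simp add: power2_eq_square)
  then show ?thesis
    unfolding orthonormal_basis_def forall_4 e_simps
    by (simp add: inner_add_left inner_add_right inner_diff_left inner_diff_right frame_simps)
qed

abbreviation param :: "real \<Rightarrow> real \<Rightarrow> real^4" where
  "param \<theta> t \<equiv> rot_param (basis_at e C1 mo.p mo.\<Xi> t) (radius C1 mo.p mo.\<Xi>) (angle H C C1 C2 mo.p mo.\<Xi>) \<theta> t"

lemma param_eq:
  "param \<theta> t = (sqrt (mo.X t) * cos \<theta>) *\<^sub>R a + (sqrt (mo.X t) * sin \<theta>) *\<^sub>R b
     + Re (u * mo.Z t) *\<^sub>R c + Im (u * mo.Z t) *\<^sub>R d"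
  unfolding mo.rot_param_model e_simps by (simp add: algebra_simps)

lemma matched_param:
  assumes "matched m t"
  shows "\<exists>\<theta>. f m = param \<theta> t"
proof -
  have X: "(f m \<bullet> a)\<^sup>2 + (f m \<bullet> b)\<^sup>2 = mo.X t" and z: "zc (f m) = u * mo.Z t"
    using assms unfolding matched_def match_pt_def axdist_def by blast+
  have Xp: "mo.X t > 0" by (rule mo.X_pos)
  have "(f m \<bullet> a / sqrt (mo.X t))\<^sup>2 + (f m \<bullet> b / sqrt (mo.X t))\<^sup>2 = 1"
    using X Xp by (simp add: power_divide flip: add_divide_distrib)
  then obtain \<theta> where \<theta>: "f m \<bullet> a / sqrt (mo.X t) = cos \<theta>" "f m \<bullet> b / sqrt (mo.X t) = sin \<theta>"
    by (rule sincos_total_2pi)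
  then have ab: "f m \<bullet> a = sqrt (mo.X t) * cos \<theta>" "f m \<bullet> b = sqrt (mo.X t) * sin \<theta>"
    using Xp by (simp_all add: field_simps)
  have cd: "f m \<bullet> c = Re (u * mo.Z t)" "f m \<bullet> d = Im (u * mo.Z t)"
    unfolding z[symmetric] by (simp_all add: zc_def)
  have "f m = param \<theta> t" unfolding param_eq ab[symmetric] cd[symmetric] by (rule frame_expand)
  then show ?thesis by blast
qed

lemma rot_param_shift: "rot a b \<phi> (param \<theta> t) = param (\<phi> + \<theta>) t"
proof -
  have "param \<theta> t \<bullet> a = sqrt (mo.X t) * cos \<theta>" "param \<theta> t \<bullet> b = sqrt (mo.X t) * sin \<theta>"
    unfolding param_eq by (simp_all add: inner_add_left frame_simps)
  then show ?thesis unfolding rot_def unfolding param_eq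
    by (simp add: cos_add sin_add algebra_simps)
qed

lemma param_off_axis: "param \<theta> t \<notin> rot_axis e"
proof
  assume "param \<theta> t \<in> rot_axis e"
  then have "param \<theta> t \<bullet> a = 0" "param \<theta> t \<bullet> b = 0" by (auto simp: rot_axis_def e_simps)
  then have "sqrt (mo.X t) * cos \<theta> = 0" "sqrt (mo.X t) * sin \<theta> = 0"
    unfolding param_eq by (simp_all add: inner_add_left frame_simps)
  then have "cos \<theta> = 0" "sin \<theta> = 0" using mo.X_pos[of t] by auto
  then show False using sin_cos_squared_add[of \<theta>] by simp
qed

text \<open>Surface points off the axis are matched at a time in \<open>J\<close>, and axis points
  occur only for \<open>C = 0\<close>, where they are removed. Conversely each time in
  \<open>J\<close> is attained by some point, whose rotations supply all values of \<theta>;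
  parametrized points never meet the axis.\<close>

lemma image_eq_param:
  assumes t0: "t0 \<in> J0"
  shows "f ` M - (if C = 0 then rot_axis e else {}) = {param \<theta> t | \<theta> t. t \<in> J t0}"
proof (intro equalityI subsetI)
  fix y assume y: "y \<in> f ` M - (if C = 0 then rot_axis e else {})"
  then obtain m where m: "m \<in> M" "y = f m" by blast
  have "axdist (f m) \<noteq> 0"
  proof
    assume ax: "axdist (f m) = 0"
    have "C = 0" by (rule axis_point_C[OF t0 m(1) ax])
    moreover have "f m \<in> rot_axis e"
      using ax by (simp add: rot_axis_def e_simps axdist_def sum_power2_eq_zero_iff)
    ultimately show False using y m(2) by simp
  qed
  moreover have "axdist (f m) \<ge> 0" by (simp add: axdist_def)
  ultimately have "m \<in> A t0" by (intro off_axis_matched[OF t0 m(1)]) simp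
  then obtain t where "t \<in> J t0" "matched m t" unfolding A_def[OF t0] by blast
  then show "y \<in> {param \<theta> t | \<theta> t. t \<in> J t0}" using matched_param m(2) by blast
next
  fix y assume "y \<in> {param \<theta> t | \<theta> t. t \<in> J t0}"
  then obtain \<theta> t where y: "y = param \<theta> t" "t \<in> J t0" by blast
  then obtain m where mt: "matched m t" using J(4)[OF t0] by (auto simp: J0_def)
  obtain \<theta>0 where th: "f m = param \<theta>0 t" using matched_param[OF mt] by blast
  have "y = rot a b (\<theta> - \<theta>0) (f m)" unfolding th rot_param_shift y(1) by simp
  then have "y \<in> f ` M" using rot[of "\<theta> - \<theta>0"] matched_M[OF mt] by blast
  moreover have "y \<notin> rot_axis e" unfolding y(1) by (rule param_off_axis)
  ultimately show "y \<in> f ` M - (if C = 0 then rot_axis e else {})" by (split if_split) blast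
qed

end

context model_profile
begin

lemma roots: "{x. poly (p_poly H C) x = 0} = {C1, C2}"
proof -
  have "poly (p_poly H C) x = - ((H\<^sup>2 + 1) * ((C1 - x) * (x - C2)))" for x
    unfolding poly_factor by (simp add: p_poly_def power2_eq_square algebra_simps)
  moreover have "H\<^sup>2 + 1 > 0" by (simp add: add_nonneg_pos)
  ultimately show ?thesis by auto
qed

lemma p_sq_range: "p\<^sup>2 \<in> {0..1}"
  using p_bounds by (simp add: power_le_one)

end

section \<open>Assembly of the classification\<close>

lemma orthonormal4_extend:
  fixes a b :: "real^4"
  assumes "norm a = 1" "norm b = 1" "a \<bullet> b = 0"
  obtains c d where "frame4 a b c d"
proof -
  have ex: "\<exists>x. norm x = 1 \<and> (\<forall>y\<in>S. x \<bullet> y = 0)" if "finite S" "card S \<le> 3" for S :: "(real^4) set"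
  proof -
    have "dim S < DIM(real^4)" using dim_le_card'[OF that(1)] that(2) by simp
    then obtain x where x: "x \<noteq> 0" "\<And>y. y \<in> span S \<Longrightarrow> orthogonal x y"
      using orthogonal_to_subspace_exists by blast
    then show ?thesis
      by (intro exI[of _ "x /\<^sub>R norm x"]) (auto simp: orthogonal_def span_base)
  qed
  obtain c where c: "norm c = 1" "c \<bullet> a = 0" "c \<bullet> b = 0"
  proof -
    have "card {a, b} \<le> 3" by (simp add: card_insert_if)
    from ex[OF _ this] show ?thesis using that by auto
  qed
  obtain d where d: "norm d = 1" "d \<bullet> a = 0" "d \<bullet> b = 0" "d \<bullet> c = 0"
  proof -
    have "card {a, b, c} \<le> 3" by (simp add: card_insert_if)
    from ex[OF _ this] show ?thesis using that by auto
  qed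
  have "frame4 a b c d"
    using assms c d by unfold_locales (auto simp: dot_square_norm inner_commute)
  then show ?thesis by (rule that)
qed

theorem theorem4p6:
  fixes M :: "'m::{t2_space,second_countable_topology} set"
    and f :: "'m \<Rightarrow> real^4"
    and H :: real
  assumes "H \<ge> 0"
    and "immersed_surface_S3 M f"
    and "constant_mean_curvature M f H"
    and "rotational (f ` M)"
  shows "\<exists>(e :: 4 \<Rightarrow> real^4) (C :: real) (C1 :: real) (C2 :: real) (p :: real) (\<Xi> :: real) (J :: real set).
    orthonormal_basis e \<and>
    {x. poly (p_poly H C) x = 0} = {C1, C2} \<and> 0 \<le> C2 \<and> C2 \<le> C1 \<and>
    0 \<le> p \<and> p\<^sup>2 = (C1 - C2) / C1 \<and> p\<^sup>2 \<in> {0..1} \<and>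
    \<Xi> = sqrt ((H\<^sup>2 + 1) * C1) \<and>
    open J \<and> connected J \<and> J \<noteq> {} \<and>
    f ` M - (if C = 0 then rot_axis e else {}) =
      {rot_param (basis_at e C1 p \<Xi> t) (radius C1 p \<Xi>) (angle H C C1 C2 p \<Xi>) \<theta> t | \<theta> t. t \<in> J}"
proof -
  obtain a b where ab: "norm a = 1" "norm b = 1" "a \<bullet> b = 0" "\<And>\<phi>. rot a b \<phi> ` (f ` M) = f ` M"
    using assms(4) unfolding rotational_def by blast
  obtain c d where fr: "frame4 a b c d" using orthonormal4_extend[OF ab(1-3)] .
  interpret rs: rot_surface a b c d M f H
    by (intro rot_surface.intro fr rot_surface_axioms.intro) (use assms ab(4) in auto)
  \<comment> \<open>An arbitrary point off the axis supplies the initial state.\<close>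
  obtain m where m: "m \<in> M" "rs.axdist (f m) > 0" using rs.off_axis_point by blast
  obtain B \<phi> N x where gc: "good_chart H M f B \<phi> N" "x \<in> B" "\<phi> x = m"
    using good_chart_exists[OF assms(1-3) m(1)] .
  define y n where "y = f m" and "n = N x"
  obtain L where L: "cmc_at H (f \<circ> \<phi>) N x L" using rs.good_chartD(4)[OF gc(1,2)] by blast
  have yx: "(f \<circ> \<phi>) x = y" using gc(3) by (simp add: y_def)
  have ax: "rs.axdist y > 0" using m(2) by (simp add: y_def)
  interpret pt: normal_pt a b c d y n
    using rs.cmc_normal_pt[OF L rs.good_chartD(6)[OF gc(1,2)]] ax unfolding yx n_def by blast
  \<comment> \<open>The conserved moment, read off at the initial point with the normal of the
    chosen chart; the roots and the model depend on this value.\<close>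
  define C where "C = H * rs.axdist y + rs.mm y n"
  have mmC: "rs.mm y n = C - H * rs.axdist y" by (simp add: C_def)
  have en: "(rs.del y n)\<^sup>2 * rs.axdist y = rs.axdist y - (rs.axdist y)\<^sup>2 - (C - H * rs.axdist y)\<^sup>2"
    using pt.del_sq unfolding mmC[symmetric] pt.mm_k by (simp add: power2_eq_square)
  have le1: "rs.axdist y \<le> 1" using pt.norm_z zero_le_power2[of "norm (rs.zc y)"] by linarith
  obtain C1 C2 where mo: "model_profile H C C1 C2" "C2 \<le> rs.axdist y" "rs.axdist y \<le> C1"
    using model_profile_exists[OF ax le1 en] .
  interpret mo: model_profile H C C1 C2 by (rule mo(1))
  obtain t0 u where t0: "mo.X t0 = rs.axdist y" "mo.Del t0 = rs.del y n" "norm u = 1"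
    "rs.zc y = u * mo.Z t0" "rs.zc (rs.V y n) = u * mo.V t0"
    using mo.initial_match[OF ax mo(2,3) en pt.norm_z pt.v_cnj_z[unfolded mmC] pt.norm_v] .
  interpret rp: rot_profile a b c d M f H C C1 C2 u
    by (intro rot_profile.intro rs.rot_surface_axioms profile_match.intro fr mo(1))
  have "rp.match_pt (f (\<phi> x)) (N x) t0"
    unfolding rp.match_pt_def gc(3) y_def[symmetric] n_def[symmetric] C_def[symmetric]
    by (simp only: t0 simp_thms)
  then have "rp.matched m t0" using rp.matchedI[OF gc(1,2)] gc(3) by simp
  then have t0J: "t0 \<in> rp.J0" unfolding rp.J0_def by blast
  show ?thesis
  proof (intro exI conjI)
    show "orthonormal_basis rp.e" by (rule rp.orthonormal_e[OF t0(3)])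
    show "{x. poly (p_poly H C) x = 0} = {C1, C2}" by (rule mo.roots)
    show "0 \<le> C2" "C2 \<le> C1" by (rule mo.C2_nonneg mo.C2_le)+
    show "0 \<le> mo.p" "mo.p\<^sup>2 = (C1 - C2) / C1" "mo.p\<^sup>2 \<in> {0..1}"
      by (rule mo.p_bounds(1) mo.p_sq(1) mo.p_sq_range)+
    show "mo.\<Xi> = sqrt ((H\<^sup>2 + 1) * C1)" by (rule mo.\<Xi>_def)
    show "open (rp.J t0)" "connected (rp.J t0)" by (rule rp.J(1,2)[OF t0J])+
    show "rp.J t0 \<noteq> {}" using rp.J(3)[OF t0J] by blast
    show "f ` M - (if C = 0 then rot_axis rp.e else {}) = {rp.param \<theta> t | \<theta> t. t \<in> rp.J t0}"
      by (rule rp.image_eq_param[OF t0J])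
  qed
qed

end
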